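(* Let $p\ge 3$ be a prime, let $r\equiv a \bmod (p-1)$ with $1\le a\le p-1$, let $r\equiv r_0\bmod p$ with $0\le r_0\le p-1$, and let $1\le i<[a-i]<p-1$. If $r\ge i(p+1)+p$, then there is an exact sequence of $\Gamma$-modules $$0\to W\to Q(i)\to Q(i-1)\to 0,$$ where $W=V_{p-1-[a-2i]}\otimes D^{a-i}$ if $\binom{r-[a-i]-1}{i}\not\equiv 0\bmod p$, and $W=V_r^{(i)}/V_r^{(i+1)}$ otherwise.
   Context: Let $\Gamma=\mathrm{GL}_2(\mathbb{F}_p)$ and $D:\Gamma\to\mathbb{F}_p^\ast$ the determinant character. For an integer $n$, $[n]\in\{1,2,\dots,p-1\}$ denotes the element with $[n]\equiv n\bmod (p-1)$. $V_r$ is the $\mathbb{F}_p$-space of homogeneous polynomials $F(X,Y)$ of degree $r$ over $\mathbb{F}_p$, with action $\begin{pmatrix} a&b\\c&d\end{pmatrix}\cdot F(X,Y)=F(aX+cY,\,bX+dY)$. $X_{r-l}=X_{r-l,\,r}\subseteq V_r$ is the $\mathbb{F}_p[\Gamma]$-submodule generated by $X^{r-l}Y^{l}$. Let $\theta=X^pY-XY^p$ and, for $m\ge0$, $V_r^{(m)}=\{F\in V_r:\theta^m\mid F\}$, a $\Gamma$-submodule of $V_r$. For $l\ge0$, $Q(l)=V_r/(X_{r-l}+V_r^{(l+1)})$ (both $Q(i)$ and $Q(i-1)$ are formed from the same $V_r$). *)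

theory Defs
  imports
    "HOL-Algebra.Module"
    "HOL-Algebra.AbelCoset"
    "HOL-Number_Theory.Cong"
    "HOL-Analysis.Determinants"
    "Berlekamp_Zassenhaus.Finite_Field"
begin

section \<open>Modules with a linear group action\<close>

text \<open>
  A module over a group ring \<open>R[G]\<close> is an \<open>R\<close>-module with an \<open>R\<close>-linear left action of \<open>G\<close>.
  The record extends the module record of HOL-Algebra, whose fields \<open>mult\<close> and \<open>one\<close> are
  inherited from rings and play no role for modules; below they are set to \<open>undefined\<close>.
\<close>

record ('g, 'k, 'v) gmodule = "('k, 'v) module" +
  gact :: "'g \<Rightarrow> 'v \<Rightarrow> 'v"

locale G_module = Module.module R M + \<Gamma>: group G
  for G :: "('g, 'x) monoid_scheme"
    and R :: "('k, 'y) ring_scheme"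
    and M :: "('g, 'k, 'v, 'z) gmodule_scheme" +
  assumes gact_closed:
      "\<lbrakk>g \<in> carrier G; v \<in> carrier M\<rbrakk> \<Longrightarrow> gact M g v \<in> carrier M"
    and gact_one:
      "v \<in> carrier M \<Longrightarrow> gact M \<one>\<^bsub>G\<^esub> v = v"
    and gact_mult:
      "\<lbrakk>g \<in> carrier G; h \<in> carrier G; v \<in> carrier M\<rbrakk>
        \<Longrightarrow> gact M (g \<otimes>\<^bsub>G\<^esub> h) v = gact M g (gact M h v)"
    and gact_add:
      "\<lbrakk>g \<in> carrier G; v \<in> carrier M; w \<in> carrier M\<rbrakk>
        \<Longrightarrow> gact M g (v \<oplus>\<^bsub>M\<^esub> w) = gact M g v \<oplus>\<^bsub>M\<^esub> gact M g w"
    and gact_smult: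
      "\<lbrakk>g \<in> carrier G; c \<in> carrier R; v \<in> carrier M\<rbrakk>
        \<Longrightarrow> gact M g (c \<odot>\<^bsub>M\<^esub> v) = c \<odot>\<^bsub>M\<^esub> gact M g v"

definition G_submodule ::
    "('g, 'x) monoid_scheme \<Rightarrow> ('k, 'y) ring_scheme \<Rightarrow> ('g, 'k, 'v, 'z) gmodule_scheme
      \<Rightarrow> 'v set \<Rightarrow> bool" where
  "G_submodule G R M U \<longleftrightarrow>
    submodule U R M \<and> (\<forall>g\<in>carrier G. \<forall>u\<in>U. gact M g u \<in> U)"

definition G_generated ::
    "('g, 'x) monoid_scheme \<Rightarrow> ('k, 'y) ring_scheme \<Rightarrow> ('g, 'k, 'v, 'z) gmodule_scheme
      \<Rightarrow> 'v \<Rightarrow> 'v set" where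
  "G_generated G R M v = \<Inter>{U. G_submodule G R M U \<and> v \<in> U}"

definition G_quotient ::
    "('g, 'k, 'v, 'z) gmodule_scheme \<Rightarrow> 'v set \<Rightarrow> ('g, 'k, 'v set) gmodule" where
  "G_quotient M U =
    \<lparr>carrier = a_rcosets\<^bsub>M\<^esub> U, mult = undefined, one = undefined,
     zero = U, add = set_add M,
     module.smult = (\<lambda>c A. \<Union>x\<in>A. U +>\<^bsub>M\<^esub> (c \<odot>\<^bsub>M\<^esub> x)),
     gact = (\<lambda>g A. \<Union>x\<in>A. U +>\<^bsub>M\<^esub> gact M g x)\<rparr>"

text \<open>The tensor product of \<open>M\<close> with a character \<open>\<psi> : G \<rightarrow> R\<^sup>*\<close>, realised on the same
  underlying \<open>R\<close>-module: \<open>g\<close> acts as \<open>\<psi>(g)\<close> times its action on \<open>M\<close>.\<close>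

definition twist ::
    "('g, 'k, 'v) gmodule \<Rightarrow> ('g \<Rightarrow> 'k) \<Rightarrow> ('g, 'k, 'v) gmodule" where
  "twist M \<psi> = M\<lparr>gact := (\<lambda>g v. \<psi> g \<odot>\<^bsub>M\<^esub> gact M g v)\<rparr>"

definition G_hom ::
    "('g, 'x) monoid_scheme \<Rightarrow> ('k, 'y) ring_scheme \<Rightarrow> ('g, 'k, 'v, 'z) gmodule_scheme
      \<Rightarrow> ('g, 'k, 'w, 'u) gmodule_scheme \<Rightarrow> ('v \<Rightarrow> 'w) set" where
  "G_hom G R M N =
    {f \<in> hom (add_monoid M) (add_monoid N).
      (\<forall>c\<in>carrier R. \<forall>v\<in>carrier M. f (c \<odot>\<^bsub>M\<^esub> v) = c \<odot>\<^bsub>N\<^esub> f v) \<and>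
      (\<forall>g\<in>carrier G. \<forall>v\<in>carrier M. f (gact M g v) = gact N g (f v))}"

definition short_exact ::
    "('g, 'x) monoid_scheme \<Rightarrow> ('k, 'y) ring_scheme \<Rightarrow> ('g, 'k, 'u) gmodule
      \<Rightarrow> ('u \<Rightarrow> 'v) \<Rightarrow> ('g, 'k, 'v) gmodule \<Rightarrow> ('v \<Rightarrow> 'w) \<Rightarrow> ('g, 'k, 'w) gmodule
      \<Rightarrow> bool" where
  "short_exact G R L f M h N \<longleftrightarrow>
    G_module G R L \<and> G_module G R M \<and> G_module G R N \<and>
    f \<in> G_hom G R L M \<and> h \<in> G_hom G R M N \<and>
    inj_on f (carrier L) \<and>
    f ` carrier L = a_kernel M N h \<and>
    h ` carrier M = carrier N"


section \<open>Binary forms over the prime field\<close>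

text \<open>The field \<open>F\<^sub>p\<close> is the type \<open>'p mod_ring\<close> with \<open>p = CARD('p)\<close>.\<close>

definition Fp :: "'p::prime_card mod_ring ring" where
  "Fp = \<lparr>carrier = UNIV, mult = (*), one = 1, zero = 0, add = (+)\<rparr>"

definition GL2 :: "('p::prime_card mod_ring^2^2) monoid" where
  "GL2 = \<lparr>carrier = {A. invertible A}, mult = (**), one = mat 1\<rparr>"

text \<open>The polynomial ring \<open>F\<^sub>p[X,Y]\<close> is represented as \<open>F\<^sub>p[X][Y]\<close>, with the coefficient of
  \<open>X\<^sup>i Y\<^sup>j\<close> in \<open>F\<close> given by \<open>coeff (coeff F j) i\<close>.\<close>

type_synonym 'p bipoly = "'p mod_ring poly poly"

definition const :: "'p::prime_card mod_ring \<Rightarrow> 'p bipoly" where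
  "const c = [:[:c:]:]"

definition varX :: "'p::prime_card bipoly" where
  "varX = [:[:0, 1:]:]"

definition varY :: "'p::prime_card bipoly" where
  "varY = [:0, 1:]"

definition homogeneous :: "nat \<Rightarrow> 'p::prime_card bipoly \<Rightarrow> bool" where
  "homogeneous r F \<longleftrightarrow> (\<forall>i j. coeff (coeff F j) i \<noteq> 0 \<longrightarrow> i + j = r)"

text \<open>\<open>substXY F S T\<close> is \<open>F(S,T)\<close>.\<close>

definition substXY :: "'p::prime_card bipoly \<Rightarrow> 'p bipoly \<Rightarrow> 'p bipoly \<Rightarrow> 'p bipoly" where
  "substXY F S T =
    (\<Sum>j\<le>degree F. \<Sum>i\<le>degree (coeff F j). const (coeff (coeff F j) i) * S ^ i * T ^ j)"

definition V ::
    "nat \<Rightarrow> ('p::prime_card mod_ring^2^2, 'p mod_ring, 'p bipoly) gmodule" where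
  "V r =
    \<lparr>carrier = {F. homogeneous r F}, mult = undefined, one = undefined,
     zero = 0, add = (+),
     module.smult = (\<lambda>c F. const c * F),
     gact = (\<lambda>A F. substXY F
        (const (A$1$1) * varX + const (A$2$1) * varY)
        (const (A$1$2) * varX + const (A$2$2) * varY))\<rparr>"

definition theta :: "'p::prime_card bipoly" where
  "theta = varX ^ CARD('p) * varY - varX * varY ^ CARD('p)"

definition V_filt :: "nat \<Rightarrow> nat \<Rightarrow> 'p::prime_card bipoly set" where
  "V_filt r m = {F \<in> carrier (V r). theta ^ m dvd F}"

text \<open>\<open>X_sub r l\<close> is the submodule \<open>X\<^bsub>r-l,r\<^esub>\<close> of \<open>V r\<close>; it is only meaningful for \<open>l \<le> r\<close>.\<close>

definition X_sub :: "nat \<Rightarrow> nat \<Rightarrow> 'p::prime_card bipoly set" where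
  "X_sub r l = G_generated GL2 Fp (V r) (varX ^ (r - l) * varY ^ l)"

definition Q ::
    "nat \<Rightarrow> nat \<Rightarrow> ('p::prime_card mod_ring^2^2, 'p mod_ring, 'p bipoly set) gmodule" where
  "Q r l = G_quotient (V r) (X_sub r l <+>\<^bsub>V r\<^esub> V_filt r (l + 1))"

text \<open>The subquotient \<open>V\<^sub>r\<^sup>(\<^sup>m\<^sup>) / V\<^sub>r\<^sup>(\<^sup>n\<^sup>)\<close>, for \<open>m \<le> n\<close>.\<close>

definition V_subquot ::
    "nat \<Rightarrow> nat \<Rightarrow> nat
      \<Rightarrow> ('p::prime_card mod_ring^2^2, 'p mod_ring, 'p bipoly set) gmodule" where
  "V_subquot r m n = G_quotient ((V r)\<lparr>carrier := V_filt r m\<rparr>) (V_filt r n)"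

text \<open>The integral power \<open>D\<^sup>n\<close> of the determinant character.\<close>

definition det_char :: "int \<Rightarrow> 'p::prime_card mod_ring^2^2 \<Rightarrow> 'p mod_ring" where
  "det_char n A = det A powi n"

text \<open>The representative \<open>[n]\<close> of \<open>n\<close> modulo \<open>p - 1\<close> in \<open>{1, \<dots>, p - 1}\<close>.\<close>

definition bracket :: "nat \<Rightarrow> int \<Rightarrow> nat" where
  "bracket p n = (THE m. m \<in> {1..p - 1} \<and> [int m = n] (mod (int p - 1)))"

end

theory Submission
  imports Defs "HOL-Computational_Algebra.Formal_Power_Series"
begin

text \<open>
  Put \<open>c = [a - i]\<close>, so that \<open>r \<equiv> c + i\<close> modulo \<open>p - 1\<close> and \<open>[a - 2i] = c - i\<close>. If the generator
  \<open>X\<^bsup>r-i\<^esup> Y\<^sup>i\<close> lies in \<open>X\<^bsub>r-i+1\<^esub> + V\<^sub>r\<^bsup>(i)\<^esup>\<close>, then \<open>Q(i - 1)\<close> is a quotient of \<open>Q(i)\<close>. Since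
  \<open>X\<^bsub>r-i+1\<^esub> \<subseteq> X\<^bsub>r-i\<^esub>\<close>, the kernel is the image of \<open>V\<^sub>r\<^bsup>(i)\<^esup>\<close>, that is, the quotient of
  \<open>V\<^sub>r\<^bsup>(i)\<^esup>/V\<^sub>r\<^bsup>(i+1)\<^esup>\<close> by the part that comes from \<open>X\<^bsub>r-i\<^esub>\<close>. The theorem says that this part is
  zero if the binomial coefficient vanishes modulo \<open>p\<close>, and otherwise is the kernel of the
  projection to \<open>V\<^bsub>p-1-(c-i)\<^esub> \<otimes> D\<^sup>c\<close>.

  A form is studied through \<open>f = F(X, 1)\<close> and its Hasse derivatives at the points of \<open>F\<^sub>p\<close>: it is
  divisible by \<open>\<theta>\<^sup>m\<close> iff it vanishes to order \<open>m\<close> at all points of the projective line over \<open>F\<^sub>p\<close>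
  (\<open>theta_power_dvdE\<close>). On \<open>X\<^bsub>r-i\<^esub>\<close>, which is spanned by products \<open>L\<^bsup>r-i\<^esup> M\<^sup>i\<close> with linear forms
  \<open>L\<close> and \<open>M\<close>, these derivatives are explicit, the exponent \<open>r\<close> may be reduced to \<open>c + i\<close>, and
  sums over \<open>F\<^sub>p\<close> extract coefficients.

  Upper bounds for \<open>X\<^bsub>r-i\<^esub>\<close> come from linear functionals that annihilate it. The sum of the \<open>i\<close>-th
  Hasse derivatives always does (\<open>jet_sum_X_sub\<close>). If the binomial coefficient vanishes, a
  weighted sum of values of Taylor polynomials does as well (\<open>taylor_sum_X_sub\<close>). On \<open>\<theta>\<^sup>i G\<close> these
  functionals give, up to sign, the sum of the values \<open>G(x, 1)\<close> over all \<open>x\<close> and over \<open>x \<noteq> 0\<close>, so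
  together they isolate a single value of \<open>G\<close>. As the group permutes the points transitively,
  \<open>X\<^bsub>r-i\<^esub> \<inter> V\<^sub>r\<^bsup>(i)\<^esup>\<close> is then contained in \<open>V\<^sub>r\<^bsup>(i+1)\<^esup>\<close> (\<open>X_sub_inter_V_filt\<close>).

  Conversely, a Lagrange combination of averages of generators is an element of \<open>X\<^bsub>r-i\<^esub>\<close> that is
  congruent modulo \<open>V\<^sub>r\<^bsup>(i+1)\<^esup>\<close> to \<open>\<theta>\<^sup>i Y\<^bsup>r-i(p+1)\<^esup>\<close> times, up to sign, the binomial coefficient
  (\<open>critical_congruence\<close>). Its components also yield the congruence for the generator
  (\<open>generator_congruence\<close>). If the coefficient does not vanish, \<open>X\<^bsub>r-i\<^esub> + V\<^sub>r\<^bsup>(i+1)\<^esup>\<close> therefore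
  contains \<open>\<theta>\<^sup>i\<close> times the module generated by \<open>Y\<^bsup>r-i(p+1)\<^esup>\<close>. The map that takes \<open>G\<close> to the sum of
  \<open>G(u, w) (u Y - w X)\<^sup>n\<close> over all \<open>(u, w)\<close>, with \<open>n = p - 1 - (c - i)\<close>, is equivariant up to a
  power of the determinant (\<open>form_trace_act\<close>) and maps onto \<open>V\<^sub>n\<close> (\<open>form_trace_surj\<close>). Modulo \<open>\<theta>\<close>
  its kernel is contained in that module (\<open>form_trace_kernel\<close>), and it annihilates the part of the
  layer that comes from \<open>X\<^bsub>r-i\<^esub>\<close> because of the first functional (\<open>form_trace_X_sub\<close>). Hence the
  kernel of \<open>Q(i) \<rightarrow> Q(i - 1)\<close> is \<open>V\<^sub>n\<close> with the twist by \<open>D\<^sup>c\<close>.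
\<close>

section \<open>Quotients of modules with a group action\<close>

lemma G_module_imp_module: "G_module G R M \<Longrightarrow> Module.module R M"
  by (simp add: G_module_def)

lemma G_module_imp_abelian_group: "G_module G R M \<Longrightarrow> abelian_group M"
  by (simp add: G_module_def Module.module_def)

lemma G_submodule_imp_abelian_subgroup:
  assumes "G_module G R M" "G_submodule G R M U"
  shows "abelian_subgroup U M"
  using assms
  by (auto intro!: abelian_subgroupI3 additive_subgroup.intro
      simp: G_submodule_def submodule_def G_module_imp_abelian_group)

lemma G_submodule_subset:
  assumes "G_submodule G R M U"
  shows "U \<subseteq> carrier M"
  using assms subgroup.subset by (fastforce simp: G_submodule_def submodule_def)

text \<open>The operations of a quotient are defined as unions over all representatives of a coset.
  For an additive map that preserves \<open>U\<close>, every representative contributes the same coset.\<close>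

lemma coset_UN_well_defined:
  assumes "abelian_subgroup U M" "v \<in> carrier M"
    and closed: "\<And>x. x \<in> carrier M \<Longrightarrow> f x \<in> carrier M"
    and add: "\<And>x y. \<lbrakk>x \<in> carrier M; y \<in> carrier M\<rbrakk> \<Longrightarrow> f (x \<oplus>\<^bsub>M\<^esub> y) = f x \<oplus>\<^bsub>M\<^esub> f y"
    and U: "\<And>u. u \<in> U \<Longrightarrow> f u \<in> U"
  shows "(\<Union>x\<in>U +>\<^bsub>M\<^esub> v. U +>\<^bsub>M\<^esub> f x) = U +>\<^bsub>M\<^esub> f v"
proof -
  interpret abelian_subgroup U M by fact
  have "U +>\<^bsub>M\<^esub> f x = U +>\<^bsub>M\<^esub> f v" if x: "x \<in> U +>\<^bsub>M\<^esub> v" for x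
  proof -
    obtain u where u: "u \<in> U" "x = u \<oplus>\<^bsub>M\<^esub> v"
      using x by (auto simp: a_r_coset_def')
    then have "f x = f u \<oplus>\<^bsub>M\<^esub> f v"
      using add assms(2) by auto
    then have "f x \<in> U +>\<^bsub>M\<^esub> f v"
      using U u by (auto simp: a_r_coset_def')
    then show ?thesis
      using a_repr_independence' closed assms(2) by metis
  qed
  moreover have "v \<in> U +>\<^bsub>M\<^esub> v"
    using assms(2) by (rule a_rcos_self)
  ultimately show ?thesis by blast
qed

lemma
  assumes M: "G_module G R M" and U: "G_submodule G R M U"
  shows carrier_G_quotient: "carrier (G_quotient M U) = (\<lambda>v. U +>\<^bsub>M\<^esub> v) ` carrier M"
    and zero_G_quotient: "zero (G_quotient M U) = U"
    and add_G_quotient: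
      "\<And>v w. \<lbrakk>v \<in> carrier M; w \<in> carrier M\<rbrakk> \<Longrightarrow>
        (U +>\<^bsub>M\<^esub> v) \<oplus>\<^bsub>G_quotient M U\<^esub> (U +>\<^bsub>M\<^esub> w) = U +>\<^bsub>M\<^esub> (v \<oplus>\<^bsub>M\<^esub> w)"
    and smult_G_quotient:
      "\<And>c v. \<lbrakk>c \<in> carrier R; v \<in> carrier M\<rbrakk> \<Longrightarrow>
        c \<odot>\<^bsub>G_quotient M U\<^esub> (U +>\<^bsub>M\<^esub> v) = U +>\<^bsub>M\<^esub> (c \<odot>\<^bsub>M\<^esub> v)"
    and gact_G_quotient:
      "\<And>g v. \<lbrakk>g \<in> carrier G; v \<in> carrier M\<rbrakk> \<Longrightarrow>
        gact (G_quotient M U) g (U +>\<^bsub>M\<^esub> v) = U +>\<^bsub>M\<^esub> gact M g v"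
proof -
  interpret abelian_subgroup U M
    by (rule G_submodule_imp_abelian_subgroup[OF M U])
  interpret Mm: G_module G R M by (rule M)
  have sub: "submodule U R M" and inv: "\<And>g u. \<lbrakk>g \<in> carrier G; u \<in> U\<rbrakk> \<Longrightarrow> gact M g u \<in> U"
    using U by (auto simp: G_submodule_def)
  show "carrier (G_quotient M U) = (\<lambda>v. U +>\<^bsub>M\<^esub> v) ` carrier M"
    by (auto simp: G_quotient_def A_RCOSETS_def')
  show "zero (G_quotient M U) = U"
    by (simp add: G_quotient_def)
  show "(U +>\<^bsub>M\<^esub> v) \<oplus>\<^bsub>G_quotient M U\<^esub> (U +>\<^bsub>M\<^esub> w) = U +>\<^bsub>M\<^esub> (v \<oplus>\<^bsub>M\<^esub> w)"
    if "v \<in> carrier M" "w \<in> carrier M" for v w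
    using that a_rcos_sum by (simp add: G_quotient_def)
  show "c \<odot>\<^bsub>G_quotient M U\<^esub> (U +>\<^bsub>M\<^esub> v) = U +>\<^bsub>M\<^esub> (c \<odot>\<^bsub>M\<^esub> v)"
    if "c \<in> carrier R" "v \<in> carrier M" for c v
    unfolding G_quotient_def gmodule.simps module.simps
    by (rule coset_UN_well_defined[OF abelian_subgroup_axioms])
      (use that submodule.smult_closed[OF sub] in \<open>auto simp: Mm.smult_r_distr\<close>)
  show "gact (G_quotient M U) g (U +>\<^bsub>M\<^esub> v) = U +>\<^bsub>M\<^esub> gact M g v"
    if "g \<in> carrier G" "v \<in> carrier M" for g v
    unfolding G_quotient_def gmodule.simps
    by (rule coset_UN_well_defined[OF abelian_subgroup_axioms])
      (use that inv in \<open>auto simp: Mm.gact_add Mm.gact_closed\<close>)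
qed

lemma G_moduleI:
  assumes "Module.module R M" "group G"
    and "\<And>g v. \<lbrakk>g \<in> carrier G; v \<in> carrier M\<rbrakk> \<Longrightarrow> gact M g v \<in> carrier M"
    and "\<And>v. v \<in> carrier M \<Longrightarrow> gact M \<one>\<^bsub>G\<^esub> v = v"
    and "\<And>g h v. \<lbrakk>g \<in> carrier G; h \<in> carrier G; v \<in> carrier M\<rbrakk>
        \<Longrightarrow> gact M (g \<otimes>\<^bsub>G\<^esub> h) v = gact M g (gact M h v)"
    and "\<And>g v w. \<lbrakk>g \<in> carrier G; v \<in> carrier M; w \<in> carrier M\<rbrakk>
        \<Longrightarrow> gact M g (v \<oplus>\<^bsub>M\<^esub> w) = gact M g v \<oplus>\<^bsub>M\<^esub> gact M g w"
    and "\<And>g c v. \<lbrakk>g \<in> carrier G; c \<in> carrier R; v \<in> carrier M\<rbrakk>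
        \<Longrightarrow> gact M g (c \<odot>\<^bsub>M\<^esub> v) = c \<odot>\<^bsub>M\<^esub> gact M g v"
  shows "G_module G R M"
  using assms by (simp add: G_module_def G_module_axioms_def)

lemma G_module_quotient:
  assumes M: "G_module G R M" and U: "G_submodule G R M U"
  shows "G_module G R (G_quotient M U)"
proof -
  interpret abelian_subgroup U M
    by (rule G_submodule_imp_abelian_subgroup[OF M U])
  interpret Mm: G_module G R M by (rule M)
  note q = carrier_G_quotient[OF M U] add_G_quotient[OF M U] smult_G_quotient[OF M U]
    gact_G_quotient[OF M U]
  have zero: "\<zero>\<^bsub>G_quotient M U\<^esub> = U +>\<^bsub>M\<^esub> \<zero>\<^bsub>M\<^esub>"
    using zero_G_quotient[OF M U] Mm.a_coset_add_zero a_subset by simp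
  have "abelian_group (G_quotient M U)"
  proof (rule abelian_groupI)
    fix A assume "A \<in> carrier (G_quotient M U)"
    then obtain v where "A = U +>\<^bsub>M\<^esub> v" "v \<in> carrier M" by (auto simp: q)
    then show "\<exists>B\<in>carrier (G_quotient M U). B \<oplus>\<^bsub>G_quotient M U\<^esub> A = \<zero>\<^bsub>G_quotient M U\<^esub>"
      by (intro bexI[of _ "U +>\<^bsub>M\<^esub> (\<ominus>\<^bsub>M\<^esub> v)"]) (auto simp: q zero l_neg)
  qed (auto simp: q zero a_assoc a_comm a_lcomm)
  then have "Module.module R (G_quotient M U)"
  proof (rule moduleI[rotated])
    show "cring R" by (rule Mm.R.is_cring)
  qed (auto simp: q Mm.smult_l_distr Mm.smult_r_distr Mm.smult_assoc1)
  then show ?thesis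
    by (rule G_moduleI)
      (auto simp: q Mm.gact_closed Mm.gact_one Mm.gact_mult Mm.gact_add Mm.gact_smult
        Mm.\<Gamma>.is_group)
qed

lemma G_module_submodule:
  assumes M: "G_module G R M" and U: "G_submodule G R M U"
  shows "G_module G R (M\<lparr>carrier := U\<rparr>)"
proof -
  interpret Mm: G_module G R M by (rule M)
  have sub: "submodule U R M" and inv: "\<And>g u. \<lbrakk>g \<in> carrier G; u \<in> U\<rbrakk> \<Longrightarrow> gact M g u \<in> U"
    using U by (auto simp: G_submodule_def)
  have "Module.module R (M\<lparr>carrier := U\<rparr>)"
    using submodule.submodule_is_module[OF sub] G_module_imp_module[OF M] by blast
  moreover have "\<And>u. u \<in> U \<Longrightarrow> u \<in> carrier M"
    using G_submodule_subset[OF U] by blast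
  ultimately show ?thesis
    by (auto intro!: G_moduleI
        simp: Mm.gact_one Mm.gact_mult Mm.gact_add Mm.gact_smult Mm.\<Gamma>.is_group inv)
qed

lemma G_submodule_restrict:
  assumes M: "G_module G R M" and U: "G_submodule G R M U" and W: "G_submodule G R M W"
    and sub: "U \<subseteq> W"
  shows "G_submodule G R (M\<lparr>carrier := W\<rparr>) U"
proof -
  interpret M': Module.module R "M\<lparr>carrier := W\<rparr>"
    using G_module_submodule[OF M W] by (rule G_module_imp_module)
  have "Module.module R (M\<lparr>carrier := U\<rparr>)"
    using G_module_submodule[OF M U] by (rule G_module_imp_module)
  then have "submodule U R (M\<lparr>carrier := W\<rparr>)"
    using sub by (intro M'.module_incl_imp_submodule) simp_all
  then show ?thesis using U by (simp add: G_submodule_def)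
qed

lemma G_module_twist:
  assumes M: "G_module G R M"
    and closed: "\<And>g. g \<in> carrier G \<Longrightarrow> \<psi> g \<in> carrier R"
    and one: "\<psi> \<one>\<^bsub>G\<^esub> = \<one>\<^bsub>R\<^esub>"
    and mult: "\<And>g h. \<lbrakk>g \<in> carrier G; h \<in> carrier G\<rbrakk> \<Longrightarrow> \<psi> (g \<otimes>\<^bsub>G\<^esub> h) = \<psi> g \<otimes>\<^bsub>R\<^esub> \<psi> h"
  shows "G_module G R (twist M \<psi>)"
proof -
  interpret M: G_module G R M by (rule M)
  have "Module.module R (twist M \<psi>)"
    using G_module_imp_module[OF M]
    by (simp add: twist_def Module.module_def module_axioms_def abelian_group_def
        abelian_monoid_def abelian_group_axioms_def)
  then show ?thesis
    by (rule G_moduleI)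
      (auto simp: twist_def closed one mult M.gact_closed M.gact_one M.gact_mult M.gact_add
        M.gact_smult M.smult_r_distr M.smult_assoc1[symmetric] M.R.m_comm M.\<Gamma>.is_group)
qed

lemma quotient_map_G_hom:
  assumes M: "G_module G R M" and U: "G_submodule G R M U"
  shows "(\<lambda>v. U +>\<^bsub>M\<^esub> v) \<in> G_hom G R M (G_quotient M U)"
  using carrier_G_quotient[OF M U] add_G_quotient[OF M U] smult_G_quotient[OF M U]
    gact_G_quotient[OF M U]
  by (auto simp: G_hom_def hom_def)

text \<open>Both cases of the theorem are instances of one situation: a submodule \<open>P\<close> of \<open>M\<close> covers
  the kernel \<open>U'/U\<close> of \<open>M/U \<rightarrow> M/U'\<close> (because \<open>P + U = U'\<close>), and \<open>L\<close> is a copy of \<open>P/(P \<inter> U)\<close>,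
  given by a surjection \<open>\<tau> : P \<rightarrow> L\<close> with that kernel. The injection \<open>L \<rightarrow> M/U\<close> lifts along \<open>\<tau>\<close> and
  projects.\<close>

lemma short_exact_of_surjection:
  fixes M :: "('g, 'k, 'v) gmodule" and L :: "('g, 'k, 'l) gmodule"
  assumes M: "G_module G R M" and L: "G_module G R L"
    and U: "G_submodule G R M U" and U': "G_submodule G R M U'"
    and P: "P \<subseteq> carrier M"
    and tau_add: "\<And>x y. \<lbrakk>x \<in> P; y \<in> P\<rbrakk> \<Longrightarrow> x \<oplus>\<^bsub>M\<^esub> y \<in> P \<and> \<tau> (x \<oplus>\<^bsub>M\<^esub> y) = \<tau> x \<oplus>\<^bsub>L\<^esub> \<tau> y"
    and tau_smult: "\<And>c x. \<lbrakk>c \<in> carrier R; x \<in> P\<rbrakk> \<Longrightarrow> c \<odot>\<^bsub>M\<^esub> x \<in> P \<and> \<tau> (c \<odot>\<^bsub>M\<^esub> x) = c \<odot>\<^bsub>L\<^esub> \<tau> x"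
    and tau_gact: "\<And>g x. \<lbrakk>g \<in> carrier G; x \<in> P\<rbrakk> \<Longrightarrow> gact M g x \<in> P \<and> \<tau> (gact M g x) = gact L g (\<tau> x)"
    and tau_surj: "\<tau> ` P = carrier L"
    and tau_kernel: "\<And>x. x \<in> P \<Longrightarrow> \<tau> x = \<zero>\<^bsub>L\<^esub> \<longleftrightarrow> x \<in> U"
    and sub: "U \<subseteq> U'" "P \<subseteq> U'"
    and cover: "\<And>y. y \<in> U' \<Longrightarrow> \<exists>x\<in>P. \<exists>u\<in>U. y = u \<oplus>\<^bsub>M\<^esub> x"
  shows "\<exists>f h. short_exact G R L f (G_quotient M U) h (G_quotient M U')"
proof -
  interpret Mm: G_module G R M by (rule M)
  interpret Lm: G_module G R L by (rule L)
  interpret U: abelian_subgroup U M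
    by (rule G_submodule_imp_abelian_subgroup[OF M U])
  interpret U': abelian_subgroup U' M
    by (rule G_submodule_imp_abelian_subgroup[OF M U'])
  note q = carrier_G_quotient[OF M U] add_G_quotient[OF M U] smult_G_quotient[OF M U]
    gact_G_quotient[OF M U] zero_G_quotient[OF M U]
  note q' = carrier_G_quotient[OF M U'] add_G_quotient[OF M U'] smult_G_quotient[OF M U']
    gact_G_quotient[OF M U'] zero_G_quotient[OF M U']
  note PM = subsetD[OF P]
  have tauL: "\<tau> x \<in> carrier L" if "x \<in> P" for x
    using that tau_surj by blast
  have neg: "\<ominus>\<^bsub>M\<^esub> x \<in> P \<and> \<tau> (\<ominus>\<^bsub>M\<^esub> x) = \<ominus>\<^bsub>L\<^esub> \<tau> x" if x: "x \<in> P" for x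
  proof -
    have 1: "\<ominus>\<^bsub>M\<^esub> x = (\<ominus>\<^bsub>R\<^esub> \<one>\<^bsub>R\<^esub>) \<odot>\<^bsub>M\<^esub> x"
      using PM[OF x] Mm.smult_l_minus[of "\<one>\<^bsub>R\<^esub>" x] by simp
    have 2: "\<ominus>\<^bsub>L\<^esub> \<tau> x = (\<ominus>\<^bsub>R\<^esub> \<one>\<^bsub>R\<^esub>) \<odot>\<^bsub>L\<^esub> \<tau> x"
      using tauL[OF x] Lm.smult_l_minus[of "\<one>\<^bsub>R\<^esub>" "\<tau> x"] by simp
    show ?thesis
      unfolding 1 2 by (rule tau_smult) (use x in auto)
  qed
  have coset_eq: "U +>\<^bsub>M\<^esub> x = U +>\<^bsub>M\<^esub> y \<longleftrightarrow> \<tau> x = \<tau> y" if xy: "x \<in> P" "y \<in> P" for x y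
  proof -
    have "U +>\<^bsub>M\<^esub> x = U +>\<^bsub>M\<^esub> y \<longleftrightarrow> y \<in> U +>\<^bsub>M\<^esub> x"
      using U.a_repr_independence'[OF _ PM[OF xy(1)]] U.a_repr_independenceD[OF PM[OF xy(2)]]
      by (intro iffI)
    also have "\<dots> \<longleftrightarrow> y \<oplus>\<^bsub>M\<^esub> \<ominus>\<^bsub>M\<^esub> x \<in> U"
      using xy by (intro U.a_rcos_module PM)
    also have "\<dots> \<longleftrightarrow> \<tau> y \<oplus>\<^bsub>L\<^esub> \<ominus>\<^bsub>L\<^esub> \<tau> x = \<zero>\<^bsub>L\<^esub>"
      using tau_kernel[of "y \<oplus>\<^bsub>M\<^esub> \<ominus>\<^bsub>M\<^esub> x"] tau_add[of y "\<ominus>\<^bsub>M\<^esub> x"] neg xy by simp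
    also have "\<dots> \<longleftrightarrow> \<tau> x = \<tau> y"
      using tauL xy Lm.add.right_cancel[of "\<ominus>\<^bsub>L\<^esub> \<tau> x" "\<tau> y" "\<tau> x"] Lm.add.r_inv[of "\<tau> x"]
      by auto
    finally show ?thesis .
  qed
  \<comment> \<open>Any section of \<open>\<tau>\<close> will do: by \<open>coset_eq\<close> the coset of a lift does not depend on the lift.\<close>
  define s where "s = inv_into P \<tau>"
  have s: "s l \<in> P" "\<tau> (s l) = l" if "l \<in> carrier L" for l
    using that tau_surj by (auto simp: s_def inv_into_into f_inv_into_f)
  define f where "f = (\<lambda>l. U +>\<^bsub>M\<^esub> s l)"
  have f_tau: "f (\<tau> x) = U +>\<^bsub>M\<^esub> x" if "x \<in> P" for x
    using that s[of "\<tau> x"] tauL coset_eq[of "s (\<tau> x)" x] unfolding f_def by blast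
  define h where "h = (\<lambda>A. U' <+>\<^bsub>M\<^esub> A)"
  have h_coset: "h (U +>\<^bsub>M\<^esub> v) = U' +>\<^bsub>M\<^esub> v" if v: "v \<in> carrier M" for v
  proof -
    have "U' <+>\<^bsub>M\<^esub> U = U'"
    proof
      show "U' <+>\<^bsub>M\<^esub> U \<subseteq> U'"
        using sub(1) by (auto simp: set_add_def')
      show "U' \<subseteq> U' <+>\<^bsub>M\<^esub> U"
      proof
        fix x assume "x \<in> U'"
        then show "x \<in> U' <+>\<^bsub>M\<^esub> U"
          unfolding set_add_def' using U.zero_closed \<open>x \<in> U'\<close>
          by (intro UN_I[of x] UN_I[of "\<zero>\<^bsub>M\<^esub>"]) (simp_all add: U'.a_Hcarr)
      qed
    qed
    then show ?thesis
      unfolding h_def using Mm.a_setmult_rcos_assoc[OF U'.a_subset U.a_subset v] by simp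
  qed
  have "f \<in> G_hom G R L (G_quotient M U)"
  proof -
    have "f l \<in> carrier (G_quotient M U)" if "l \<in> carrier L" for l
      using s[OF that] PM by (auto simp: q f_def)
    moreover have "f (l \<oplus>\<^bsub>L\<^esub> l') = f l \<oplus>\<^bsub>G_quotient M U\<^esub> f l'"
      if "l \<in> carrier L" "l' \<in> carrier L" for l l'
      using that s[of l] s[of l'] tau_add[of "s l" "s l'"] f_tau[of "s l \<oplus>\<^bsub>M\<^esub> s l'"] PM
      by (simp add: q f_def)
    moreover have "f (c \<odot>\<^bsub>L\<^esub> l) = c \<odot>\<^bsub>G_quotient M U\<^esub> f l"
      if "c \<in> carrier R" "l \<in> carrier L" for c l
      using that s[of l] tau_smult[of c "s l"] f_tau[of "c \<odot>\<^bsub>M\<^esub> s l"] PM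
      by (simp add: q f_def)
    moreover have "f (gact L g l) = gact (G_quotient M U) g (f l)"
      if "g \<in> carrier G" "l \<in> carrier L" for g l
      using that s[of l] tau_gact[of g "s l"] f_tau[of "gact M g (s l)"] PM
      by (simp add: q f_def)
    ultimately show ?thesis by (auto simp: G_hom_def hom_def)
  qed
  moreover have "h \<in> G_hom G R (G_quotient M U) (G_quotient M U')"
    unfolding G_hom_def hom_def by (auto simp: q q' h_coset Mm.gact_closed)
  moreover have "inj_on f (carrier L)"
  proof (rule inj_onI)
    fix l l' assume "l \<in> carrier L" "l' \<in> carrier L" "f l = f l'"
    then show "l = l'" using s[of l] s[of l'] coset_eq[of "s l" "s l'"] unfolding f_def by simp
  qed
  moreover have "f ` carrier L = a_kernel (G_quotient M U) (G_quotient M U') h"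
  proof -
    have "f ` carrier L = (\<lambda>x. U +>\<^bsub>M\<^esub> x) ` P"
      unfolding tau_surj[symmetric] image_image by (rule image_cong) (simp_all add: f_tau)
    also have "\<dots> = (\<lambda>x. U +>\<^bsub>M\<^esub> x) ` U'"
    proof
      show "(\<lambda>x. U +>\<^bsub>M\<^esub> x) ` P \<subseteq> (\<lambda>x. U +>\<^bsub>M\<^esub> x) ` U'" by (rule image_mono[OF sub(2)])
      show "(\<lambda>x. U +>\<^bsub>M\<^esub> x) ` U' \<subseteq> (\<lambda>x. U +>\<^bsub>M\<^esub> x) ` P"
      proof
        fix A assume "A \<in> (\<lambda>x. U +>\<^bsub>M\<^esub> x) ` U'"
        then obtain y where y: "y \<in> U'" "A = U +>\<^bsub>M\<^esub> y" by auto
        then obtain x u where x: "x \<in> P" "u \<in> U" "y = u \<oplus>\<^bsub>M\<^esub> x" using cover[OF y(1)] by blast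
        then have "y \<in> U +>\<^bsub>M\<^esub> x" by (auto simp: a_r_coset_def')
        then have "A = U +>\<^bsub>M\<^esub> x" using y(2) U.a_repr_independence'[OF _ PM[OF x(1)]] by simp
        then show "A \<in> (\<lambda>x. U +>\<^bsub>M\<^esub> x) ` P" using x by blast
      qed
    qed
    also have "\<dots> = a_kernel (G_quotient M U) (G_quotient M U') h"
    proof -
      have eq: "h (U +>\<^bsub>M\<^esub> v) = U' \<longleftrightarrow> v \<in> U'" if "v \<in> carrier M" for v
        unfolding h_coset[OF that]
        using U'.a_rcos_self[OF that] U'.a_rcos_const[of v] by metis
      have "{A \<in> (\<lambda>v. U +>\<^bsub>M\<^esub> v) ` carrier M. h A = U'} = (\<lambda>v. U +>\<^bsub>M\<^esub> v) ` {v \<in> carrier M. v \<in> U'}"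
        using eq by blast
      also have "{v \<in> carrier M. v \<in> U'} = U'"
        using U'.a_subset by blast
      finally show ?thesis
        by (simp add: a_kernel_def' q q')
    qed
    finally show ?thesis .
  qed
  moreover have "h ` carrier (G_quotient M U) = carrier (G_quotient M U')"
    by (simp add: q q' image_image h_coset cong: image_cong_simp)
  ultimately have "short_exact G R L f (G_quotient M U) h (G_quotient M U')"
    unfolding short_exact_def
    using L G_module_quotient[OF M U] G_module_quotient[OF M U'] by - (intro conjI; assumption)
  then show ?thesis by (intro exI)
qed

section \<open>Substitution and homogeneity\<close>

lemma const_hom: "comm_ring_hom (const :: 'p::prime_card mod_ring \<Rightarrow> _)"
  by unfold_locales (simp_all add: const_def one_pCons)

interpretation const: comm_ring_hom const
  by (rule const_hom)

lemma const_0 [simp]: "const 0 = 0" by (simp add: const_def)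
lemma const_1 [simp]: "const 1 = 1" by (simp add: const_def one_pCons)

text \<open>Substitution is evaluation of an element of \<open>F\<^sub>p[X][Y]\<close>, at \<open>X = S\<close> in the coefficients
  and then at \<open>Y = T\<close>; hence it is a ring homomorphism.\<close>

lemma substXY_eq_poly:
  "substXY F S T = poly (map_poly (\<lambda>q. poly (map_poly const q) S) F) T"
proof -
  have inner: "poly (map_poly const q) S = (\<Sum>i\<le>degree q. const (coeff q i) * S ^ i)"
    for q :: "'a mod_ring poly"
    using eval_poly_as_sum[of const q S] by (simp add: eval_poly_def mult.commute)
  have "poly (map_poly h F) T = (\<Sum>j\<le>degree F. h (coeff F j) * T ^ j)"
    if "h 0 = 0" for h :: "'a mod_ring poly \<Rightarrow> 'a bipoly"
    using eval_poly_as_sum[of h F T] that by (simp add: eval_poly_def mult.commute)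
  from this[of "\<lambda>q. poly (map_poly const q) S"] show ?thesis
    by (simp add: substXY_def inner sum_distrib_right)
qed

lemma substXY_hom: "comm_ring_hom (\<lambda>F. substXY F S T)"
proof -
  interpret c: map_poly_comm_ring_hom const ..
  interpret h: comm_ring_hom "\<lambda>q. poly (map_poly const q) S"
    by unfold_locales (simp_all add: hom_distribs)
  interpret H: map_poly_comm_ring_hom "\<lambda>q. poly (map_poly const q) S" ..
  show ?thesis
    unfolding substXY_eq_poly by unfold_locales (simp_all add: hom_distribs)
qed

lemma substXY_const [simp]: "substXY (const c) S T = const c"
  by (simp add: substXY_def) (simp add: const_def)

lemma substXY_varX [simp]: "substXY varX S T = S"
  by (simp add: substXY_eq_poly varX_def map_poly_pCons)

lemma substXY_varY [simp]: "substXY varY S T = T"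
  by (simp add: substXY_eq_poly varY_def map_poly_pCons)

definition linX :: "'p::prime_card mod_ring^2^2 \<Rightarrow> 'p bipoly" where
  "linX A = const (A$1$1) * varX + const (A$2$1) * varY"

definition linY :: "'p::prime_card mod_ring^2^2 \<Rightarrow> 'p bipoly" where
  "linY A = const (A$1$2) * varX + const (A$2$2) * varY"

text \<open>The group acts on all forms of all degrees by ring endomorphisms of \<open>F\<^sub>p[X, Y]\<close>; working
  with these instead of the field of the module record lets the action be computed on products.\<close>

definition act :: "'p::prime_card mod_ring^2^2 \<Rightarrow> 'p bipoly \<Rightarrow> 'p bipoly" where
  "act A F = substXY F (linX A) (linY A)"

interpretation act: comm_ring_hom "act A"
  unfolding act_def by (rule substXY_hom)

lemma act_const [simp]: "act A (const c) = const c"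
  and act_varX [simp]: "act A varX = linX A"
  and act_varY [simp]: "act A varY = linY A"
  by (simp_all add: act_def)

lemma act_substXY: "act A (substXY F S T) = substXY F (act A S) (act A T)"
  unfolding substXY_def by (simp add: hom_distribs)

lemma act_mult: "act (A ** B) F = act A (act B F)"
proof -
  have "linX (A ** B) = act A (linX B)" "linY (A ** B) = act A (linY B)"
    by (simp_all add: linX_def linY_def hom_distribs matrix_matrix_mult_def sum_2 algebra_simps)
  then show ?thesis
    unfolding act_def[of B] act_substXY by (simp add: act_def)
qed

lemma act_one: "act (mat 1) F = F"
proof -
  have "substXY F varX varY = F"
  proof -
    have in_X: "poly (map_poly const q) varX = [:q:]" for q :: "'a mod_ring poly"
      by (induction q) (auto simp: const_def varX_def map_poly_pCons)
    have "poly (map_poly (\<lambda>q. [:q:]) F) varY = F"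
      by (induction F) (auto simp: varY_def map_poly_pCons)
    then show ?thesis by (simp add: substXY_eq_poly in_X)
  qed
  then show ?thesis
    by (simp add: act_def linX_def linY_def mat_def)
qed

lemma homogeneous_const: "homogeneous 0 (const c)"
  by (auto simp: homogeneous_def const_def coeff_pCons split: nat.splits)

lemma homogeneous_varX: "homogeneous 1 varX"
  by (auto simp: homogeneous_def varX_def coeff_pCons split: nat.splits)

lemma homogeneous_varY: "homogeneous 1 varY"
  by (auto simp: homogeneous_def varY_def coeff_pCons split: nat.splits)

lemma homogeneous_zero [simp]: "homogeneous r 0"
  by (simp add: homogeneous_def)

lemma homogeneous_add: "homogeneous r F \<Longrightarrow> homogeneous r G \<Longrightarrow> homogeneous r (F + G)"
  by (simp add: homogeneous_def) (metis add_0)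

lemma homogeneous_uminus: "homogeneous r F \<Longrightarrow> homogeneous r (- F)"
  by (simp add: homogeneous_def)

lemma homogeneous_diff: "homogeneous r F \<Longrightarrow> homogeneous r G \<Longrightarrow> homogeneous r (F - G)"
  using homogeneous_add[OF _ homogeneous_uminus] by fastforce

lemma homogeneous_sum:
  "(\<And>x. x \<in> A \<Longrightarrow> homogeneous r (f x)) \<Longrightarrow> homogeneous r (sum f A)"
  by (induction A rule: infinite_finite_induct) (auto intro: homogeneous_add)

lemma homogeneous_mult:
  assumes "homogeneous r F" "homogeneous s G"
  shows "homogeneous (r + s) (F * G)"
  unfolding homogeneous_def
proof (intro allI impI)
  fix i j assume "coeff (coeff (F * G) j) i \<noteq> 0"
  then have "(\<Sum>k\<le>j. coeff (coeff F k * coeff G (j - k)) i) \<noteq> 0"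
    by (simp add: coeff_mult coeff_sum)
  then obtain k where k: "k \<le> j" "coeff (coeff F k * coeff G (j - k)) i \<noteq> 0"
    by (meson sum.not_neutral_contains_not_neutral atMost_iff)
  then obtain l where "l \<le> i" "coeff (coeff F k) l * coeff (coeff G (j - k)) (i - l) \<noteq> 0"
    unfolding coeff_mult by (meson sum.not_neutral_contains_not_neutral atMost_iff)
  then have "l + k = r" "(i - l) + (j - k) = s"
    using assms by (auto simp: homogeneous_def)
  then show "i + j = r + s" using \<open>l \<le> i\<close> \<open>k \<le> j\<close> by linarith
qed

lemma homogeneous_power: "homogeneous r F \<Longrightarrow> homogeneous (n * r) (F ^ n)"
proof (induction n)
  case 0
  then show ?case using homogeneous_const[of 1] by simp
qed (auto intro: homogeneous_mult)

lemma homogeneous_const_mult: "homogeneous r F \<Longrightarrow> homogeneous r (const c * F)"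
  using homogeneous_mult[OF homogeneous_const] by fastforce

lemma homogeneous_linX: "homogeneous 1 (linX A)" and homogeneous_linY: "homogeneous 1 (linY A)"
  unfolding linX_def linY_def
  by (intro homogeneous_add homogeneous_const_mult homogeneous_varX homogeneous_varY)+

lemma homogeneous_lin_powers:
  assumes "homogeneous 1 S" "homogeneous 1 T"
  shows "homogeneous (i + j) (S ^ i * T ^ j)"
  using homogeneous_mult[OF homogeneous_power[OF assms(1)] homogeneous_power[OF assms(2)]]
  by simp

lemma homogeneous_act:
  assumes "homogeneous r F"
  shows "homogeneous r (act A F)"
  unfolding act_def substXY_def mult.assoc
proof (intro homogeneous_sum)
  fix i j
  show "homogeneous r (const (coeff (coeff F j) i) * (linX A ^ i * linY A ^ j))"
  proof (cases "coeff (coeff F j) i = 0")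
    case False
    then have "i + j = r" using assms by (auto simp: homogeneous_def)
    then show ?thesis
      using homogeneous_lin_powers[OF homogeneous_linX homogeneous_linY]
      by (blast intro: homogeneous_const_mult)
  qed simp
qed


section \<open>The modules of binary forms\<close>

lemma cring_Fp: "cring Fp"
proof (rule cringI)
  show "abelian_group Fp"
    by (rule abelian_groupI) (auto simp: Fp_def add.assoc add.commute intro: exI[of _ "- _"])
  show "Group.comm_monoid Fp"
    by (rule comm_monoidI) (auto simp: Fp_def mult.assoc mult.commute)
qed (auto simp: Fp_def algebra_simps)

lemma group_GL2: "group GL2"
proof (rule groupI)
  fix A assume "A \<in> carrier (GL2 :: ('a mod_ring^2^2) monoid)"
  then show "\<exists>B\<in>carrier GL2. B \<otimes>\<^bsub>GL2\<^esub> A = \<one>\<^bsub>GL2\<^esub>"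
    by (auto simp: GL2_def invertible_def)
qed (auto simp: GL2_def matrix_mul_assoc invertible_mult invertible_def[of "mat 1"])

lemma
  shows carrier_V: "carrier (V r) = {F. homogeneous r F}"
    and add_V: "(\<oplus>\<^bsub>V r\<^esub>) = (+)"
    and zero_V: "\<zero>\<^bsub>V r\<^esub> = 0"
    and smult_V: "c \<odot>\<^bsub>V r\<^esub> F = const c * F"
    and gact_V: "gact (V r) A F = act A F"
  by (simp_all add: V_def act_def linX_def linY_def)

lemmas V_simps = carrier_V add_V zero_V smult_V gact_V

lemma
  shows carrier_Fp: "carrier Fp = UNIV"
    and carrier_GL2: "carrier GL2 = {A. invertible A}"
    and mult_GL2: "A \<otimes>\<^bsub>GL2\<^esub> B = A ** B"
    and one_GL2: "\<one>\<^bsub>GL2\<^esub> = mat 1"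
  by (simp_all add: Fp_def GL2_def)

lemma G_module_V: "G_module GL2 Fp (V r)"
proof (rule G_moduleI)
  have "abelian_group (V r :: ('a mod_ring^2^2, _, _) gmodule)"
  proof (rule abelian_groupI)
    fix F assume "F \<in> carrier (V r :: ('a mod_ring^2^2, _, _) gmodule)"
    then show "\<exists>G\<in>carrier (V r). G \<oplus>\<^bsub>V r\<^esub> F = \<zero>\<^bsub>V r\<^esub>"
      by (intro bexI[of _ "- F"]) (auto simp: V_simps homogeneous_uminus)
  qed (auto simp: V_simps homogeneous_add)
  then show "Module.module Fp (V r :: ('a mod_ring^2^2, _, _) gmodule)"
    by (rule moduleI[OF cring_Fp])
      (auto simp: V_simps homogeneous_const_mult Fp_def hom_distribs ring_distribs mult.assoc)
qed (auto simp: V_simps carrier_GL2 mult_GL2 one_GL2 group_GL2 homogeneous_act act_one act_mult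
    hom_distribs)

lemma G_submodule_V_iff:
  "G_submodule GL2 Fp (V r) U \<longleftrightarrow>
    U \<subseteq> {F. homogeneous r F} \<and> 0 \<in> U \<and> (\<forall>F\<in>U. \<forall>G\<in>U. F + G \<in> U) \<and>
    (\<forall>c. \<forall>F\<in>U. const c * F \<in> U) \<and> (\<forall>A. invertible A \<longrightarrow> (\<forall>F\<in>U. act A F \<in> U))"
  (is "_ \<longleftrightarrow> ?R")
proof
  interpret M: G_module GL2 Fp "V r :: ('a mod_ring^2^2, _, _) gmodule"
    by (rule G_module_V)
  {
    assume U: "G_submodule GL2 Fp (V r) U"
    then have "submodule U Fp (V r)" by (simp add: G_submodule_def)
    note E = M.submoduleE[OF this]
    have "0 \<in> U"
    proof -
      obtain u where "u \<in> U" using E(2) by blast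
      then show ?thesis using E(4)[of 0 u] by (simp add: V_simps Fp_def)
    qed
    then show ?R
      using U E by (auto simp: V_simps G_submodule_def carrier_Fp carrier_GL2)
  }
  assume R: ?R
  have "\<ominus>\<^bsub>V r\<^esub> F \<in> U" if "F \<in> U" for F
  proof -
    have "\<ominus>\<^bsub>V r\<^esub> F = - F"
      using that R by (intro M.minus_equality) (auto simp: V_simps homogeneous_uminus)
    also have "\<dots> = const (- 1) * F" by (simp add: hom_distribs)
    finally show ?thesis using R that by metis
  qed
  then have "submodule U Fp (V r)"
    using R by (intro M.submoduleI) (auto simp: V_simps)
  then show "G_submodule GL2 Fp (V r) U"
    using R by (auto simp: G_submodule_def V_simps carrier_GL2)
qed

lemma G_submodule_V_simps:
  assumes "G_submodule GL2 Fp (V r) U"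
  shows "U \<subseteq> {F. homogeneous r F}" "0 \<in> U"
    and "\<And>F G. F \<in> U \<Longrightarrow> G \<in> U \<Longrightarrow> F + G \<in> U"
    and "\<And>c F. F \<in> U \<Longrightarrow> const c * F \<in> U"
    and "\<And>A F. invertible A \<Longrightarrow> F \<in> U \<Longrightarrow> act A F \<in> U"
    and "\<And>F. F \<in> U \<Longrightarrow> - F \<in> U"
    and "\<And>F G. F \<in> U \<Longrightarrow> G \<in> U \<Longrightarrow> F - G \<in> U"
    and "\<And>f S. (\<And>x. x \<in> S \<Longrightarrow> f x \<in> U) \<Longrightarrow> sum f S \<in> U"
proof -
  have R: "U \<subseteq> {F. homogeneous r F}" "0 \<in> U" "\<And>F G. F \<in> U \<Longrightarrow> G \<in> U \<Longrightarrow> F + G \<in> U"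
    "\<And>c F. F \<in> U \<Longrightarrow> const c * F \<in> U" "\<And>A F. invertible A \<Longrightarrow> F \<in> U \<Longrightarrow> act A F \<in> U"
    using assms unfolding G_submodule_V_iff by blast+
  have neg: "- F \<in> U" if "F \<in> U" for F
    using R(4)[OF that, of "- 1"] by (simp add: hom_distribs)
  show "U \<subseteq> {F. homogeneous r F}" "0 \<in> U" "\<And>F G. F \<in> U \<Longrightarrow> G \<in> U \<Longrightarrow> F + G \<in> U"
    "\<And>c F. F \<in> U \<Longrightarrow> const c * F \<in> U" "\<And>A F. invertible A \<Longrightarrow> F \<in> U \<Longrightarrow> act A F \<in> U"
    by fact+
  show "\<And>F. F \<in> U \<Longrightarrow> - F \<in> U" by fact
  show "F - G \<in> U" if "F \<in> U" "G \<in> U" for F G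
    using R(3)[OF that(1) neg[OF that(2)]] by simp
  show "sum f S \<in> U" if "\<And>x. x \<in> S \<Longrightarrow> f x \<in> U" for f and S :: "'c set"
    using that by (induction S rule: infinite_finite_induct) (auto simp: R)
qed

definition mat2 :: "'a::zero \<Rightarrow> 'a \<Rightarrow> 'a \<Rightarrow> 'a \<Rightarrow> 'a^2^2" where
  "mat2 a b c d = vector [vector [a, b], vector [c, d]]"

lemma mat2_nth [simp]:
  "mat2 a b c d $ 1 $ 1 = a" "mat2 a b c d $ 1 $ 2 = b"
  "mat2 a b c d $ 2 $ 1 = c" "mat2 a b c d $ 2 $ 2 = d"
  by (simp_all add: mat2_def vector_2)

lemma det_mat2 [simp]: "det (mat2 a b c d) = a * d - b * c" for a b c d :: "'a::comm_ring_1"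
  by (simp add: det_2)

lemma invertible_mat2 [simp]: "invertible (mat2 a b c d) \<longleftrightarrow> a * d \<noteq> b * c" for a b c d :: "'a::field"
  by (simp add: invertible_det_nz)

lemma linX_mat2 [simp]: "linX (mat2 a b c d) = const a * varX + const c * varY"
  and linY_mat2 [simp]: "linY (mat2 a b c d) = const b * varX + const d * varY"
  by (simp_all add: linX_def linY_def)

lemma const_power_card: "const c ^ CARD('p) = const c" for c :: "'p::prime_card mod_ring"
  using finite_field_power_card_eq_same[of c] by (simp flip: const.hom_power)

lemma frobenius_add: "(F + G) ^ CARD('p) = F ^ CARD('p) + G ^ CARD('p)"
    for F G :: "'p::prime_card bipoly"
  by (rule freshmans_dream) (simp_all add: prime_card)

text \<open>\<open>\<theta>\<close> is the determinant of the matrix with rows \<open>(X\<^sup>p, Y\<^sup>p)\<close> and \<open>(X, Y)\<close>. The Frobenius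
  map fixes the prime field, so \<open>A\<close> multiplies both rows from the right.\<close>

lemma act_theta: "act A theta = const (det A) * theta"
proof -
  have "linX A ^ CARD('a) = const (A$1$1) * varX ^ CARD('a) + const (A$2$1) * varY ^ CARD('a)"
    "linY A ^ CARD('a) = const (A$1$2) * varX ^ CARD('a) + const (A$2$2) * varY ^ CARD('a)"
    by (simp_all add: linX_def linY_def frobenius_add power_mult_distrib const_power_card)
  then show ?thesis
    by (simp add: theta_def hom_distribs det_2) (simp add: linX_def linY_def algebra_simps)
qed

lemma homogeneous_theta: "homogeneous (CARD('p) + 1) (theta :: 'p::prime_card bipoly)"
proof -
  have "homogeneous (CARD('p) + 1) (varX ^ CARD('p) * varY ^ 1 :: 'p bipoly)"
    "homogeneous (1 + CARD('p)) (varX ^ 1 * varY ^ CARD('p) :: 'p bipoly)"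
    by (intro homogeneous_lin_powers homogeneous_varX homogeneous_varY)+
  then show ?thesis
    unfolding theta_def by (intro homogeneous_diff) simp_all
qed

lemma G_submodule_V_filt: "G_submodule GL2 Fp (V r) (V_filt r m)"
proof -
  have "theta ^ m dvd act A F" if "theta ^ m dvd F" for A :: "'a mod_ring^2^2" and F
  proof -
    have "act A (theta ^ m) dvd act A F" using that by (rule act.hom_dvd)
    then show ?thesis
      by (simp add: hom_distribs act_theta power_mult_distrib) (metis dvd_mult_right)
  qed
  then show ?thesis
    unfolding G_submodule_V_iff
    by (auto simp: V_filt_def V_simps homogeneous_add homogeneous_const_mult homogeneous_act)
qed

lemma G_submodule_X_sub:
  assumes "l \<le> r"
  shows "G_submodule GL2 Fp (V r) (X_sub r l)"
proof -
  have "G_submodule GL2 Fp (V r) (carrier (V r))"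
    unfolding G_submodule_V_iff
    by (auto simp: V_simps homogeneous_add homogeneous_const_mult homogeneous_act)
  moreover have "varX ^ (r - l) * varY ^ l \<in> carrier (V r)"
    using homogeneous_lin_powers[OF homogeneous_varX homogeneous_varY, of "r - l" l] assms
    by (simp add: V_simps)
  ultimately have "X_sub r l \<subseteq> carrier (V r)"
    by (auto simp: X_sub_def G_generated_def)
  then show ?thesis
    unfolding G_submodule_V_iff
    by (auto simp: V_simps X_sub_def G_generated_def G_submodule_V_iff)
qed

lemma X_sub_generator: "varX ^ (r - l) * varY ^ l \<in> X_sub r l"
  by (simp add: X_sub_def G_generated_def)

lemma X_sub_least:
  "\<lbrakk>G_submodule GL2 Fp (V r) U; varX ^ (r - l) * varY ^ l \<in> U\<rbrakk> \<Longrightarrow> X_sub r l \<subseteq> U"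
  by (auto simp: X_sub_def G_generated_def)

lemma homogeneous_in_X_sub: "F \<in> X_sub r l \<Longrightarrow> l \<le> r \<Longrightarrow> homogeneous r F"
  using G_submodule_V_simps(1)[OF G_submodule_X_sub] by blast

lemma set_add_V: "H <+>\<^bsub>V r\<^esub> K = {F + G | F G. F \<in> H \<and> G \<in> K}"
  by (auto simp: set_add_def' V_simps)

lemma G_submodule_set_add:
  assumes "G_submodule GL2 Fp (V r) H" "G_submodule GL2 Fp (V r) K"
  shows "G_submodule GL2 Fp (V r) (H <+>\<^bsub>V r\<^esub> K)"
proof -
  note H = G_submodule_V_simps[OF assms(1)] and K = G_submodule_V_simps[OF assms(2)]
  show ?thesis
    unfolding G_submodule_V_iff set_add_V
  proof (intro conjI ballI allI impI)
    show "{F + G | F G. F \<in> H \<and> G \<in> K} \<subseteq> {F. homogeneous r F}"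
      using H(1) K(1) homogeneous_add by blast
    show "0 \<in> {F + G | F G. F \<in> H \<and> G \<in> K}"
      using H(2) K(2) by force
  next
    fix x y assume "x \<in> {F + G | F G. F \<in> H \<and> G \<in> K}" "y \<in> {F + G | F G. F \<in> H \<and> G \<in> K}"
    then obtain F G F' G' where *: "x = F + G" "y = F' + G'" "F \<in> H" "G \<in> K" "F' \<in> H" "G' \<in> K"
      by blast
    then have "x + y = (F + F') + (G + G')" by simp
    then show "x + y \<in> {F + G | F G. F \<in> H \<and> G \<in> K}"
      using H(3)[OF *(3,5)] K(3)[OF *(4,6)] by blast
  next
    fix c x assume "x \<in> {F + G | F G. F \<in> H \<and> G \<in> K}"
    then obtain F G where *: "x = F + G" "F \<in> H" "G \<in> K" by blast
    show "const c * x \<in> {F + G | F G. F \<in> H \<and> G \<in> K}"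
      unfolding *(1) distrib_left using H(4)[OF *(2)] K(4)[OF *(3)] by blast
  next
    fix A :: "'a mod_ring^2^2" and x assume A: "invertible A" and "x \<in> {F + G | F G. F \<in> H \<and> G \<in> K}"
    then obtain F G where *: "x = F + G" "F \<in> H" "G \<in> K" by blast
    show "act A x \<in> {F + G | F G. F \<in> H \<and> G \<in> K}"
      unfolding *(1) act.hom_add using H(5)[OF A *(2)] K(5)[OF A *(3)] by blast
  qed
qed

section \<open>The prime field and its power sums\<close>

lemma power_card_minus_one:
  fixes x :: "'p::prime_card mod_ring"
  assumes "x \<noteq> 0"
  shows "x ^ (CARD('p) - 1) = 1"
proof -
  have "x * x ^ (CARD('p) - 1) = x ^ CARD('p)"
    by (simp add: power_eq_if)
  also have "\<dots> = x"
    using finite_field_power_card_eq_same[of x] by simp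
  finally show ?thesis using assms by simp
qed

lemma power_eq_one_of_dvd:
  fixes x :: "'p::prime_card mod_ring"
  assumes "x \<noteq> 0" "(CARD('p) - 1) dvd k"
  shows "x ^ k = 1"
proof -
  obtain l where l: "k = (CARD('p) - 1) * l" using assms(2) by (rule dvdE)
  show ?thesis
    unfolding l power_mult power_card_minus_one[OF assms(1)] by simp
qed

lemma power_cong_card_minus_one:
  fixes x :: "'p::prime_card mod_ring"
  assumes "[m = n] (mod (CARD('p) - 1))" "0 < m" "0 < n"
  shows "x ^ m = x ^ n"
proof (cases "x = 0")
  case False
  have "x ^ m = x ^ (m mod (CARD('p) - 1))" for m
  proof -
    have "x ^ m = x ^ (m mod (CARD('p) - 1) + (CARD('p) - 1) * (m div (CARD('p) - 1)))"
      by (simp only: mod_mult_div_eq)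
    then show ?thesis
      by (simp only: power_add power_mult power_card_minus_one[OF False] power_one mult_1_right)
  qed
  then show ?thesis using assms unfolding cong_def by metis
qed (use assms in \<open>simp add: power_0_left\<close>)

lemma of_nat_eq_0_mod_ring_iff: "of_nat n = (0 :: 'p::prime_card mod_ring) \<longleftrightarrow> CARD('p) dvd n"
  by (simp add: of_nat_eq_0_iff_char_dvd)

lemma of_nat_neq_mod_ring:
  assumes "m < n" "n < CARD('p)"
  shows "of_nat m \<noteq> (of_nat n :: 'p::prime_card mod_ring)"
proof -
  have "\<not> CARD('p) dvd n - m" using assms by (auto dest: dvd_imp_le)
  then have "of_nat (n - m) \<noteq> (0 :: 'p mod_ring)" by (simp add: of_nat_eq_0_mod_ring_iff)
  then show ?thesis using assms by (simp add: of_nat_diff)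
qed

lemma binomial_nonzero_mod_ring:
  assumes "n < CARD('p)" "k \<le> n"
  shows "of_nat (n choose k) \<noteq> (0 :: 'p::prime_card mod_ring)"
proof -
  have "(n choose k) dvd fact n"
    using binomial_fact_lemma[OF assms(2)] dvd_triv_right[of "n choose k" "fact k * fact (n - k)"]
        by simp
  moreover have "\<not> CARD('p) dvd fact n"
    using assms prime_card[where 'a='p] by (simp add: prime_dvd_fact_iff)
  ultimately show ?thesis
    unfolding of_nat_eq_0_mod_ring_iff using dvd_trans by blast
qed

lemma power_sum_mod_ring:
  "(\<Sum>x\<in>UNIV. x ^ k :: 'p::prime_card mod_ring) = (if 0 < k \<and> (CARD('p) - 1) dvd k then - 1 else 0)"
proof (cases "(CARD('p) - 1) dvd k")
  case True
  have p: "CARD('p) > 1" using prime_card[where 'a='p] prime_gt_1_nat by blast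
  show ?thesis
  proof (cases "k = 0")
    case False
    have "(\<Sum>x\<in>UNIV. x ^ k :: 'p mod_ring) = (\<Sum>x\<in>UNIV - {0}. x ^ k)"
      using False by (intro sum.mono_neutral_right) (auto simp: power_0_left)
    also have "\<dots> = (\<Sum>x\<in>UNIV - {0 :: 'p mod_ring}. 1)"
      using True by (intro sum.cong) (simp_all add: power_eq_one_of_dvd)
    also have "\<dots> = of_nat (CARD('p) - 1)"
      by (simp add: card_Diff_singleton)
    also have "\<dots> = (- 1 :: 'p mod_ring)"
      using p by (simp add: of_nat_diff)
    finally show ?thesis using True False by simp
  qed simp
next
  case False
  define m where "m = k mod (CARD('p) - 1)"
  have p: "CARD('p) > 1" using prime_card[where 'a='p] prime_gt_1_nat by blast
  have m: "0 < m"
    using False by (simp add: m_def dvd_eq_mod_eq_0)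
  have m': "m < CARD('p) - 1"
    using p unfolding m_def by (intro mod_less_divisor) simp
  \<comment> \<open>The substitution \<open>x \<mapsto> y x\<close> multiplies the sum by \<open>y\<^sup>k\<close>, and \<open>X\<^sup>m - 1\<close> has too few roots
    for \<open>y\<^sup>k = 1\<close> to hold throughout.\<close>
  have "\<exists>y::'p mod_ring. y \<noteq> 0 \<and> y ^ m \<noteq> 1"
  proof (rule ccontr)
    assume "\<not> ?thesis"
    then have "y ^ m = 1" if "y \<noteq> 0" for y :: "'p mod_ring"
      using that by blast
    then have sub: "UNIV - {0} \<subseteq> {x :: 'p mod_ring. poly (monom 1 m - 1) x = 0}"
      by (auto simp: poly_monom)
    have nz: "monom 1 m - 1 \<noteq> (0 :: 'p mod_ring poly)"
      using m by (auto simp: poly_eq_iff intro!: exI[of _ m])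
    have "CARD('p) - 1 = card (UNIV - {0 :: 'p mod_ring})"
      by (simp add: card_Diff_singleton)
    also have "\<dots> \<le> card {x :: 'p mod_ring. poly (monom 1 m - 1) x = 0}"
      by (intro card_mono sub) simp
    also have "\<dots> \<le> degree (monom 1 m - 1 :: 'p mod_ring poly)"
      by (rule card_poly_roots_bound[OF nz])
    also have "\<dots> \<le> m"
      by (intro degree_diff_le degree_monom_le) simp
    finally show False using m' by simp
  qed
  then obtain y :: "'p mod_ring" where y: "y \<noteq> 0" "y ^ m \<noteq> 1" by blast
  have "y ^ k = y ^ m"
    using m False by (intro power_cong_card_minus_one) (auto simp: m_def cong_def intro: Nat.gr0I)
  have "(\<Sum>x\<in>UNIV. x ^ k) = (\<Sum>x\<in>UNIV. (y * x) ^ k)"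
    using y by (intro sum.reindex_bij_witness[of _ "\<lambda>x. y * x" "\<lambda>x. x / y"]) auto
  also have "\<dots> = y ^ m * (\<Sum>x\<in>UNIV. x ^ k)"
    by (simp add: power_mult_distrib sum_distrib_left \<open>y ^ k = y ^ m\<close>)
  finally show ?thesis using y False by simp
qed

lemma power_sum_eq_0_of_cong:
  assumes "[n = m] (mod (CARD('p) - 1))" "0 < m" "m < CARD('p) - 1"
  shows "(\<Sum>x\<in>UNIV. x ^ n :: 'p::prime_card mod_ring) = 0"
proof -
  have "\<not> (CARD('p) - 1) dvd n"
    using assms nat_dvd_not_less cong_dvd_iff by blast
  then show ?thesis by (simp only: power_sum_mod_ring simp_thms if_False)
qed

lemma sum_poly_eq_0:
  fixes f :: "'p::prime_card mod_ring poly"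
  assumes "degree f < CARD('p) - 1"
  shows "(\<Sum>x\<in>UNIV. poly f x) = 0"
proof -
  have "(\<Sum>x\<in>UNIV. poly f x) = (\<Sum>i\<le>degree f. coeff f i * (\<Sum>x\<in>UNIV. x ^ i))"
    unfolding poly_altdef by (subst sum.swap) (simp add: sum_distrib_left)
  also have "\<dots> = 0"
    using assms by (intro sum.neutral) (auto simp: power_sum_mod_ring dest: dvd_imp_le)
  finally show ?thesis .
qed

text \<open>The factor \<open>x\<^bsup>p-1-k\<^esup>\<close> turns summation over \<open>F\<^sub>p\<close> into extraction of the coefficient of
  \<open>x\<^sup>k\<close>, up to sign. The exponents stay below \<open>2 (p - 1)\<close>, where only \<open>p - 1\<close> itself contributes.\<close>

lemma power_sum_shift:
  assumes "k < CARD('p) - 1" "m < CARD('p) - 1 + k"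
  shows "(\<Sum>x\<in>UNIV. x ^ (CARD('p) - 1 - k + m) :: 'p::prime_card mod_ring) = (if m = k then - 1 else 0)"
proof -
  let ?q = "CARD('p) - 1"
  have *: "?q - k + m < 2 * ?q" "0 < ?q - k + m" using assms by auto
  have "n = q" if "q dvd n" "n < 2 * q" "0 < n" for n q :: nat
    using that by (auto elim!: dvdE)
  from this[OF _ *] have "?q dvd ?q - k + m \<longleftrightarrow> ?q - k + m = ?q"
    using dvd_refl[of ?q] by metis
  also have "\<dots> \<longleftrightarrow> m = k" using assms(1) by linarith
  finally show ?thesis using *(2) by (simp only: power_sum_mod_ring simp_thms)
qed

lemma sum_power_times_linear_power:
  fixes a b :: "'p::prime_card mod_ring"
  assumes "e < CARD('p) - 1" "n < CARD('p) - 1 + e"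
  shows "(\<Sum>x\<in>UNIV. x ^ (CARD('p) - 1 - e) * (a + b * x) ^ n)
      = - (of_nat (n choose e) * b ^ e * a ^ (n - e))"
proof -
  let ?q = "CARD('p) - 1"
  have "(\<Sum>x\<in>UNIV. x ^ (?q - e) * (a + b * x) ^ n) =
      (\<Sum>x\<in>UNIV. \<Sum>j\<le>n. (of_nat (n choose j) * b ^ j * a ^ (n - j)) * x ^ (?q - e + j))"
    by (simp add: add.commute[of a] binomial_ring sum_distrib_left power_add power_mult_distrib mult_ac)
  also have "\<dots> = (\<Sum>j\<le>n. (of_nat (n choose j) * b ^ j * a ^ (n - j)) * (\<Sum>x\<in>UNIV. x ^ (?q - e + j)))"
    by (subst sum.swap) (simp add: sum_distrib_left)
  also have "\<dots> = (\<Sum>j\<le>n. if j = e then - (of_nat (n choose e) * b ^ e * a ^ (n - e)) else 0)"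
  proof (intro sum.cong refl)
    fix j assume "j \<in> {..n}"
    then have "(\<Sum>x\<in>UNIV. x ^ (?q - e + j) :: 'p mod_ring) = (if j = e then - 1 else 0)"
      using assms by (intro power_sum_shift) auto
    then show "(of_nat (n choose j) * b ^ j * a ^ (n - j)) * (\<Sum>x\<in>UNIV. x ^ (?q - e + j)) =
        (if j = e then - (of_nat (n choose e) * b ^ e * a ^ (n - e)) else 0)"
      by simp
  qed
  also have "\<dots> = - (of_nat (n choose e) * b ^ e * a ^ (n - e))"
    by (cases "e \<le> n") (simp_all add: binomial_eq_0)
  finally show ?thesis .
qed


section \<open>Dehomogenisation and Hasse derivatives\<close>

text \<open>\<open>F(X, 1)\<close>: the outer variable of \<open>F\<^sub>p[X][Y]\<close> is \<open>Y\<close>.\<close>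

definition dehom :: "'p::prime_card bipoly \<Rightarrow> 'p mod_ring poly" where
  "dehom F = poly F 1"

interpretation dehom: comm_ring_hom dehom
  unfolding dehom_def by (rule poly_hom.comm_ring_hom_axioms)

lemma dehom_const [simp]: "dehom (const c) = [:c:]"
  and dehom_varX [simp]: "dehom varX = [:0, 1:]"
  and dehom_varY [simp]: "dehom varY = 1"
  by (simp_all add: dehom_def const_def varX_def varY_def)

lemma coeff_dehom:
  assumes "homogeneous r F"
  shows "coeff (dehom F) i = (if i \<le> r then coeff (coeff F (r - i)) i else 0)"
proof -
  have "coeff (dehom F) i = (\<Sum>j\<le>degree F. coeff (coeff F j) i)"
    by (simp add: dehom_def poly_altdef coeff_sum)
  also have "\<dots> = (\<Sum>j\<le>degree F. if j = r - i then (if i \<le> r then coeff (coeff F (r - i)) i else 0)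
      else 0)"
    using assms by (intro sum.cong) (fastforce simp: homogeneous_def)+
  also have "\<dots> = (if i \<le> r then coeff (coeff F (r - i)) i else 0)"
    by (auto simp: coeff_eq_0)
  finally show ?thesis .
qed

lemma dehom_inj:
  assumes F: "homogeneous r F" and G: "homogeneous r G" and eq: "dehom F = dehom G"
  shows "F = G"
proof -
  have "coeff (coeff F j) i = coeff (coeff G j) i" for i j
  proof (cases "i + j = r")
    case True
    then show ?thesis
      using coeff_dehom[OF F, of i] coeff_dehom[OF G, of i] eq by (auto simp flip: True)
  next
    case False
    then show ?thesis using F G unfolding homogeneous_def by metis
  qed
  then show ?thesis by (simp add: poly_eq_iff)
qed

definition rehom :: "nat \<Rightarrow> 'p::prime_card mod_ring poly \<Rightarrow> 'p bipoly" where
  "rehom r f = (\<Sum>i\<le>r. const (coeff f i) * (varX ^ i * varY ^ (r - i)))"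

lemma homogeneous_rehom: "homogeneous r (rehom r f)"
  unfolding rehom_def
proof (intro homogeneous_sum homogeneous_const_mult)
  fix i assume "i \<in> {..r}"
  then show "homogeneous r (varX ^ i * varY ^ (r - i))"
    using homogeneous_lin_powers[OF homogeneous_varX homogeneous_varY, of i "r - i"] by simp
qed

lemma dehom_rehom:
  assumes "degree f \<le> r"
  shows "dehom (rehom r f) = f"
proof -
  have "dehom (rehom r f) = (\<Sum>i\<le>r. monom (coeff f i) i)"
    by (simp add: rehom_def hom_distribs monom_altdef)
  also have "\<dots> = f"
    using assms by (rule poly_as_sum_of_monoms')
  finally show ?thesis .
qed

lemma degree_dehom: "homogeneous r F \<Longrightarrow> degree (dehom F) \<le> r"
  by (intro degree_le) (simp add: coeff_dehom)

text \<open>The Hasse derivative, which replaces the \<open>k\<close>-th derivative divided by \<open>k!\<close> in positive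
  characteristic.\<close>

definition hasse :: "nat \<Rightarrow> 'a::comm_ring_1 poly \<Rightarrow> 'a \<Rightarrow> 'a" where
  "hasse k f x = coeff (f \<circ>\<^sub>p [:x, 1:]) k"

lemma hasse_add: "hasse k (f + g) x = hasse k f x + hasse k g x"
  and hasse_diff: "hasse k (f - g) x = hasse k f x - hasse k g x"
  and hasse_smult: "hasse k (smult c f) x = c * hasse k f x"
  and hasse_const_mult: "hasse k ([:c:] * f) x = c * hasse k f x"
  and hasse_zero [simp]: "hasse k 0 x = 0"
  by (simp_all add: hasse_def pcompose_add pcompose_diff pcompose_smult)

lemma hasse_sum: "hasse k (sum f A) x = (\<Sum>a\<in>A. hasse k (f a) x)"
  by (induction A rule: infinite_finite_induct) (simp_all add: hasse_add)

lemma hasse_mult: "hasse k (f * g) x = (\<Sum>l\<le>k. hasse l f x * hasse (k - l) g x)"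
  by (simp add: hasse_def pcompose_mult coeff_mult)

lemma hasse_linear_power:
  "hasse k ([:a, b:] ^ n) x = of_nat (n choose k) * b ^ k * (a + b * x) ^ (n - k)"
proof -
  have *: "[:a, b:] ^ n \<circ>\<^sub>p [:x, 1:] = [:a + b * x, b:] ^ n"
    by (simp add: hom_distribs pcompose_pCons algebra_simps)
  show ?thesis
  proof (cases "k \<le> n")
    case True
    then show ?thesis by (simp add: hasse_def * coeff_linear_poly_power)
  next
    case False
    have "degree ([:a + b * x, b:] ^ n) \<le> n"
      using degree_power_le[of "[:a + b * x, b:]" n] by (auto split: if_splits)
    then show ?thesis using False by (simp add: hasse_def * coeff_eq_0 binomial_eq_0)
  qed
qed

lemma coeff_linear_power:
  "coeff ([:a, b:] ^ n) t = of_nat (n choose t) * b ^ t * a ^ (n - t)" for a b :: "'a::comm_ring_1"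
  using hasse_linear_power[of t a b n 0] by (simp add: hasse_def)

text \<open>The Taylor polynomial of order \<open>n\<close> at \<open>x\<close> of a polynomial of degree at most \<open>n\<close> is that
  polynomial.\<close>

lemma taylor_at_zero:
  fixes f :: "'a::comm_ring_1 poly"
  assumes "degree f \<le> n"
  shows "(\<Sum>k\<le>n. (- x) ^ k * hasse k f x) = poly f 0"
proof -
  have "degree (f \<circ>\<^sub>p [:x, 1:]) \<le> n"
    using assms degree_pcompose_le[of f "[:x, 1:]"] by simp
  then have "(\<Sum>k\<le>n. monom (hasse k f x) k) = f \<circ>\<^sub>p [:x, 1:]"
    unfolding hasse_def by (rule poly_as_sum_of_monoms')
  then have "poly (f \<circ>\<^sub>p [:x, 1:]) (- x) = (\<Sum>k\<le>n. poly (monom (hasse k f x) k) (- x))"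
    by (metis poly_hom.hom_sum)
  then show ?thesis
    by (simp add: poly_pcompose poly_monom mult.commute)
qed

lemma linear_power_dvd_of_hasse:
  fixes f :: "'a::comm_ring_1 poly"
  assumes "\<And>k. k < m \<Longrightarrow> hasse k f x = 0"
  shows "[:- x, 1:] ^ m dvd f"
proof -
  have "monom 1 m dvd f \<circ>\<^sub>p [:x, 1:]"
    using assms by (simp add: monom_1_dvd_iff' hasse_def)
  then have "monom 1 m \<circ>\<^sub>p [:- x, 1:] dvd (f \<circ>\<^sub>p [:x, 1:]) \<circ>\<^sub>p [:- x, 1:]"
    by (rule pcompose_hom.hom_dvd)
  moreover have "(f \<circ>\<^sub>p [:x, 1:]) \<circ>\<^sub>p [:- x, 1:] = f"
    by (simp add: pcompose_assoc[symmetric] pcompose_pCons)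
  moreover have "monom 1 m \<circ>\<^sub>p [:- x, 1:] = [:- x, 1:] ^ m"
    by (simp add: monom_altdef hom_distribs pcompose_pCons)
  ultimately show ?thesis by simp
qed

lemma dehom_theta: "dehom (theta :: 'p::prime_card bipoly) = [:0, 1:] ^ CARD('p) - [:0, 1:]"
  by (simp add: theta_def hom_distribs)

lemma dehom_theta_eq_prod: "dehom (theta :: 'p::prime_card bipoly) = (\<Prod>x\<in>UNIV. [:- x, 1:])"
proof (rule poly_eqI_degree_lead_coeff)
  have p: "CARD('p) > 1" using prime_card[where 'a='p] prime_gt_1_nat by blast
  have *: "dehom (theta :: 'p bipoly) = monom 1 CARD('p) - monom 1 1"
    by (simp add: dehom_theta monom_altdef)
  have deg: "degree (\<Prod>x\<in>UNIV. [:- x, 1:] :: 'p mod_ring poly) = CARD('p)"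
    by (subst degree_prod_eq_sum_degree) auto
  have "lead_coeff (\<Prod>x\<in>UNIV. [:- x, 1:] :: 'p mod_ring poly) = 1"
    by (simp add: lead_coeff_prod)
  then show "coeff (dehom (theta :: 'p bipoly)) CARD('p) = coeff (\<Prod>x\<in>UNIV. [:- x, 1:]) CARD('p)"
    using p deg by (simp add: *)
  show "degree (\<Prod>x\<in>UNIV. [:- x, 1:] :: 'p mod_ring poly) \<le> CARD('p)" using deg by simp
  show "degree (dehom (theta :: 'p bipoly)) \<le> CARD('p)"
    unfolding * using p by (intro degree_diff_le order.trans[OF degree_monom_le]) auto
  show "CARD('p) \<le> card (UNIV :: 'p mod_ring set)" by simp
  fix z :: "'p mod_ring"
  have "(\<Prod>x\<in>UNIV. z - x) = 0" by (intro prod_zero) auto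
  then show "poly (dehom theta) z = poly (\<Prod>x\<in>UNIV. [:- x, 1:]) z"
    using finite_field_power_card_eq_same[of z]
    by (simp add: dehom_theta poly_prod)
qed

lemma dehom_theta_power_dvd:
  fixes f :: "'p::prime_card mod_ring poly"
  assumes "\<And>k x. k < m \<Longrightarrow> hasse k f x = 0"
  shows "dehom theta ^ m dvd f"
proof -
  have cop: "coprime ([:- x, 1:] ^ m) ([:- y, 1:] ^ m)" if "x \<noteq> y" for x y :: "'p mod_ring"
  proof -
    have "coprime [:- x, 1:] [:- y, 1:]"
    proof (rule coprimeI)
      fix d assume "d dvd [:- x, 1:]" "d dvd [:- y, 1:]"
      then have "d dvd [:- x, 1:] - [:- y, 1:]" by (rule dvd_diff)
      then have "d dvd [:y - x:]" by simp
      moreover have "is_unit [:y - x:]" using that by (simp add: is_unit_const_poly_iff dvd_field_iff)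
      ultimately show "is_unit d" using dvd_trans by blast
    qed
    then show ?thesis by simp
  qed
  have "(\<Prod>x\<in>S. [:- x, 1:] ^ m) dvd f" for S :: "'p mod_ring set"
  proof (induction S rule: infinite_finite_induct)
    case (insert x S)
    have "coprime ([:- x, 1:] ^ m) (\<Prod>x\<in>S. [:- x, 1:] ^ m)"
      using insert.hyps cop by (intro prod_coprime_right) metis
    then have "[:- x, 1:] ^ m * (\<Prod>x\<in>S. [:- x, 1:] ^ m) dvd f"
      using insert.IH linear_power_dvd_of_hasse[of m f x] assms by (intro divides_mult) auto
    then show ?case using insert.hyps by simp
  qed auto
  from this[of UNIV] show ?thesis
    by (simp add: dehom_theta_eq_prod prod_power_distrib)
qed

lemma degree_dehom_theta: "degree (dehom (theta :: 'p::prime_card bipoly)) = CARD('p)"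
  unfolding dehom_theta_eq_prod by (subst degree_prod_eq_sum_degree) auto

lemma dehom_theta_nonzero: "dehom (theta :: 'p::prime_card bipoly) \<noteq> 0"
  using degree_dehom_theta[where 'p='p] by fastforce

lemma theta_nonzero: "theta \<noteq> (0 :: 'p::prime_card bipoly)"
  using dehom_theta_nonzero by (metis dehom.hom_zero)

lemma dehom_theta_pcompose:
  "dehom (theta :: 'p::prime_card bipoly) \<circ>\<^sub>p [:x, 1:] = [:0, 1:] * ([:0, 1:] ^ (CARD('p) - 1) - 1)"
proof -
  have "[:x, 1:] = [:x:] + [:0, 1:]" by simp
  then have "[:x, 1:] ^ CARD('p) = [:x:] ^ CARD('p) + [:0, 1:] ^ CARD('p)"
    by (simp only:) (rule freshmans_dream, simp_all add: prime_card)
  also have "[:x:] ^ CARD('p) = [:x:]"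
    using finite_field_power_card_eq_same[of x] by (simp add: poly_const_pow)
  finally have "dehom (theta :: 'p bipoly) \<circ>\<^sub>p [:x, 1:] = [:0, 1:] ^ CARD('p) - [:0, 1:]"
    by (simp add: dehom_theta hom_distribs pcompose_pCons)
  also have "\<dots> = [:0, 1:] * ([:0, 1:] ^ (CARD('p) - 1) - 1)"
    by (simp only: right_diff_distrib power_Suc[symmetric] Suc_diff_1[OF zero_less_card_finite]
        mult_1_right)
  finally show ?thesis .
qed

text \<open>Around a point \<open>x\<close> of the prime field \<open>X\<^sup>p - X\<close> is \<open>- (X - x)\<close> to first order, so \<open>\<theta>\<^sup>m g\<close>
  starts with \<open>(- 1)\<^sup>m g(x) (X - x)\<^sup>m\<close>.\<close>

lemma hasse_theta_power_mult:
  fixes g :: "'p::prime_card mod_ring poly"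
  assumes "k \<le> m"
  shows "hasse k (dehom theta ^ m * g) x = (if k = m then (- 1) ^ m * poly g x else 0)"
proof -
  define h where "h = ([:0, 1:] ^ (CARD('p) - 1) - 1) ^ m * (g \<circ>\<^sub>p [:x, 1:])"
  have p: "CARD('p) > 1" using prime_card[where 'a='p] prime_gt_1_nat by blast
  have "(dehom theta ^ m * g) \<circ>\<^sub>p [:x, 1:] = monom 1 m * h"
    by (simp only: pcompose_mult pcompose_hom.hom_power dehom_theta_pcompose h_def
        power_mult_distrib monom_altdef mult.assoc smult_1_left)
  then have "hasse k (dehom theta ^ m * g) x = (if k = m then coeff h 0 else 0)"
    using assms by (simp add: hasse_def coeff_monom_mult)
  moreover have "coeff h 0 = (- 1) ^ m * poly g x"
    using p by (simp add: h_def poly_0_coeff_0[symmetric] poly_pcompose power_0_left)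
  ultimately show ?thesis by simp
qed

text \<open>The zeros of \<open>\<theta>\<close> are the points of the projective line over the prime field, each of them
  simple. So \<open>\<theta>\<^sup>m\<close> divides a form that vanishes to order \<open>m\<close> at all of them: at \<open>(x : 1)\<close> this is
  a condition on the Hasse derivatives of the dehomogenised form, at \<open>(1 : 0)\<close> a bound on its
  degree.\<close>

lemma theta_power_dvdE:
  fixes F :: "'p::prime_card bipoly"
  assumes F: "homogeneous r F"
    and jets: "\<And>k x. k < m \<Longrightarrow> hasse k (dehom F) x = 0"
    and infinity: "\<And>t. r < t + m \<Longrightarrow> coeff (dehom F) t = 0"
  obtains G where "homogeneous (r - m * (CARD('p) + 1)) G" "F = theta ^ m * G"
proof (cases "dehom F = 0")
  case True
  then have "F = 0" using dehom_inj[OF F homogeneous_zero] by simp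
  then show ?thesis using that[of 0] by simp
next
  case False
  obtain g where g: "dehom F = dehom theta ^ m * g"
    using dehom_theta_power_dvd[OF jets] by (auto elim: dvdE)
  have "degree (dehom F) = m * CARD('p) + degree g"
    using False unfolding g
    by (simp add: degree_mult_eq degree_power_eq dehom_theta_nonzero degree_dehom_theta)
  moreover have "degree (dehom F) + m \<le> r"
    using infinity[of "degree (dehom F)"] False by (metis leading_coeff_0_iff not_le)
  ultimately have deg: "degree g + m * (CARD('p) + 1) \<le> r" by (simp add: algebra_simps)
  define G where "G = rehom (r - m * (CARD('p) + 1)) g"
  have G: "homogeneous (r - m * (CARD('p) + 1)) G"
    unfolding G_def by (rule homogeneous_rehom)
  have "homogeneous (m * (CARD('p) + 1) + (r - m * (CARD('p) + 1))) (theta ^ m * G)"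
    by (intro homogeneous_mult homogeneous_power homogeneous_theta G)
  then have "homogeneous r (theta ^ m * G)" using deg by simp
  moreover have "dehom (theta ^ m * G) = dehom F"
    using deg by (simp add: hom_distribs G_def dehom_rehom g)
  ultimately have "F = theta ^ m * G" using dehom_inj F by metis
  then show ?thesis using that G by blast
qed

lemma
  fixes F :: "'p::prime_card bipoly"
  assumes F: "homogeneous r F" and dvd: "theta ^ m dvd F"
  shows hasse_eq_0_of_theta_power_dvd: "\<And>k x. k < m \<Longrightarrow> hasse k (dehom F) x = 0"
    and coeff_eq_0_of_theta_power_dvd: "\<And>t. r < t + m \<Longrightarrow> coeff (dehom F) t = 0"
proof -
  obtain G where G: "F = theta ^ m * G" using dvd by (rule dvdE)
  show "hasse k (dehom F) x = 0" if "k < m" for k x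
    using that hasse_theta_power_mult[of k m "dehom G" x] by (simp add: G hom_distribs)
  have p: "CARD('p) > 1" using prime_card[where 'a='p] prime_gt_1_nat by blast
  have "varY dvd (theta :: 'p bipoly)"
    using p unfolding theta_def by (intro dvd_diff dvd_mult) (auto simp: dvd_power)
  then have "varY ^ m dvd F"
    using dvd by (metis dvd_power_same dvd_trans)
  then have "monom 1 m dvd F" by (simp add: varY_def monom_altdef)
  then have low: "coeff F k = 0" if "k < m" for k
    using that by (simp add: monom_1_dvd_iff')
  show "coeff (dehom F) t = 0" if "r < t + m" for t
    using low[of "r - t"] that by (simp add: coeff_dehom[OF F])
qed

lemma theta_power_dvd_homogeneousE:
  fixes F :: "'p::prime_card bipoly"
  assumes F: "homogeneous r F" and dvd: "theta ^ m dvd F"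
  obtains G where "homogeneous (r - m * (CARD('p) + 1)) G" "F = theta ^ m * G"
  using theta_power_dvdE[OF F hasse_eq_0_of_theta_power_dvd[OF F dvd]
      coeff_eq_0_of_theta_power_dvd[OF F dvd]] by blast


section \<open>Values of forms\<close>

text \<open>The value \<open>F(u, w)\<close>.\<close>

definition bival :: "'p::prime_card mod_ring \<Rightarrow> 'p mod_ring \<Rightarrow> 'p bipoly \<Rightarrow> 'p mod_ring" where
  "bival u w F = poly (poly F [:w:]) u"

interpretation bival: comm_ring_hom "bival u w"
  unfolding bival_def by unfold_locales simp_all

lemma bival_const [simp]: "bival u w (const c) = c"
  and bival_varX [simp]: "bival u w varX = u"
  and bival_varY [simp]: "bival u w varY = w"
  by (simp_all add: bival_def const_def varX_def varY_def)

lemma bival_one: "bival u 1 F = poly (dehom F) u"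
  by (simp add: bival_def dehom_def one_pCons)

lemma bival_substXY: "bival u w (substXY F S T) = bival (bival u w S) (bival u w T) F"
proof -
  have F: "F = substXY F varX varY"
    using act_one[of F] by (simp add: act_def linX_def linY_def mat_def)
  have "bival u w (substXY F S T) =
      (\<Sum>j\<le>degree F. \<Sum>i\<le>degree (coeff F j). coeff (coeff F j) i * bival u w S ^ i * bival u w T ^ j)"
    for u w S T
    by (simp add: substXY_def hom_distribs)
  from this[of u w S T] this[of "bival u w S" "bival u w T" varX varY] F
  show ?thesis by simp
qed

lemma bival_act:
  "bival u w (act A F) = bival (A$1$1 * u + A$2$1 * w) (A$1$2 * u + A$2$2 * w) F"
  by (simp add: act_def bival_substXY linX_def linY_def hom_distribs)

lemma bival_theta [simp]: "bival u w theta = 0"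
  using finite_field_power_card_eq_same[of u] finite_field_power_card_eq_same[of w]
  by (simp add: theta_def hom_distribs)

lemma rehom_dehom:
  assumes "homogeneous r F"
  shows "rehom r (dehom F) = F"
  using dehom_inj[OF homogeneous_rehom assms] dehom_rehom[OF degree_dehom[OF assms]] by simp

lemma bival_eq_sum:
  assumes "homogeneous r F"
  shows "bival u w F = (\<Sum>i\<le>r. coeff (dehom F) i * (u ^ i * w ^ (r - i)))"
  by (subst rehom_dehom[OF assms, symmetric]) (simp add: rehom_def hom_distribs)

lemma bival_scale:
  assumes "homogeneous r F"
  shows "bival (c * u) (c * w) F = c ^ r * bival u w F"
proof -
  have "c ^ r = c ^ i * c ^ (r - i)" if "i \<le> r" for i
    using that by (simp flip: power_add)
  then show ?thesis
    unfolding bival_eq_sum[OF assms] sum_distrib_left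
    by (intro sum.cong) (simp_all add: power_mult_distrib mult_ac)
qed

lemma bival_infinity:
  assumes "homogeneous r F"
  shows "bival 1 0 F = coeff (dehom F) r"
proof -
  have "bival 1 0 F = (\<Sum>i\<le>r. if i = r then coeff (dehom F) r else 0)"
    unfolding bival_eq_sum[OF assms] by (intro sum.cong) (auto simp: power_0_left)
  then show ?thesis by simp
qed

lemma theta_dvd_of_values:
  assumes F: "homogeneous r F"
    and finite_points: "\<And>x. poly (dehom F) x = 0" and infinity: "coeff (dehom F) r = 0"
  shows "theta dvd F"
proof -
  obtain G where "F = theta ^ 1 * G"
  proof (rule theta_power_dvdE[OF F])
    show "hasse k (dehom F) x = 0" if "k < 1" for k x
      using that finite_points by (simp add: hasse_def poly_0_coeff_0[symmetric] poly_pcompose)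
    show "coeff (dehom F) t = 0" if "r < t + 1" for t
      using that infinity degree_dehom[OF F] by (cases "t = r") (auto simp: coeff_eq_0)
  qed
  then show ?thesis by simp
qed

section \<open>Annihilators of the submodules generated by a monomial\<close>

text \<open>The forms all of whose translates are annihilated by \<open>\<phi>\<close> constitute a submodule, so it is
  enough to test \<open>\<phi>\<close> on the translates \<open>L\<^bsup>r-l\<^esup> M\<^sup>l\<close> of the generator, with linear forms \<open>L\<close> and
  \<open>M\<close>.\<close>

lemma X_sub_annihilated:
  fixes \<phi> :: "'p::prime_card bipoly \<Rightarrow> 'p mod_ring"
  assumes "l \<le> r"
    and add: "\<And>F G. \<phi> (F + G) = \<phi> F + \<phi> G"
    and smult: "\<And>c F. \<phi> (const c * F) = c * \<phi> F"
    and generators: "\<And>A. \<phi> (linX A ^ (r - l) * linY A ^ l) = 0"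
    and F: "F \<in> X_sub r l"
  shows "\<phi> F = 0"
proof -
  let ?U = "{F. homogeneous r F \<and> (\<forall>A. \<phi> (act A F) = 0)}"
  have zero: "\<phi> 0 = 0" using smult[of 0 0] by simp
  have "G_submodule GL2 Fp (V r) ?U"
    unfolding G_submodule_V_iff
    by (auto simp: homogeneous_add homogeneous_const_mult homogeneous_act add smult zero
        act.hom_add act.hom_mult simp flip: act_mult)
  moreover have "varX ^ (r - l) * varY ^ l \<in> ?U"
    using homogeneous_lin_powers[OF homogeneous_varX homogeneous_varY, of "r - l" l]
      assms(1) generators by (simp add: hom_distribs)
  ultimately have "F \<in> ?U" using F X_sub_least by blast
  then have "\<phi> (act (mat 1) F) = 0" by blast
  then show ?thesis by (simp add: act_one)
qed

text \<open>Both sides are the coefficient of \<open>t\<^sup>i\<close> in \<open>(1 - t)\<^sup>N (1 - t)\<^bsup>-M-1\<^esup>\<close>; this is the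
  Vandermonde identity with a negative upper index.\<close>

lemma sum_binomial_neg:
  assumes "M < N"
  shows "(\<Sum>k\<le>i. (- 1) ^ k * int (N choose k) * int ((M + (i - k)) choose (i - k)))
    = (- 1) ^ i * int ((N - M - 1) choose i)"
proof -
  have *: "rat_of_nat ((M + e) choose e) = (- 1) ^ e * ((- of_nat M - 1) gchoose e)" for e
    using gbinomial_negated_upper[of "of_nat (M + e) :: rat" e]
    by (simp add: binomial_gbinomial algebra_simps)
  have "rat_of_int (\<Sum>k\<le>i. (- 1) ^ k * int (N choose k) * int ((M + (i - k)) choose (i - k)))
      = (\<Sum>k\<le>i. (- 1) ^ i * ((of_nat N gchoose k) * ((- of_nat M - 1) gchoose (i - k))))"
    unfolding of_int_sum
  proof (intro sum.cong refl)
    fix k assume "k \<in> {..i}"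
    then have "(- 1 :: rat) ^ i = (- 1) ^ k * (- 1) ^ (i - k)" by (simp flip: power_add)
    then show "rat_of_int ((- 1) ^ k * int (N choose k) * int ((M + (i - k)) choose (i - k)))
      = (- 1) ^ i * ((of_nat N gchoose k) * ((- of_nat M - 1) gchoose (i - k)))"
      by (simp only: of_int_mult of_int_power of_int_minus of_int_1 of_int_of_nat_eq *
          binomial_gbinomial[of N k] mult_ac)
  qed
  also have "\<dots> = (- 1) ^ i * ((of_nat N + (- of_nat M - 1)) gchoose i)"
    by (simp only: gbinomial_Vandermonde[symmetric] sum_distrib_left atMost_atLeast0)
  also have "of_nat N + (- of_nat M - 1 :: rat) = of_nat (N - M - 1)"
    using assms by (simp add: of_nat_diff)
  also have "(- 1) ^ i * (of_nat (N - M - 1) gchoose i)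
      = rat_of_int ((- 1) ^ i * int ((N - M - 1) choose i))"
    by (simp add: binomial_gbinomial)
  finally show ?thesis by (simp only: of_int_eq_iff)
qed

text \<open>The situation of the theorem in terms of \<open>c = [a - i]\<close>. The lower bound on \<open>r\<close> gives the
  cofactor of \<open>\<theta>\<^sup>i\<close> in \<open>V\<^sub>r\<close> a degree of at least \<open>p\<close>; the congruence lets an exponent \<open>r - m\<close> of
  an element of \<open>F\<^sub>p\<close> be replaced by the small exponent \<open>c + i - m\<close>.\<close>

locale form_parameters =
  fixes prime_type :: "'p::prime_card itself" and c i r :: nat
  assumes i_pos: "1 \<le> i" and i_less: "i < c" and c_less: "c < CARD('p) - 1"
    and r_cong: "[r = c + i] (mod (CARD('p) - 1))"
    and r_ge: "i * (CARD('p) + 1) + CARD('p) \<le> r"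
begin

lemma r_large: "c + i + 1 < r"
  using r_ge c_less i_less i_pos by (simp add: algebra_simps)

lemma i_le_r: "i \<le> r"
  using r_large by simp

lemma r_diff_cong: "m \<le> c + i \<Longrightarrow> [r - m = c + i - m] (mod (CARD('p) - 1))"
  using r_cong r_large by (intro cong_diff_nat) auto

lemma power_r_diff:
  fixes x :: "'p mod_ring"
  assumes "m < c + i"
  shows "x ^ (r - m) = x ^ (c + i - m)"
  using assms r_large r_diff_cong[of m] by (intro power_cong_card_minus_one) auto

text \<open>By \<open>hasse_theta_power_mult\<close>, this functional takes \<open>\<theta>\<^sup>i G\<close> to \<open>(- 1)\<^sup>i\<close> times the sum of
  the values \<open>G(x, 1)\<close>.\<close>

definition jet_sum :: "'p bipoly \<Rightarrow> 'p mod_ring" where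
  "jet_sum F = (\<Sum>x\<in>UNIV. hasse i (dehom F) x)"

text \<open>On \<open>F\<^sub>p\<close> exponents may be reduced modulo \<open>p - 1\<close>. After the reduction from \<open>r\<close> to \<open>c + i\<close>,
  the \<open>i\<close>-th Hasse derivative of \<open>L\<^bsup>r-i\<^esup> M\<^sup>i\<close> is a polynomial of degree at most \<open>c < p - 1\<close> in the
  point, and the sum of such a polynomial over \<open>F\<^sub>p\<close> vanishes.\<close>

lemma jet_sum_X_sub:
  assumes "F \<in> X_sub r i"
  shows "jet_sum F = 0"
proof (rule X_sub_annihilated[OF i_le_r _ _ _ assms])
  fix A :: "'p mod_ring^2^2"
  define P where "P = (\<Sum>l\<le>i. [:of_nat ((r - i) choose l) * A$1$1 ^ l * (of_nat (i choose (i - l))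
      * A$1$2 ^ (i - l)):]
    * ([:A$2$1, A$1$1:] ^ (c - l) * [:A$2$2, A$1$2:] ^ l))"
  have "degree P \<le> c"
    unfolding P_def
  proof (intro degree_sum_le order.trans[OF degree_mult_le])
    fix l assume "l \<in> {..i}"
    then have "l \<le> i" by simp
    have "degree ([:A$2$1, A$1$1:] ^ (c - l)) \<le> c - l" "degree ([:A$2$2, A$1$2:] ^ l) \<le> l"
      using degree_power_le[of "[:A$2$1, A$1$1:]" "c - l"] degree_power_le[of "[:A$2$2, A$1$2:]" l]
      by (auto split: if_splits)
    then have "degree ([:A$2$1, A$1$1:] ^ (c - l) * [:A$2$2, A$1$2:] ^ l) \<le> c"
      using \<open>l \<le> i\<close> i_less degree_mult_le[of "[:A$2$1, A$1$1:] ^ (c - l)" "[:A$2$2, A$1$2:] ^ l"]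
      by linarith
    then show "degree [:of_nat ((r - i) choose l) * A$1$1 ^ l * (of_nat (i choose (i - l))
        * A$1$2 ^ (i - l)):]
        + degree ([:A$2$1, A$1$1:] ^ (c - l) * [:A$2$2, A$1$2:] ^ l) \<le> c"
      by simp
  qed simp
  moreover have "hasse i (dehom (linX A ^ (r - i) * linY A ^ i)) x = poly P x" for x
  proof -
    have "dehom (linX A ^ (r - i) * linY A ^ i) = [:A$2$1, A$1$1:] ^ (r - i) * [:A$2$2, A$1$2:] ^ i"
      by (simp add: hom_distribs linX_def linY_def)
    moreover have "hasse l ([:A$2$1, A$1$1:] ^ (r - i)) x * hasse (i - l) ([:A$2$2, A$1$2:] ^ i) x
      = poly ([:of_nat ((r - i) choose l) * A$1$1 ^ l * (of_nat (i choose (i - l)) * A$1$2 ^ (i - l)):]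
    * ([:A$2$1, A$1$1:] ^ (c - l) * [:A$2$2, A$1$2:] ^ l)) x" if "l \<le> i" for l
      using that i_less power_r_diff[of "i + l" "A$2$1 + A$1$1 * x"]
      by (simp add: hasse_linear_power mult_ac)
    ultimately show ?thesis
      by (simp add: hasse_mult P_def poly_sum)
  qed
  ultimately show "jet_sum (linX A ^ (r - i) * linY A ^ i) = 0"
    using c_less unfolding jet_sum_def by (simp add: sum_poly_eq_0)
qed (simp_all add: jet_sum_def hom_distribs hasse_add hasse_smult sum.distrib sum_distrib_left)

text \<open>For \<open>x \<noteq> 0\<close> the inner sum is \<open>x\<^bsup>-i\<^esup>\<close> times the value at \<open>0\<close> of the Taylor polynomial of
  order \<open>i\<close> of \<open>f\<close> at \<open>x\<close>; the exponents are written such that the point \<open>x = 0\<close> contributes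
  nothing. On \<open>\<theta>\<^sup>i G\<close> only \<open>k = i\<close> survives, and the functional gives the sum of \<open>G(x, 1)\<close> over
  \<open>x \<noteq> 0\<close>.\<close>

definition taylor_sum :: "'p mod_ring poly \<Rightarrow> 'p mod_ring" where
  "taylor_sum f = (\<Sum>x\<in>UNIV. \<Sum>k\<le>i. (- 1) ^ k * x ^ (CARD('p) - 1 - (i - k)) * hasse k f x)"

lemma taylor_sum_add: "taylor_sum (f + g) = taylor_sum f + taylor_sum g"
  by (simp add: taylor_sum_def hasse_add distrib_left sum.distrib)

lemma taylor_sum_smult: "taylor_sum (smult a f) = a * taylor_sum f"
  by (simp add: taylor_sum_def hasse_smult sum_distrib_left mult_ac)

lemma taylor_sum_sum: "taylor_sum (sum f A) = (\<Sum>a\<in>A. taylor_sum (f a))"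
  by (induction A rule: infinite_finite_induct)
    (simp_all add: taylor_sum_add, simp_all add: taylor_sum_def)

text \<open>The sum over \<open>x\<close> extracts a coefficient of \<open>(v + u x)\<^bsup>c+i-j-k\<^esup>\<close>. What remains is the
  alternating sum over \<open>k\<close> of products of binomial coefficients that \<open>sum_binomial_neg\<close> evaluates;
  the dependence on \<open>j\<close> cancels in \<open>(r - j) - (c - j)\<close>.\<close>

lemma taylor_sum_linear_power:
  assumes "j \<le> i"
  shows "taylor_sum ([:v, u:] ^ (r - j)) = - ((- u) ^ i * v ^ (c - j) * of_nat ((r - c - 1) choose i))"
proof -
  have "(\<Sum>x\<in>UNIV. (- 1) ^ k * x ^ (CARD('p) - 1 - (i - k)) * hasse k ([:v, u:] ^ (r - j)) x) =
      - (u ^ i * v ^ (c - j)) * of_int ((- 1) ^ k * int ((r - j) choose k) * int ((c - j + (i - k))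
          choose (i - k)))"
    if "k \<le> i" for k
  proof -
    have jk: "j + k < c + i" using that assms i_less by simp
    have exponents: "c + i - (j + k) = c - j + (i - k)" "c - j + (i - k) - (i - k) = c - j"
      using that assms i_less by auto
    have "(\<Sum>x\<in>UNIV. (- 1) ^ k * x ^ (CARD('p) - 1 - (i - k)) * hasse k ([:v, u:] ^ (r - j)) x) =
        (- 1) ^ k * of_nat ((r - j) choose k) * u ^ k * (\<Sum>x\<in>UNIV. x ^ (CARD('p) - 1 - (i - k)) * (v
            + u * x) ^ (c - j + (i - k)))"
      unfolding sum_distrib_left
    proof (intro sum.cong refl)
      fix x :: "'p mod_ring"
      have "x ^ (CARD('p) - 1 - (i - k)) * hasse k ([:v, u:] ^ (r - j)) x
          = x ^ (CARD('p) - 1 - (i - k)) * (of_nat ((r - j) choose k) * u ^ k * (v + u * x) ^ (c - j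
          + (i - k)))"
        using power_r_diff[OF jk, of "v + u * x"] by (simp only: hasse_linear_power diff_diff_left
            exponents)
      then show "(- 1) ^ k * x ^ (CARD('p) - 1 - (i - k)) * hasse k ([:v, u:] ^ (r - j)) x
          = (- 1) ^ k * of_nat ((r - j) choose k) * u ^ k * (x ^ (CARD('p) - 1 - (i - k)) * (v
          + u * x) ^ (c - j + (i - k)))"
        by (simp only: mult_ac)
    qed
    also have "(\<Sum>x\<in>UNIV. x ^ (CARD('p) - 1 - (i - k)) * (v + u * x) ^ (c - j + (i - k))) =
        - (of_nat ((c - j + (i - k)) choose (i - k)) * u ^ (i - k) * v ^ (c - j))"
      using sum_power_times_linear_power[of "i - k" "c - j + (i - k)" v u] that assms i_less c_less
      unfolding exponents(2) by simp
    also have "(- 1) ^ k * of_nat ((r - j) choose k) * u ^ k *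
        - (of_nat ((c - j + (i - k)) choose (i - k)) * u ^ (i - k) * v ^ (c - j))
        = - ((u ^ k * u ^ (i - k)) * v ^ (c - j)) * of_int ((- 1) ^ k * int ((r - j) choose k)
            * int ((c - j + (i - k)) choose (i - k)))"
      by simp
    also have "u ^ k * u ^ (i - k) = u ^ i" using that by (simp flip: power_add)
    finally show ?thesis .
  qed
  then have "taylor_sum ([:v, u:] ^ (r - j)) =
      - (u ^ i * v ^ (c - j)) * of_int (\<Sum>k\<le>i. (- 1) ^ k * int ((r - j) choose k) * int ((c - j
          + (i - k)) choose (i - k)))"
    unfolding taylor_sum_def by (subst sum.swap) (simp add: sum_distrib_left)
  also have "(\<Sum>k\<le>i. (- 1) ^ k * int ((r - j) choose k) * int ((c - j + (i - k)) choose (i - k)))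
      = (- 1) ^ i * int ((r - j - (c - j) - 1) choose i)"
    using r_large assms i_less by (intro sum_binomial_neg) simp
  also have "r - j - (c - j) - 1 = r - c - 1"
    using r_large assms i_less by simp
  finally show ?thesis by (simp add: power_minus[of u] mult_ac)
qed

lemma taylor_sum_low_degree:
  assumes "degree f \<le> i"
  shows "taylor_sum f = 0"
proof -
  have "taylor_sum f = (\<Sum>x\<in>UNIV. x ^ (CARD('p) - 1 - i) * (\<Sum>k\<le>i. (- x) ^ k * hasse k f x))"
    unfolding taylor_sum_def sum_distrib_left
  proof (intro sum.cong refl)
    fix x :: "'p mod_ring" and k assume "k \<in> {..i}"
    then have "CARD('p) - 1 - (i - k) = CARD('p) - 1 - i + k" using i_less c_less by simp
    then show "(- 1) ^ k * x ^ (CARD('p) - 1 - (i - k)) * hasse k f x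
      = x ^ (CARD('p) - 1 - i) * ((- x) ^ k * hasse k f x)"
      by (simp add: power_add power_minus[of x] mult_ac)
  qed
  also have "\<dots> = poly f 0 * (\<Sum>x\<in>UNIV. x ^ (CARD('p) - 1 - i))"
    by (simp only: taylor_at_zero[OF assms] sum_distrib_left mult.commute[of _ "poly f 0"])
  also have "(\<Sum>x\<in>UNIV. x ^ (CARD('p) - 1 - i) :: 'p mod_ring) = 0"
    using i_pos i_less c_less nat_dvd_not_less[of "CARD('p) - 1 - i" "CARD('p) - 1"]
    unfolding power_sum_mod_ring by simp
  finally show ?thesis by simp
qed

text \<open>If \<open>L\<close> has a nonzero coefficient at \<open>X\<close>, then \<open>L\<^bsup>r-i\<^esup> M\<^sup>i\<close> dehomogenises to a combination
  of the powers \<open>L\<^bsup>r-m\<^esup>\<close> with \<open>m \<le> i\<close>, on which the functional is a multiple of the binomial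
  coefficient. Otherwise it dehomogenises to a polynomial of degree at most \<open>i\<close>.\<close>

lemma taylor_sum_X_sub:
  assumes binom: "of_nat ((r - c - 1) choose i) = (0 :: 'p mod_ring)" and F: "F \<in> X_sub r i"
  shows "taylor_sum (dehom F) = 0"
proof (rule X_sub_annihilated[OF i_le_r _ _ _ F])
  fix A :: "'p mod_ring^2^2"
  let ?a = "A$1$1" and ?b = "A$1$2" and ?c = "A$2$1" and ?d = "A$2$2"
  have eq: "dehom (linX A ^ (r - i) * linY A ^ i) = [:?c, ?a:] ^ (r - i) * [:?d, ?b:] ^ i"
    by (simp add: hom_distribs linX_def linY_def)
  show "taylor_sum (dehom (linX A ^ (r - i) * linY A ^ i)) = 0"
  proof (cases "?a = 0")
    case True
    have "degree ([:?d, ?b:] ^ i) \<le> i"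
      using degree_power_le[of "[:?d, ?b:]" i] by (auto split: if_splits)
    then have "degree (smult (?c ^ (r - i)) ([:?d, ?b:] ^ i)) \<le> i"
      using degree_smult_le order.trans by blast
    moreover have "dehom (linX A ^ (r - i) * linY A ^ i) = smult (?c ^ (r - i)) ([:?d, ?b:] ^ i)"
      unfolding eq using True by (simp add: poly_const_pow)
    ultimately show ?thesis by (simp add: taylor_sum_low_degree)
  next
    case False
    define L where "L = [:?c, ?a:]"
    define e where "e = ?d - ?b * ?c / ?a"
    define w where "w m = of_nat (i choose m) * e ^ m * (?b / ?a) ^ (i - m)" for m
    \<comment> \<open>The second linear form is a combination of the first one and \<open>Y\<close>.\<close>
    have "[:?d, ?b:] = [:e:] + smult (?b / ?a) L"
      using False by (simp add: e_def L_def)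
    then have "[:?d, ?b:] ^ i = (\<Sum>m\<le>i. of_nat (i choose m) * [:e:] ^ m * smult (?b / ?a) L ^ (i - m))"
      by (simp only: binomial_ring)
    also have "\<dots> = (\<Sum>m\<le>i. smult (w m) (L ^ (i - m)))"
      by (simp add: poly_const_pow smult_power of_nat_poly w_def mult_ac)
    finally have "L ^ (r - i) * [:?d, ?b:] ^ i = (\<Sum>m\<le>i. smult (w m) (L ^ (r - i) * L ^ (i - m)))"
      by (simp add: sum_distrib_left)
    also have "\<dots> = (\<Sum>m\<le>i. smult (w m) (L ^ (r - m)))"
      using i_le_r by (intro sum.cong refl) (simp flip: power_add)
    finally show ?thesis
      using taylor_sum_linear_power[of _ ?c ?a] binom
      unfolding eq L_def[symmetric] by (simp add: taylor_sum_sum taylor_sum_smult)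
  qed
qed (simp_all add: hom_distribs taylor_sum_add taylor_sum_smult)

text \<open>When the binomial coefficient vanishes, both functionals annihilate \<open>X\<^bsub>r-i\<^esub>\<close>. On \<open>\<theta>\<^sup>i G\<close>
  one of them is, up to sign, the sum of \<open>G(x, 1)\<close> over all \<open>x\<close> and the other one the sum over
  \<open>x \<noteq> 0\<close>, so \<open>G\<close> vanishes at \<open>(0 : 1)\<close>. The group moves this point to every other one.\<close>

lemma X_sub_inter_V_filt:
  fixes F :: "'p bipoly"
  assumes binom: "of_nat ((r - c - 1) choose i) = (0 :: 'p mod_ring)"
    and F: "F \<in> X_sub r i" "theta ^ i dvd F"
  shows "theta ^ (i + 1) dvd F"
proof -
  define s where "s = r - i * (CARD('p) + 1)"
  have sub: "G_submodule GL2 Fp (V r) (X_sub r i)"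
    by (rule G_submodule_X_sub[OF i_le_r])
  then have "homogeneous r F"
    using F(1) G_submodule_V_simps(1) by blast
  then obtain G where G: "homogeneous s G" "F = theta ^ i * G"
    using F(2) unfolding s_def by (rule theta_power_dvd_homogeneousE)
  have value_0: "bival (A$2$1) (A$2$2) G = 0" if A: "invertible A" for A :: "'p mod_ring^2^2"
  proof -
    define f where "f = dehom (act A G)"
    define d where "d = det A ^ i"
    have d: "d \<noteq> 0" using A by (simp add: d_def invertible_det_nz)
    have AF: "act A F \<in> X_sub r i"
      by (rule G_submodule_V_simps(5)[OF sub A F(1)])
    have "dehom (act A F) = [:d:] * (dehom theta ^ i * f)"
      by (simp add: G(2) hom_distribs act_theta power_mult_distrib d_def f_def poly_const_pow)
    then have jets: "hasse k (dehom (act A F)) x = d * (if k = i then (- 1) ^ i * poly f x else 0)"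
      if "k \<le> i" for k x
      by (simp only: hasse_const_mult hasse_theta_power_mult[OF that])
    have "(\<Sum>x\<in>UNIV. poly f x) = 0"
      using jet_sum_X_sub[OF AF] d by (simp add: jet_sum_def jets sum_distrib_left[symmetric])
    moreover have "(\<Sum>x\<in>UNIV. x ^ (CARD('p) - 1) * poly f x) = 0"
    proof -
      have "(\<Sum>k\<le>i. (- 1) ^ k * x ^ (CARD('p) - 1 - (i - k)) * hasse k (dehom (act A F)) x) =
        d * (x ^ (CARD('p) - 1) * poly f x)" for x
      proof -
        have "(\<Sum>k\<le>i. (- 1) ^ k * x ^ (CARD('p) - 1 - (i - k)) * hasse k (dehom (act A F)) x) =
          (\<Sum>k\<le>i. if k = i then (- 1) ^ i * x ^ (CARD('p) - 1) * (d * ((- 1) ^ i * poly f x)) else 0)"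
          by (intro sum.cong refl) (auto simp: jets)
        also have "\<dots> = ((- 1) ^ i * (- 1) ^ i) * (d * (x ^ (CARD('p) - 1) * poly f x))"
          by simp
        also have "(- 1) ^ i * (- 1) ^ i = (1 :: 'p mod_ring)"
          by (simp flip: power_add mult_2)
        finally show ?thesis by simp
      qed
      then have "d * (\<Sum>x\<in>UNIV. x ^ (CARD('p) - 1) * poly f x) = 0"
        using taylor_sum_X_sub[OF binom AF] by (simp only: taylor_sum_def sum_distrib_left)
      then show ?thesis using d by simp
    qed
    moreover have "(\<Sum>x\<in>UNIV. poly f x) = poly f 0 + (\<Sum>x\<in>UNIV. x ^ (CARD('p) - 1) * poly f x)"
    proof -
      have "(\<Sum>x\<in>UNIV. x ^ (CARD('p) - 1) * poly f x) = (\<Sum>x\<in>UNIV - {0}. poly f x)"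
        using power_card_minus_one[where 'p='p] c_less
        by (intro sum.mono_neutral_cong_right) (auto simp: power_0_left)
      then show ?thesis by (simp add: sum.remove[of UNIV 0])
    qed
    ultimately have "poly f 0 = 0" by simp
    then have "bival 0 1 (act A G) = 0" by (simp add: bival_one f_def)
    then show ?thesis by (simp add: bival_act)
  qed
  have "theta dvd G"
  proof (rule theta_dvd_of_values[OF G(1)])
    fix x :: "'p mod_ring"
    show "poly (dehom G) x = 0"
      using value_0[of "mat2 1 0 x 1"] by (simp add: bival_one)
  next
    show "coeff (dehom G) s = 0"
      using value_0[of "mat2 0 1 1 0"] bival_infinity[OF G(1)] by simp
  qed
  then show ?thesis
    unfolding G(2) by (simp add: mult_dvd_mono)
qed

end

section \<open>A congruence between a generator and a multiple of \<open>\<theta>\<^sup>i\<close>\<close>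

lemma degree_prod_linear:
  fixes f :: "'b \<Rightarrow> 'a::comm_semiring_1 poly"
  assumes "\<And>x. x \<in> S \<Longrightarrow> degree (f x) \<le> 1"
  shows "degree (\<Prod>x\<in>S. f x) \<le> card S"
  using assms
proof (induction S rule: infinite_finite_induct)
  case (insert x S)
  then show ?case
    using degree_mult_le[of "f x" "\<Prod>x\<in>S. f x"] by fastforce
qed auto

lemma lagrange_evaluation:
  fixes G :: "'a::field poly" and x :: "nat \<Rightarrow> 'a"
  assumes inj: "inj_on x {..n}" and deg: "degree G \<le> n"
  shows "poly G z = (\<Sum>j\<le>n. (\<Prod>l\<in>{..n} - {j}. (z - x l) / (x j - x l)) * poly G (x j))"
proof -
  define b where "b j = (\<Prod>l\<in>{..n} - {j}. smult (1 / (x j - x l)) [:- x l, 1:])" for j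
  have value_b: "poly (b j) w = (\<Prod>l\<in>{..n} - {j}. (w - x l) / (x j - x l))" for j w
    by (simp add: b_def poly_prod diff_divide_distrib)
  have degree_b: "degree (b j) \<le> n" if "j \<le> n" for j
  proof -
    have "degree (b j) \<le> card ({..n} - {j})"
      unfolding b_def by (intro degree_prod_linear) (simp add: degree_smult_le[THEN order.trans])
    then show ?thesis using that by (simp add: card_Diff_singleton)
  qed
  define L where "L = (\<Sum>j\<le>n. smult (poly G (x j)) (b j))"
  have "G = L"
  proof (rule poly_eqI_degree)
    have card: "card (x ` {..n}) = n + 1" using card_image[OF inj] by simp
    then show "degree G < card (x ` {..n})" using deg by simp
    have "degree L \<le> n"
      unfolding L_def by (intro degree_sum_le) (auto intro: degree_b degree_smult_le[THEN order.trans])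
    then show "degree L < card (x ` {..n})" using card by simp
    fix w assume "w \<in> x ` {..n}"
    then obtain m where m: "m \<le> n" "w = x m" by blast
    have "poly (b j) w = (if j = m then 1 else 0)" if "j \<le> n" for j
    proof (cases "j = m")
      case True
      have "x m \<noteq> x l" if "l \<in> {..n} - {m}" for l
        using that m inj by (auto simp: inj_on_eq_iff)
      then show ?thesis
        by (simp add: value_b m(2) True)
    next
      case False
      then show ?thesis
        using m by (auto simp: value_b intro!: prod_zero bexI[of _ m])
    qed
    then show "poly G w = poly L w"
      using m by (simp add: L_def poly_sum if_distrib[of "\<lambda>t. _ * t"] cong: if_cong)
  qed
  then have "poly G z = poly L z" by simp
  then show ?thesis by (simp add: L_def poly_sum value_b mult.commute)
qed

lemma of_nat_fact_times_binomial:
  "of_nat (fact k * (n choose k)) = (\<Prod>l<k. of_nat n - of_nat l :: 'a::comm_ring_1)"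
proof (induction k)
  case (Suc k)
  have "Suc k * (n choose Suc k) = (n - k) * (n choose k)"
    by (simp only: binomial_absorption binomial_absorb_comp)
  then have "fact (Suc k) * (n choose Suc k) = fact k * (n choose k) * (n - k)"
    by (metis (no_types, lifting) fact_Suc mult.assoc mult.commute of_nat_id)
  then have "of_nat (fact (Suc k) * (n choose Suc k)) = of_nat (fact k * (n choose k)) * (of_nat (n
      - k) :: 'a)"
    by (simp only: of_nat_mult)
  also have "\<dots> = of_nat (fact k * (n choose k)) * (of_nat n - of_nat k)"
    by (cases "k \<le> n") (simp_all add: of_nat_diff binomial_eq_0)
  finally show ?case using Suc.IH by (simp add: mult.commute)
qed simp

text \<open>Since \<open>k!\<close> is invertible modulo \<open>p\<close>, the residue of \<open>binom(N - j, k)\<close> is a polynomial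
  function of degree \<open>k\<close> of \<open>j\<close>.\<close>

lemma binomial_polynomial:
  assumes "k < CARD('p::prime_card)"
  obtains B :: "'p::prime_card mod_ring poly" where "degree B \<le> k"
    "\<And>j. j \<le> N \<Longrightarrow> poly B (of_nat j) = of_nat ((N - j) choose k)"
proof
  let ?B = "smult (1 / of_nat (fact k)) (\<Prod>l<k. [:of_nat N - of_nat l, - 1:]) :: 'p mod_ring poly"
  have "degree (\<Prod>l<k. [:of_nat N - of_nat l, - 1 :: 'p mod_ring:]) \<le> card {..<k}"
    by (rule degree_prod_linear) simp
  then show "degree ?B \<le> k"
    using degree_smult_le order.trans by fastforce
  fix j assume "j \<le> N"
  have "\<not> CARD('p) dvd fact k"
    using assms prime_card[where 'a='p] by (simp add: prime_dvd_fact_iff)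
  then have nz: "of_nat (fact k) \<noteq> (0 :: 'p mod_ring)"
    by (simp only: of_nat_eq_0_mod_ring_iff not_False_eq_True)
  have "poly (\<Prod>l<k. [:of_nat N - of_nat l, - 1:]) (of_nat j)
      = (\<Prod>l<k. of_nat (N - j) - of_nat l :: 'p mod_ring)"
    using \<open>j \<le> N\<close> by (simp add: poly_prod of_nat_diff algebra_simps)
  also have "\<dots> = of_nat (fact k) * of_nat ((N - j) choose k)"
    by (simp only: of_nat_fact_times_binomial[symmetric] of_nat_mult)
  finally show "poly ?B (of_nat j) = of_nat ((N - j) choose k)"
    using nz by simp
qed

lemma X_sub_mono:
  assumes "j \<le> l" "l < CARD('p) - 1" "l \<le> r"
  shows "X_sub r j \<subseteq> (X_sub r l :: 'p::prime_card bipoly set)"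
proof (rule X_sub_least)
  show sub: "G_submodule GL2 Fp (V r) (X_sub r l :: 'p bipoly set)"
    using assms by (intro G_submodule_X_sub)
  define k where "k = l - j"
  let ?q = "CARD('p) - 1"
  \<comment> \<open>The torus weights of the monomials in \<open>X\<^bsup>r-l\<^esup> (Y + x X)\<^sup>l\<close> are separated by averaging over \<open>x\<close>.\<close>
  have mem: "varX ^ (r - l) * (varY + const x * varX) ^ l \<in> (X_sub r l :: 'p bipoly set)" for x
    using G_submodule_V_simps(5)[OF sub _ X_sub_generator, of "mat2 1 x 0 1"]
    by (simp add: hom_distribs add.commute)
  have "(\<Sum>x\<in>(UNIV :: 'p mod_ring set). const (x ^ (?q - k)) * (varX ^ (r - l) * (varY + const x
      * varX) ^ l)) =
      (\<Sum>x\<in>UNIV. \<Sum>m\<le>l. const (x ^ (?q - k + m)) * (of_nat (l choose m) * (varX ^ (r - l + m)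
          * varY ^ (l - m))))"
    by (simp add: add.commute[of varY] binomial_ring sum_distrib_left power_add hom_distribs
        power_mult_distrib mult_ac)
  also have "\<dots> = (\<Sum>m\<le>l. const (\<Sum>x\<in>UNIV. x ^ (?q - k + m)) * (of_nat (l choose m) * (varX ^ (r - l
      + m) * varY ^ (l - m))))"
    by (subst sum.swap) (simp add: hom_distribs sum_distrib_right)
  also have "\<dots> = (\<Sum>m\<le>l. if m = k then - (of_nat (l choose k) * (varX ^ (r - j) * varY ^ j)) else 0)"
  proof (intro sum.cong refl)
    fix m assume "m \<in> {..l}"
    then have "m \<le> l" by simp
    have kl: "k \<le> l" by (simp add: k_def)
    have "(\<Sum>x\<in>UNIV. x ^ (?q - k + m) :: 'p mod_ring) = (if m = k then - 1 else 0)"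
      using \<open>m \<le> l\<close> kl assms by (intro power_sum_shift) auto
    moreover have "r - l + k = r - j" "l - k = j" using assms by (auto simp: k_def)
    ultimately show "const (\<Sum>x\<in>UNIV. x ^ (?q - k + m)) * (of_nat (l choose m) * (varX ^ (r - l + m)
        * varY ^ (l - m)))
      = (if m = k then - (of_nat (l choose k) * (varX ^ (r - j) * varY ^ j) :: 'p bipoly) else 0)"
      by (simp add: hom_distribs)
  qed
  also have "\<dots> = const (- of_nat (l choose k)) * (varX ^ (r - j) * varY ^ j)"
    by (simp add: k_def hom_distribs)
  finally have "const (- of_nat (l choose k)) * (varX ^ (r - j) * varY ^ j) =
      (\<Sum>x\<in>(UNIV :: 'p mod_ring set). const (x ^ (?q - k)) * (varX ^ (r - l) * (varY + const x
          * varX) ^ l))"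
    by (rule sym)
  also have "\<dots> \<in> X_sub r l"
    by (intro G_submodule_V_simps(4,8)[OF sub] mem)
  finally have "const (- of_nat (l choose k)) * (varX ^ (r - j) * varY ^ j)
      \<in> (X_sub r l :: 'p bipoly set)" .
  then have "const (- 1 / of_nat (l choose k)) * (const (- of_nat (l choose k)) * (varX ^ (r - j)
      * varY ^ j)) \<in> (X_sub r l :: 'p bipoly set)"
    by (rule G_submodule_V_simps(4)[OF sub])
  moreover have "of_nat (l choose k) \<noteq> (0 :: 'p mod_ring)"
    using assms by (intro binomial_nonzero_mod_ring) (simp_all add: k_def)
  ultimately show "varX ^ (r - j) * varY ^ j \<in> (X_sub r l :: 'p bipoly set)"
    by (simp add: mult.assoc[symmetric] flip: const.hom_mult)
qed

lemma homogeneous_pencil: "homogeneous 1 (const x * varX + varY)"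
  by (intro homogeneous_add homogeneous_const_mult homogeneous_varX homogeneous_varY)

lemma dehom_pencil: "dehom (const x * varX + varY) = [:1, x:]"
  by (simp add: hom_distribs one_pCons)

context form_parameters
begin

text \<open>The projection of translates of the generator of \<open>X\<^bsub>r-j\<^esub>\<close> to an eigenspace of the diagonal
  matrices. The factor is \<open>x\<^bsup>-i\<^esup>\<close> for \<open>x \<noteq> 0\<close> and vanishes at \<open>x = 0\<close>, where the substitution
  degenerates.\<close>

definition gen_sum :: "nat \<Rightarrow> 'p bipoly" where
  "gen_sum j = - (\<Sum>x\<in>UNIV. const (x ^ (CARD('p) - 1 - i)) * ((const x * varX + varY) ^ (r - j)
      * varY ^ j))"

lemma gen_sum_in_X_sub:
  assumes "j \<le> i"
  shows "gen_sum j \<in> X_sub r j"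
proof -
  have sub: "G_submodule GL2 Fp (V r) (X_sub r j :: 'p bipoly set)"
    using assms i_le_r by (intro G_submodule_X_sub) simp
  have "const (x ^ (CARD('p) - 1 - i)) * ((const x * varX + varY) ^ (r - j) * varY ^ j) \<in> X_sub r j"
    for x :: "'p mod_ring"
  proof (cases "x = 0")
    case True
    moreover have "CARD('p) - 1 - i \<noteq> 0" using i_less c_less by simp
    ultimately show ?thesis
      using G_submodule_V_simps(2)[OF sub] by (simp only: power_0_left if_False const_0 mult_zero_left)
  next
    case False
    have "(const x * varX + varY) ^ (r - j) * varY ^ j \<in> X_sub r j"
      using G_submodule_V_simps(5)[OF sub _ X_sub_generator, of "mat2 x 0 1 1"] False
      by (simp add: hom_distribs)
    then show ?thesis by (rule G_submodule_V_simps(4)[OF sub])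
  qed
  then show ?thesis
    unfolding gen_sum_def by (intro G_submodule_V_simps(6,8)[OF sub])
qed

lemma dehom_gen_sum: "dehom (gen_sum j) = - (\<Sum>x\<in>UNIV. smult (x ^ (CARD('p) - 1 - i)) ([:1, x:] ^ (r
    - j)))"
  by (simp add: gen_sum_def dehom_pencil dehom.hom_uminus dehom.hom_sum dehom.hom_mult dehom.hom_power)

text \<open>The sum over \<open>x\<close> extracts the coefficient of \<open>x\<^bsup>i-k\<^esup>\<close> in \<open>(1 + y x)\<^bsup>c+i-k-j\<^esup>\<close>.\<close>

lemma hasse_gen_sum:
  assumes "k \<le> i" "j \<le> i"
  shows "hasse k (dehom (gen_sum j)) y
    = of_nat ((r - j) choose k) * of_nat ((c + i - k - j) choose (i - k)) * y ^ (i - k)"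
proof -
  have jk: "j + k < c + i" using assms i_less by simp
  have exps: "c + i - k - j = c + i - (j + k)" "CARD('p) - 1 - (i - k) = CARD('p) - 1 - i + k"
    "r - j - k = r - (j + k)"
    using assms i_less c_less by auto
  have power_reduced: "z ^ (r - j - k) = z ^ (c + i - k - j)" for z :: "'p mod_ring"
    unfolding exps(1,3) by (rule power_r_diff[OF jk])
  have "hasse k (dehom (gen_sum j)) y = - (\<Sum>x\<in>UNIV. x ^ (CARD('p) - 1 - i) * hasse k ([:1, x:] ^ (r
      - j)) y)"
  proof -
    have neg: "hasse k (- f) y = - hasse k f y" for f :: "'p mod_ring poly"
      using hasse_diff[of k 0 f y] by simp
    show ?thesis
      unfolding dehom_gen_sum neg hasse_sum by (simp only: hasse_smult)
  qed
  also have "(\<Sum>x\<in>UNIV. x ^ (CARD('p) - 1 - i) * hasse k ([:1, x:] ^ (r - j)) y) =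
    of_nat ((r - j) choose k) * (\<Sum>x\<in>UNIV. x ^ (CARD('p) - 1 - (i - k)) * (1 + y * x) ^ (c + i - k - j))"
    unfolding sum_distrib_left
  proof (intro sum.cong refl)
    fix x :: "'p mod_ring"
    show "x ^ (CARD('p) - 1 - i) * hasse k ([:1, x:] ^ (r - j)) y =
      of_nat ((r - j) choose k) * (x ^ (CARD('p) - 1 - (i - k)) * (1 + y * x) ^ (c + i - k - j))"
      unfolding hasse_linear_power power_reduced exps(2) power_add
      by (simp only: mult_ac)
  qed
  also have "(\<Sum>x\<in>UNIV. x ^ (CARD('p) - 1 - (i - k)) * (1 + y * x) ^ (c + i - k - j)) =
    - (of_nat ((c + i - k - j) choose (i - k)) * y ^ (i - k) * 1 ^ (c + i - k - j - (i - k)))"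
    using assms i_less c_less by (intro sum_power_times_linear_power) auto
  finally show ?thesis by simp
qed

text \<open>The coefficient is a multiple of a power sum whose order is congruent to \<open>c - (r - t)\<close>
  modulo \<open>p - 1\<close>; this number lies strictly between \<open>0\<close> and \<open>p - 1\<close>.\<close>

lemma coeff_gen_sum_top:
  assumes "r < t + (i + 1)"
  shows "coeff (dehom (gen_sum j)) t = 0"
proof (cases "t \<le> r")
  case True
  define m where "m = r - t"
  have m: "m \<le> i" "t = r - m" using assms True by (auto simp: m_def)
  have "[CARD('p) - 1 + (t - i) = 0 + (c - m)] (mod (CARD('p) - 1))"
  proof (rule cong_add)
    have "[r - (m + i) = c + i - (m + i)] (mod (CARD('p) - 1))"
      using m i_less by (intro r_diff_cong) simp
    then show "[t - i = c - m] (mod (CARD('p) - 1))" using m by simp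
  qed (simp add: cong_def)
  moreover have "CARD('p) - 1 + (t - i) = CARD('p) - 1 - i + t" "0 + (c - m) = c - m"
    using m r_large i_less c_less by auto
  ultimately have "[CARD('p) - 1 - i + t = c - m] (mod (CARD('p) - 1))" by (simp only:)
  then have "(\<Sum>x\<in>UNIV. x ^ (CARD('p) - 1 - i + t) :: 'p mod_ring) = 0"
    by (rule power_sum_eq_0_of_cong) (use m i_less c_less in auto)
  moreover have "coeff (dehom (gen_sum j)) t
    = - (of_nat ((r - j) choose t) * (\<Sum>x\<in>UNIV. x ^ (CARD('p) - 1 - i + t)))"
    by (simp add: dehom_gen_sum coeff_sum coeff_linear_power sum_distrib_left power_add mult_ac)
  ultimately show ?thesis by simp
next
  case False
  then show ?thesis
    by (simp add: dehom_gen_sum coeff_sum coeff_linear_power binomial_eq_0)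
qed

text \<open>The Lagrange coefficients that evaluate a polynomial of degree at most \<open>i\<close> at \<open>c + 1\<close>,
  given its values at \<open>0, \<dots>, i\<close>.\<close>

definition weight :: "nat \<Rightarrow> 'p mod_ring" where
  "weight j = (\<Prod>l\<in>{..i} - {j}. (of_nat (c + 1) - of_nat l) / (of_nat j - of_nat l))"

lemma weight_i_nonzero: "weight i \<noteq> 0"
proof -
  have top: "of_nat (c + 1) - of_nat l \<noteq> (0 :: 'p mod_ring)" if "l \<le> i" for l
    unfolding right_minus_eq
    by (rule not_sym, rule of_nat_neq_mod_ring) (use that i_less c_less in simp_all)
  have nodes: "of_nat i - of_nat l \<noteq> (0 :: 'p mod_ring)" if "l < i" for l
    unfolding right_minus_eq
    by (rule not_sym, rule of_nat_neq_mod_ring) (use that i_less c_less in simp_all)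
  show ?thesis
    unfolding weight_def using top nodes by (auto simp: prod_zero_iff simp del: of_nat_Suc of_nat_add)
qed

definition critical :: "'p bipoly" where
  "critical = (\<Sum>j\<le>i. const (weight j) * gen_sum j)"

text \<open>By \<open>hasse_gen_sum\<close> the Hasse derivatives of \<^const>\<open>gen_sum\<close> \<open>j\<close> depend on \<open>j\<close> through a product
  of two binomial coefficients, a polynomial function of degree \<open>k + (i - k)\<close>. The weights
  extrapolate it to \<open>j = c + 1\<close>, where the second factor is \<open>binom(i - k - 1, i - k) = 0\<close> unless
  \<open>k = i\<close>.\<close>

lemma hasse_critical:
  assumes "k \<le> i"
  shows "hasse k (dehom critical) y = (if k = i then of_nat ((r - c - 1) choose i) else 0)"
proof -
  have inj: "inj_on (of_nat :: nat \<Rightarrow> 'p mod_ring) {..i}"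
    by (rule linorder_inj_onI) (use of_nat_neq_mod_ring[where 'p='p] i_less c_less in auto)
  have kp: "k < CARD('p)" "i - k < CARD('p)" using assms i_less c_less by auto
  obtain B :: "'p mod_ring poly" where B: "degree B \<le> k"
    "\<And>j. j \<le> r \<Longrightarrow> poly B (of_nat j) = of_nat ((r - j) choose k)"
    using binomial_polynomial[OF kp(1), of r] by blast
  obtain B' :: "'p mod_ring poly" where B': "degree B' \<le> i - k"
    "\<And>j. j \<le> c + i - k \<Longrightarrow> poly B' (of_nat j) = of_nat ((c + i - k - j) choose (i - k))"
    using binomial_polynomial[OF kp(2), of "c + i - k"] by blast
  have deg: "degree (B * B') \<le> i"
    using degree_mult_le[of B B'] B(1) B'(1) assms by linarith
  have "hasse k (dehom critical) y = (\<Sum>j\<le>i. weight j * hasse k (dehom (gen_sum j)) y)"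
    by (simp add: critical_def hom_distribs hasse_sum hasse_smult)
  also have "\<dots> = (\<Sum>j\<le>i. weight j * poly (B * B') (of_nat j)) * y ^ (i - k)"
    unfolding sum_distrib_right
  proof (intro sum.cong refl)
    fix j assume "j \<in> {..i}"
    then have j: "j \<le> i" "j \<le> r" "j \<le> c + i - k" using i_le_r i_less assms by auto
    show "weight j * hasse k (dehom (gen_sum j)) y = weight j * poly (B * B') (of_nat j) * y ^ (i - k)"
      by (simp only: hasse_gen_sum[OF assms j(1)] poly_mult B(2)[OF j(2)] B'(2)[OF j(3)] mult.assoc)
  qed
  also have "(\<Sum>j\<le>i. weight j * poly (B * B') (of_nat j)) = poly (B * B') (of_nat (c + 1))"
    using lagrange_evaluation[OF inj deg, of "of_nat (c + 1)"] unfolding weight_def ..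
  also have "poly (B * B') (of_nat (c + 1)) = (if k = i then of_nat ((r - c - 1) choose i) else 0)"
  proof (cases "k = i")
    case True
    have "poly B' (of_nat (c + 1)) = 1"
    proof -
      obtain b where "B' = [:b:]" using B'(1) True by (auto elim: degree_eq_zeroE)
      then show ?thesis using B'(2)[of 0] True by simp
    qed
    then show ?thesis using True B(2)[of "c + 1"] r_large by (simp del: of_nat_Suc of_nat_add)
  next
    case False
    then have "c + i - k - (c + 1) < i - k" using assms by simp
    then have "poly B' (of_nat (c + 1)) = 0"
      using B'(2)[of "c + 1"] False assms by (simp only: binomial_eq_0 of_nat_0)
    then show ?thesis using False by simp
  qed
  finally show ?thesis by simp
qed

lemma critical_in_X_sub: "critical \<in> X_sub r i"
proof -
  have sub: "G_submodule GL2 Fp (V r) (X_sub r i :: 'p bipoly set)"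
    by (rule G_submodule_X_sub[OF i_le_r])
  have "gen_sum j \<in> X_sub r i" if "j \<le> i" for j
    using gen_sum_in_X_sub[OF that] X_sub_mono[OF that _ i_le_r, where 'p='p] i_less c_less by auto
  then show ?thesis
    unfolding critical_def by (intro G_submodule_V_simps(4,8)[OF sub]) simp_all
qed

lemma coeff_critical_top: "r < t + (i + 1) \<Longrightarrow> coeff (dehom critical) t = 0"
  by (simp add: critical_def hom_distribs coeff_sum coeff_gen_sum_top)

text \<open>The two forms have the same Hasse derivatives up to order \<open>i\<close> at every point \<open>(x : 1)\<close>,
  and both vanish to order \<open>i + 1\<close> at \<open>(1 : 0)\<close>. If the binomial coefficient does not vanish, this
  puts \<open>\<theta>\<^sup>i Y\<^bsup>r-i(p+1)\<^esup>\<close> into \<open>X\<^bsub>r-i\<^esub> + V\<^sub>r\<^bsup>(i+1)\<^esup>\<close>.\<close>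

lemma critical_congruence:
  "critical - const ((- 1) ^ i * of_nat ((r - c - 1) choose i)) * (theta ^ i * varY ^ (r
      - i * (CARD('p) + 1)))
    \<in> V_filt r (i + 1)"
  (is "?F \<in> _")
proof -
  let ?k = "(- 1) ^ i * of_nat ((r - c - 1) choose i) :: 'p mod_ring"
  have deh: "dehom ?F = dehom critical - smult ?k (dehom theta ^ i * 1)"
    by (simp add: dehom.hom_minus dehom.hom_mult dehom.hom_power)
  have "homogeneous (i * (CARD('p) + 1) + (r - i * (CARD('p) + 1)) * 1)
      (theta ^ i * varY ^ (r - i * (CARD('p) + 1)) :: 'p bipoly)"
    by (intro homogeneous_mult homogeneous_power homogeneous_theta homogeneous_varY)
  then have hom: "homogeneous r ?F"
    using r_ge homogeneous_in_X_sub[OF critical_in_X_sub i_le_r]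
    by (intro homogeneous_diff homogeneous_const_mult) auto
  obtain G where "?F = theta ^ (i + 1) * G"
  proof (rule theta_power_dvdE[OF hom])
    show "hasse k (dehom ?F) x = 0" if "k < i + 1" for k x
    proof -
      have k: "k \<le> i" using that by simp
      have sq: "(- 1) ^ i * (- 1) ^ i = (1 :: 'p mod_ring)" by (simp flip: power_add mult_2)
      have "hasse k (dehom ?F) x = hasse k (dehom critical) x - ?k * (if k = i then (- 1) ^ i else 0)"
        unfolding deh hasse_diff hasse_smult hasse_theta_power_mult[OF k] by simp
      also have "\<dots> = 0"
        unfolding hasse_critical[OF k] using sq by (simp add: mult.commute mult.left_commute)
      finally show ?thesis .
    qed
    show "coeff (dehom ?F) t = 0" if "r < t + (i + 1)" for t
    proof -
      have "degree (dehom (theta :: 'p bipoly) ^ i) = i * CARD('p)"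
        by (simp add: degree_power_eq dehom_theta_nonzero degree_dehom_theta)
      moreover have "i * CARD('p) < t"
        using that r_ge i_less c_less by (simp add: algebra_simps)
      ultimately show ?thesis
        unfolding deh using coeff_critical_top[OF that] by (simp add: coeff_eq_0)
    qed
  qed
  then show ?thesis using hom by (simp add: V_filt_def V_simps)
qed

end

section \<open>The submodules defining the two quotients\<close>

context form_parameters
begin

text \<open>As for \<^const>\<open>jet_sum\<close>, every Hasse derivative of order at most \<open>i\<close> is a sum over \<open>x\<close> of a
  polynomial of degree at most \<open>c < p - 1\<close> in \<open>x\<close>. The coefficients that decide the order at
  \<open>(1 : 0)\<close> are multiples of power sums of orders not divisible by \<open>p - 1\<close>.\<close>

lemma pencil_average_in_V_filt:
  "(\<Sum>x\<in>UNIV. (const x * varX + varY) ^ (r - i) * varX ^ i) \<in> (V_filt r (i + 1) :: 'p bipoly set)"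
  (is "?Z \<in> _")
proof -
  have hom: "homogeneous r ?Z"
    using i_le_r homogeneous_lin_powers[OF homogeneous_pencil homogeneous_varX, of "r - i" i]
    by (intro homogeneous_sum) simp
  have deh: "dehom ?Z = (\<Sum>x\<in>UNIV. [:1, x:] ^ (r - i) * monom 1 i)"
    by (simp add: dehom.hom_sum dehom.hom_mult dehom.hom_power dehom_pencil monom_altdef)
  obtain G where "?Z = theta ^ (i + 1) * G"
  proof (rule theta_power_dvdE[OF hom])
    show "hasse k (dehom ?Z) y = 0" if "k < i + 1" for k y
    proof -
      have vanish: "(\<Sum>x\<in>UNIV. hasse l ([:1, x:] ^ (r - i)) y) = 0" if "l \<le> i" for l
      proof -
        have exps: "r - i - l = r - (i + l)" "c + i - (i + l) = c - l" by simp_all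
        have "hasse l ([:1, x:] ^ (r - i)) y = of_nat ((r - i) choose l) * poly ([:0, 1:] ^ l
            * [:1, y:] ^ (c - l)) x" for x
          unfolding hasse_linear_power exps(1) using that i_less
          by (subst power_r_diff) (simp_all add: mult_ac)
        moreover have "degree ([:0, 1:] ^ l * [:1, y:] ^ (c - l)) \<le> c"
        proof -
          have "degree ([:1, y:] ^ (c - l)) \<le> c - l"
            using degree_power_le[of "[:1, y:]" "c - l"] by (auto split: if_splits)
          moreover have "degree ([:0, 1 :: 'p mod_ring:] ^ l) \<le> l"
            using degree_power_le[of "[:0, 1 :: 'p mod_ring:]" l] by simp
          ultimately show ?thesis
            using degree_mult_le[of "[:0, 1:] ^ l" "[:1, y:] ^ (c - l)"] that i_less by linarith
        qed
        ultimately show ?thesis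
          using c_less by (simp only: sum_distrib_left[symmetric] sum_poly_eq_0 le_less_trans
              mult_zero_right)
      qed
      have "hasse k (dehom ?Z) y = (\<Sum>l\<le>k. (\<Sum>x\<in>UNIV. hasse l ([:1, x:] ^ (r - i)) y) * hasse (k
          - l) (monom 1 i) y)"
        unfolding deh hasse_sum hasse_mult by (subst sum.swap) (simp add: sum_distrib_right)
      also have "\<dots> = 0"
        using that vanish by (intro sum.neutral) simp
      finally show ?thesis .
    qed
    show "coeff (dehom ?Z) t = 0" if "r < t + (i + 1)" for t
    proof -
      have "i \<le> t" using that r_large i_less by simp
      then have *: "coeff (dehom ?Z) t = of_nat ((r - i) choose (t - i)) * (\<Sum>x\<in>UNIV. x ^ (t - i))"
        by (simp add: deh coeff_sum mult.commute[of _ "monom 1 i"] coeff_monom_mult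
            coeff_linear_power sum_distrib_left)
      show ?thesis
      proof (cases "t \<le> r")
        case True
        define m where "m = r - t"
        have m: "m \<le> i" "t = r - m" using that True by (auto simp: m_def)
        have "[r - (m + i) = c + i - (m + i)] (mod (CARD('p) - 1))"
          using m i_less by (intro r_diff_cong) simp
        moreover have "r - (m + i) = t - i" "c + i - (m + i) = c - m" using m by auto
        ultimately have "[t - i = c - m] (mod (CARD('p) - 1))" by (simp only:)
        then have "(\<Sum>x\<in>UNIV. x ^ (t - i) :: 'p mod_ring) = 0"
          by (rule power_sum_eq_0_of_cong) (use m i_less c_less in auto)
        then show ?thesis by (simp add: *)
      next
        case False
        then have "r - i < t - i" using i_le_r by simp
        then show ?thesis by (simp add: * binomial_eq_0)
      qed
    qed
  qed
  then show ?thesis using hom by (simp add: V_filt_def V_simps)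
qed

text \<open>By \<open>critical_congruence\<close>, \<^const>\<open>critical\<close> lies in \<open>V\<^sub>r\<^bsup>(i)\<^esup>\<close>; its component of index \<open>i\<close> has a
  nonzero weight while the others lie in \<open>X\<^bsub>r-i+1\<^esub>\<close>. So \<^const>\<open>gen_sum\<close> \<open>i\<close> lies in the sum on the
  right. Modulo \<open>X\<^bsub>r-i+1\<^esub>\<close> it is, up to sign, the sum of \<open>(x X + Y)\<^bsup>r-i\<^esup> X\<^sup>i\<close> over \<open>x \<noteq> 0\<close>; by
  \<open>pencil_average_in_V_filt\<close> this is \<open>- Y\<^bsup>r-i\<^esup> X\<^sup>i\<close> modulo \<open>V\<^sub>r\<^bsup>(i+1)\<^esup>\<close>, which the exchange of \<open>X\<close>
  and \<open>Y\<close> takes to the generator.\<close>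

lemma generator_congruence:
  "varX ^ (r - i) * varY ^ i \<in> X_sub r (i - 1) <+>\<^bsub>V r\<^esub> (V_filt r i :: 'p bipoly set)"
  (is "_ \<in> ?U")
proof -
  have subX: "G_submodule GL2 Fp (V r) (X_sub r (i - 1) :: 'p bipoly set)"
    using i_le_r by (intro G_submodule_X_sub) simp
  have subV: "G_submodule GL2 Fp (V r) (V_filt r i :: 'p bipoly set)"
    by (rule G_submodule_V_filt)
  have subU: "G_submodule GL2 Fp (V r) ?U"
    by (rule G_submodule_set_add[OF subX subV])
  note U = G_submodule_V_simps[OF subU]
  have XU: "F \<in> ?U" if "F \<in> X_sub r (i - 1)" for F
    using that G_submodule_V_simps(2)[OF subV] unfolding set_add_V by force
  have VU: "F \<in> ?U" if "F \<in> V_filt r i" for F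
    using that G_submodule_V_simps(2)[OF subX] unfolding set_add_V by force
  have XjU: "F \<in> ?U" if "F \<in> X_sub r j" "j < i" for F j
  proof -
    have "X_sub r j \<subseteq> (X_sub r (i - 1) :: 'p bipoly set)"
      using that i_le_r i_less c_less by (intro X_sub_mono) auto
    then show ?thesis using that XU by blast
  qed
  have filt: "V_filt r (i + 1) \<subseteq> (V_filt r i :: 'p bipoly set)"
    by (auto simp: V_filt_def dest: power_le_dvd[of _ _ _ i])
  have "critical \<in> V_filt r i"
  proof -
    let ?M = "const ((- 1) ^ i * of_nat ((r - c - 1) choose i)) * (theta ^ i * varY ^ (r
        - i * (CARD('p) + 1))) :: 'p bipoly"
    have "theta ^ i dvd critical - ?M"
      using subsetD[OF filt critical_congruence] unfolding V_filt_def by blast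
    moreover have "theta ^ i dvd ?M" by (intro dvd_mult dvd_mult2) simp
    ultimately have "theta ^ i dvd critical - ?M + ?M" by (rule dvd_add)
    then show ?thesis
      using homogeneous_in_X_sub[OF critical_in_X_sub i_le_r] by (simp add: V_filt_def V_simps)
  qed
  then have crit: "critical \<in> ?U" by (rule VU)
  have "critical = const (weight i) * gen_sum i + (\<Sum>j<i. const (weight j) * gen_sum j)"
    by (simp add: critical_def lessThan_Suc_atMost[symmetric])
  then have "const (weight i) * gen_sum i = critical - (\<Sum>j<i. const (weight j) * gen_sum j)"
    by simp
  also have "\<dots> \<in> ?U"
    by (intro U(4,7,8) crit XjU[OF gen_sum_in_X_sub]) simp_all
  finally have "const (1 / weight i) * (const (weight i) * gen_sum i) \<in> ?U" by (rule U(4))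
  then have gen: "gen_sum i \<in> ?U"
    using weight_i_nonzero by (simp add: mult.assoc[symmetric] flip: const.hom_mult)
  let ?S = "\<lambda>x. const x * varX + varY :: 'p bipoly"
  let ?e = "CARD('p) - 1 - i"
  \<comment> \<open>Modulo \<open>X\<^bsub>r-i+1\<^esub>\<close> a power \<open>Y\<^sup>i\<close> next to \<open>(x X + Y)\<^bsup>r-i\<^esup>\<close> may be replaced by \<open>(- x X)\<^sup>i\<close>.\<close>
  have replace: "?S x ^ (r - i) * varY ^ i - const ((- x) ^ i) * (?S x ^ (r - i) * varX ^ i) \<in> ?U" for x
  proof -
    have "varY ^ i = (const (- x) * varX + ?S x) ^ i" by (simp add: const.hom_uminus)
    also have "\<dots> = (\<Sum>m\<le>i. of_nat (i choose m) * (const (- x) * varX) ^ m * ?S x ^ (i - m))"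
      by (rule binomial_ring)
    finally have "?S x ^ (r - i) * varY ^ i =
        (\<Sum>m\<le>i. const (of_nat (i choose m) * (- x) ^ m) * ((?S x ^ (r - i) * ?S x ^ (i - m))
            * varX ^ m))"
      by (simp add: sum_distrib_left const.hom_mult const.hom_power const.hom_of_nat
          power_mult_distrib mult_ac)
    also have "\<dots> = (\<Sum>m\<le>i. const (of_nat (i choose m) * (- x) ^ m) * (?S x ^ (r - m) * varX ^ m))"
      using i_le_r by (intro sum.cong refl) (simp flip: power_add)
    also have "\<dots> = const ((- x) ^ i) * (?S x ^ (r - i) * varX ^ i)
        + (\<Sum>m<i. const (of_nat (i choose m) * (- x) ^ m) * (?S x ^ (r - m) * varX ^ m))"
      by (simp add: lessThan_Suc_atMost[symmetric])
    finally have "?S x ^ (r - i) * varY ^ i - const ((- x) ^ i) * (?S x ^ (r - i) * varX ^ i)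
        = (\<Sum>m<i. const (of_nat (i choose m) * (- x) ^ m) * (?S x ^ (r - m) * varX ^ m))"
      by simp
    also have "\<dots> \<in> ?U"
    proof (intro U(4,8))
      fix m assume "m \<in> {..<i}"
      then have m: "m < i" by simp
      have "?S x ^ (r - m) * varX ^ m \<in> X_sub r m"
        using G_submodule_V_simps(5)[OF G_submodule_X_sub _ X_sub_generator, of m r "mat2 x 1 1 0"]
            m i_le_r
        by (simp add: hom_distribs)
      then show "?S x ^ (r - m) * varX ^ m \<in> ?U" using XjU m by blast
    qed
    finally show ?thesis .
  qed
  let ?Z = "\<Sum>x\<in>UNIV. ?S x ^ (r - i) * varX ^ i"
  have "const (x ^ ?e) * (const ((- x) ^ i) * (?S x ^ (r - i) * varX ^ i))
      = const ((- 1) ^ i) * (?S x ^ (r - i) * varX ^ i - (if x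
          = 0 then varY ^ (r - i) * varX ^ i else 0))" for x :: "'p mod_ring"
  proof -
    have "x ^ ?e * (- x) ^ i = (- 1) ^ i * (x ^ ?e * x ^ i)"
      by (simp add: power_minus[of x] mult_ac)
    also have "x ^ ?e * x ^ i = x ^ (CARD('p) - 1)"
      using i_less c_less by (simp flip: power_add)
    also have "x ^ (CARD('p) - 1) = (if x = 0 then 0 else 1)"
      using c_less power_card_minus_one[of x] by (simp add: power_0_left)
    finally have "const (x ^ ?e) * (const ((- x) ^ i) * (?S x ^ (r - i) * varX ^ i))
        = const ((- 1) ^ i * (if x = 0 then 0 else 1)) * (?S x ^ (r - i) * varX ^ i)"
      by (simp only: const.hom_mult[symmetric] mult.assoc[symmetric])
    also have "\<dots> = const ((- 1) ^ i) * (?S x ^ (r - i) * varX ^ i - (if x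
        = 0 then varY ^ (r - i) * varX ^ i else 0))"
      by (cases "x = 0") (simp_all only: if_True if_False mult_zero_right mult_1_right const_0
          mult_zero_left add_0_left diff_self diff_zero refl)
    finally show ?thesis .
  qed
  then have "(\<Sum>x\<in>UNIV. const (x ^ ?e) * (const ((- x) ^ i) * (?S x ^ (r - i) * varX ^ i)))
      = const ((- 1) ^ i) * (?Z - (\<Sum>x\<in>(UNIV :: 'p mod_ring set). if x
          = 0 then varY ^ (r - i) * varX ^ i else 0))"
    by (simp only: sum_distrib_left[symmetric] sum_subtractf)
  also have "(\<Sum>x\<in>(UNIV :: 'p mod_ring set). if x = 0 then varY ^ (r - i) * varX ^ i else 0)
      = (varY ^ (r - i) * varX ^ i :: 'p bipoly)"
    by simp
  finally have sum_eq: "(\<Sum>x\<in>UNIV. const (x ^ ?e) * (const ((- x) ^ i) * (?S x ^ (r - i) * varX ^ i)))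
      = const ((- 1) ^ i) * (?Z - varY ^ (r - i) * varX ^ i)" .
  have "const ((- 1) ^ i) * (?Z - varY ^ (r - i) * varX ^ i) =
      - gen_sum i - (\<Sum>x\<in>UNIV. const (x ^ ?e) * (?S x ^ (r - i) * varY ^ i - const ((- x) ^ i)
          * (?S x ^ (r - i) * varX ^ i)))"
    unfolding right_diff_distrib[of "const (_ ^ ?e)"] sum_subtractf sum_eq
    by (simp only: gen_sum_def minus_minus diff_diff_eq2 add_diff_cancel_left')
  also have "\<dots> \<in> ?U"
    by (intro U(4,6,7,8) gen replace)
  finally have "const ((- 1) ^ i) * (const ((- 1) ^ i) * (?Z - varY ^ (r - i) * varX ^ i)) \<in> ?U"
    by (rule U(4))
  moreover have "const ((- 1) ^ i) * (const ((- 1) ^ i) * F) = F" for F :: "'p bipoly"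
  proof -
    have "(- 1) ^ i * (- 1) ^ i = (1 :: 'p mod_ring)" by (simp flip: power_add mult_2)
    then show ?thesis by (simp only: mult.assoc[symmetric] const.hom_mult[symmetric] const_1
        mult_1_left)
  qed
  ultimately have diff: "?Z - varY ^ (r - i) * varX ^ i \<in> ?U" by (simp only:)
  have "?Z \<in> ?U" by (rule VU[OF subsetD[OF filt pencil_average_in_V_filt]])
  from U(7)[OF this diff] have swapped: "varY ^ (r - i) * varX ^ i \<in> ?U" by simp
  have "act (mat2 0 1 1 0) (varY ^ (r - i) * varX ^ i) \<in> ?U"
    by (rule U(5)[OF _ swapped]) simp
  then show ?thesis by (simp add: hom_distribs)
qed

text \<open>This inclusion is what makes \<open>Q(i - 1)\<close> a quotient of \<open>Q(i)\<close>.\<close>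

lemma X_sub_subset_sum: "X_sub r i \<subseteq> X_sub r (i - 1) <+>\<^bsub>V r\<^esub> (V_filt r i :: 'p bipoly set)"
  using i_le_r
  by (intro X_sub_least G_submodule_set_add G_submodule_X_sub G_submodule_V_filt
      generator_congruence) simp

end

section \<open>The projection onto the top constituent\<close>

text \<open>The sum of \<open>F(v) (v \<and> (X, Y))\<^sup>n\<close> over all vectors \<open>v = (u, w)\<close>, where
  \<open>v \<and> (X, Y) = u Y - w X\<close>. It sees only the values of \<open>F\<close>, so it annihilates the multiples of
  \<open>\<theta>\<close>.\<close>

definition form_trace :: "nat \<Rightarrow> 'p::prime_card bipoly \<Rightarrow> 'p bipoly" where
  "form_trace n F = (\<Sum>u\<in>UNIV. \<Sum>w\<in>UNIV. const (bival u w F) * (const u * varY - const w * varX) ^ n)"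

lemma homogeneous_form_trace: "homogeneous n (form_trace n F)"
proof -
  have "homogeneous 1 (const u * varY - const w * varX :: 'a bipoly)" for u w
    by (intro homogeneous_diff homogeneous_const_mult homogeneous_varX homogeneous_varY)
  from homogeneous_power[OF this] show ?thesis
    unfolding form_trace_def by (intro homogeneous_sum homogeneous_const_mult) (metis mult_1_right)
qed

lemma form_trace_add: "form_trace n (F + G) = form_trace n F + form_trace n G"
  by (simp add: form_trace_def hom_distribs distrib_right sum.distrib)

lemma form_trace_const: "form_trace n (const c * F) = const c * form_trace n F"
  by (simp add: form_trace_def hom_distribs sum_distrib_left mult.assoc)

lemma form_trace_sum: "form_trace n (sum f A) = (\<Sum>a\<in>A. form_trace n (f a))"
  by (induction A rule: infinite_finite_induct)
    (simp_all add: form_trace_add, simp_all add: form_trace_def)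

lemma form_trace_theta: "form_trace n (theta * F) = 0"
  by (simp add: form_trace_def hom_distribs)

text \<open>The substitution \<open>v \<mapsto> v A\<close> permutes the vectors, and
  \<open>v A \<and> (X, Y) A = det A (v \<and> (X, Y))\<close>.\<close>

lemma form_trace_act:
  assumes "invertible A"
  shows "const (det A ^ n) * form_trace n (act A F) = act A (form_trace n F)"
proof -
  define d where "d = det A"
  have d: "d \<noteq> 0" "d = A$1$1 * A$2$2 - A$1$2 * A$2$1"
    using assms by (simp_all add: d_def invertible_det_nz det_2)
  define g where "g = (\<lambda>(u, w). (A$1$1 * u + A$2$1 * w, A$1$2 * u + A$2$2 * w))"
  define g' where "g' = (\<lambda>(u, w). ((A$2$2 * u - A$2$1 * w) / d, (A$1$1 * w - A$1$2 * u) / d))"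
  have inv: "g' (g v) = v" "g (g' v) = v" for v
  proof -
    obtain u w where v: "v = (u, w)" by (cases v)
    have "A$2$2 * (A$1$1 * u + A$2$1 * w) - A$2$1 * (A$1$2 * u + A$2$2 * w) = d * u"
      "A$1$1 * (A$1$2 * u + A$2$2 * w) - A$1$2 * (A$1$1 * u + A$2$1 * w) = d * w"
      by (simp_all add: d(2) algebra_simps)
    then show "g' (g v) = v" using d(1) by (simp add: g_def g'_def v)
    have "A$1$1 * (A$2$2 * u - A$2$1 * w) + A$2$1 * (A$1$1 * w - A$1$2 * u) = d * u"
      "A$1$2 * (A$2$2 * u - A$2$1 * w) + A$2$2 * (A$1$1 * w - A$1$2 * u) = d * w"
      by (simp_all add: d(2) algebra_simps)
    then show "g (g' v) = v"
      using d(1) by (simp add: g_def g'_def v flip: add_divide_distrib)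
  qed
  define t where "t = (\<lambda>(u, w). const (bival u w F) * (const u * linY A - const w * linX A) ^ n)"
  have "act A (form_trace n F) = (\<Sum>u\<in>UNIV. \<Sum>w\<in>UNIV. t (u, w))"
    by (simp add: form_trace_def hom_distribs t_def)
  also have "\<dots> = (\<Sum>v\<in>UNIV. t v)"
    by (simp add: sum.cartesian_product)
  also have "\<dots> = (\<Sum>v\<in>UNIV. t (g v))"
    by (rule sum.reindex_bij_witness[of _ g g']) (simp_all add: inv)
  also have "\<dots> = (\<Sum>u\<in>UNIV. \<Sum>w\<in>UNIV. t (g (u, w)))"
    by (simp add: sum.cartesian_product)
  also have "\<dots> = (\<Sum>u\<in>UNIV. \<Sum>w\<in>UNIV. const (d ^ n) * (const (bival u w (act A F)) * (const u * varY
      - const w * varX) ^ n))"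
  proof (intro sum.cong refl)
    fix u w
    have "const (fst (g (u, w))) * linY A - const (snd (g (u, w))) * linX A
        = const d * (const u * varY - const w * varX)"
      by (simp add: g_def linX_def linY_def d(2) hom_distribs algebra_simps)
    then show "t (g (u, w)) = const (d ^ n) * (const (bival u w (act A F)) * (const u * varY
        - const w * varX) ^ n)"
      by (simp add: t_def case_prod_beta) (simp add: g_def bival_act power_mult_distrib
          const.hom_power mult_ac)
  qed
  also have "\<dots> = const (det A ^ n) * form_trace n (act A F)"
    by (simp add: form_trace_def sum_distrib_left d_def)
  finally show ?thesis ..
qed

text \<open>The sum over \<open>m\<close> of \<open>y\<^sup>m x\<^bsup>p-1-m\<^esup>\<close> is the divided difference of \<open>t\<^sup>p = t\<close>: it is \<open>1\<close> off
  the diagonal, and \<open>p y\<^bsup>p-1\<^esup> = 0\<close> on it.\<close>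

lemma interpolation_mod_ring:
  fixes f :: "'p::prime_card mod_ring \<Rightarrow> 'p mod_ring"
  shows "f y = (\<Sum>x\<in>UNIV. f x) - (\<Sum>m<CARD('p). y ^ m * (\<Sum>x\<in>UNIV. f x * x ^ (CARD('p) - 1 - m)))"
proof -
  have kernel: "(\<Sum>m<CARD('p). y ^ m * x ^ (CARD('p) - 1 - m)) = (if x = y then 0 else 1)" for x
  proof (cases "x = y")
    case True
    have "(\<Sum>m<CARD('p). y ^ m * y ^ (CARD('p) - 1 - m)) = (\<Sum>m<CARD('p). y ^ (CARD('p) - 1))"
      by (intro sum.cong refl) (simp flip: power_add)
    then show ?thesis using True by simp
  next
    case False
    have "(y - x) * (\<Sum>m<CARD('p). y ^ m * x ^ (CARD('p) - Suc m)) = y - x"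
      using diff_power_eq_sum[of y "CARD('p) - 1" x] finite_field_power_card_eq_same[of x]
        finite_field_power_card_eq_same[of y]
      by (simp add: mult.commute)
    then show ?thesis using False by simp
  qed
  have "(\<Sum>m<CARD('p). y ^ m * (\<Sum>x\<in>UNIV. f x * x ^ (CARD('p) - 1 - m)))
      = (\<Sum>x\<in>UNIV. f x * (\<Sum>m<CARD('p). y ^ m * x ^ (CARD('p) - 1 - m)))"
    unfolding sum_distrib_left by (subst sum.swap) (simp add: mult_ac)
  also have "\<dots> = (\<Sum>x\<in>UNIV. f x - (if x = y then f y else 0))"
    unfolding kernel by (intro sum.cong) auto
  finally show ?thesis by (simp add: sum_subtractf)
qed

context form_parameters
begin

text \<open>The degree of the cofactor of \<open>\<theta>\<^sup>i\<close> in \<open>V\<^sub>r\<close>, and the degree of the top constituent of the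
  \<open>i\<close>-th layer; their sum is divisible by \<open>p - 1\<close>, so the summands of \<^const>\<open>form_trace\<close> are constant
  on lines, apart from the origin.\<close>

definition layer_deg :: nat where "layer_deg = r - i * (CARD('p) + 1)"

definition trace_deg :: nat where "trace_deg = CARD('p) - 1 - (c - i)"

lemma layer_deg_ge: "CARD('p) \<le> layer_deg"
  using r_ge by (simp add: layer_deg_def)

lemma trace_deg_bounds: "0 < trace_deg" "trace_deg < CARD('p) - 1" "trace_deg + (c - i) = CARD('p) - 1"
  using i_pos i_less c_less by (auto simp: trace_deg_def)

lemma layer_deg_cong: "[layer_deg = c - i] (mod (CARD('p) - 1))"
proof -
  obtain q where q: "CARD('p) = q + 1"
    using c_less by (metis less_imp_Suc_add add.commute less_diff_conv plus_1_eq_Suc add_Suc_right)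
  have "layer_deg + i * (CARD('p) + 1) = r"
    using r_ge by (simp add: layer_deg_def)
  moreover have "c - i + i * (CARD('p) + 1) = c + i + i * (CARD('p) - 1)"
    using i_less by (simp add: q algebra_simps)
  moreover have "[r = c + i + i * (CARD('p) - 1)] (mod (CARD('p) - 1))"
    using r_cong by (simp add: cong_def)
  ultimately have "[layer_deg + i * (CARD('p) + 1) = c - i + i * (CARD('p) + 1)] (mod (CARD('p) - 1))"
    by (simp only:)
  then show ?thesis by (simp only: cong_add_rcancel_nat)
qed

lemma dvd_layer_deg_plus_trace_deg: "(CARD('p) - 1) dvd (layer_deg + trace_deg)"
proof -
  have "[layer_deg + trace_deg = c - i + trace_deg] (mod (CARD('p) - 1))"
    using layer_deg_cong by (intro cong_add) simp_all
  moreover have "c - i + trace_deg = CARD('p) - 1" using trace_deg_bounds by simp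
  ultimately show ?thesis by (simp add: cong_dvd_iff)
qed

lemma power_layer_deg_plus_trace_deg: "x ^ (layer_deg + trace_deg) = (if x = 0 then 0 else 1)"
    for x :: "'p mod_ring"
  using dvd_layer_deg_plus_trace_deg trace_deg_bounds power_eq_one_of_dvd[of x "layer_deg
      + trace_deg"] by (auto simp: power_0_left)

text \<open>Sorting the vectors \<open>v\<close> by the value of \<open>v \<and> (y, 1)\<close> writes the value of \<^const>\<open>form_trace\<close> at
  \<open>(y : 1)\<close> as a combination of sums of values of \<open>G\<close> on affine lines. Each of these is a multiple
  of the \<^const>\<open>jet_sum\<close> of one fixed translate of \<open>\<theta>\<^sup>i G\<close>. A form of degree below \<open>p\<close> that vanishes at
  all \<open>(y : 1)\<close> is zero.\<close>

lemma form_trace_X_sub: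
  fixes G :: "'p bipoly"
  assumes G: "homogeneous layer_deg G" and mem: "theta ^ i * G \<in> X_sub r i"
  shows "form_trace trace_deg G = 0"
proof -
  have "poly (dehom (form_trace trace_deg G)) y = 0" for y
  proof -
    define A :: "'p mod_ring^2^2" where "A = mat2 y 1 1 0"
    have A: "invertible A" "det A = - 1" by (simp_all add: A_def)
    have "act A (theta ^ i * G) \<in> X_sub r i"
      by (rule G_submodule_V_simps(5)[OF G_submodule_X_sub[OF i_le_r] A(1) mem])
    then have "jet_sum (act A (theta ^ i * G)) = 0" by (rule jet_sum_X_sub)
    moreover have "dehom (act A (theta ^ i * G)) = [:(- 1) ^ i:] * (dehom theta ^ i * dehom (act A G))"
      by (simp add: act.hom_mult act.hom_power act_theta A(2) power_mult_distrib
          dehom.hom_mult dehom.hom_power poly_const_pow)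
    ultimately have "(- 1) ^ i * ((- 1) ^ i * (\<Sum>x\<in>UNIV. poly (dehom (act A G)) x)) = 0"
      by (simp only: jet_sum_def hasse_const_mult hasse_theta_power_mult[OF order.refl] if_True
          simp_thms
          sum_distrib_left)
    then have "(\<Sum>x\<in>UNIV. poly (dehom (act A G)) x) = 0" by simp
    then have zero: "(\<Sum>x\<in>UNIV. bival (y * x + 1) x G) = 0"
      by (simp add: bival_one[symmetric] bival_act A_def)
    have "poly (dehom (form_trace trace_deg G)) y = (\<Sum>u\<in>UNIV. \<Sum>w\<in>UNIV. bival u w G * (u - w * y) ^
        trace_deg)"
      by (simp add: bival_one[symmetric] form_trace_def hom_distribs mult.commute[of _ y])
    also have "\<dots> = (\<Sum>w\<in>UNIV. \<Sum>u\<in>UNIV. bival u w G * (u - w * y) ^ trace_deg)"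
      by (rule sum.swap)
    also have "\<dots> = (\<Sum>w\<in>UNIV. \<Sum>t\<in>UNIV. bival (t + w * y) w G * t ^ trace_deg)"
    proof (rule sum.cong[OF refl])
      fix w
      show "(\<Sum>u\<in>UNIV. bival u w G * (u - w * y) ^ trace_deg)
          = (\<Sum>t\<in>UNIV. bival (t + w * y) w G * t ^ trace_deg)"
        by (rule sum.reindex_bij_witness[of _ "\<lambda>t. t + w * y" "\<lambda>u. u - w * y"]) simp_all
    qed
    also have "\<dots> = (\<Sum>t\<in>UNIV. \<Sum>w\<in>UNIV. bival (t + w * y) w G * t ^ trace_deg)"
      by (rule sum.swap)
    also have "\<dots> = 0"
    proof (rule sum.neutral, rule ballI)
      fix t :: "'p mod_ring"
      show "(\<Sum>w\<in>UNIV. bival (t + w * y) w G * t ^ trace_deg) = 0"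
      proof (cases "t = 0")
        case True
        then show ?thesis using trace_deg_bounds by (simp add: power_0_left)
      next
        case False
        have "(\<Sum>w\<in>UNIV. bival (t + w * y) w G * t ^ trace_deg)
            = (\<Sum>x\<in>UNIV. bival (t * (y * x + 1)) (t * x) G * t ^ trace_deg)"
          using False
          by (intro sum.reindex_bij_witness[of _ "\<lambda>x. t * x" "\<lambda>w. w / t"]) (auto simp: algebra_simps)
        also have "\<dots> = t ^ layer_deg * t ^ trace_deg * (\<Sum>x\<in>UNIV. bival (y * x + 1) x G)"
          unfolding bival_scale[OF G] sum_distrib_left by (simp only: mult_ac)
        finally show ?thesis by (simp add: zero)
      qed
    qed
    finally show ?thesis .
  qed
  moreover have "degree (dehom (form_trace trace_deg G)) < CARD('p)"
    using degree_dehom[OF homogeneous_form_trace[of trace_deg G]] trace_deg_bounds by linarith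
  ultimately have "dehom (form_trace trace_deg G) = 0"
    by (intro poly_eqI_degree[of UNIV]) simp_all
  then show ?thesis
    using dehom_inj[OF homogeneous_form_trace homogeneous_zero] by simp
qed

text \<open>The two power sums, over \<open>u\<close> and over \<open>w\<close>, isolate one monomial of \<open>(u Y - w X)\<^sup>n\<close>. Its
  coefficient is invertible because \<open>n < p\<close>.\<close>

lemma form_trace_surj:
  fixes W :: "'p bipoly"
  assumes W: "homogeneous trace_deg W"
  obtains G where "homogeneous layer_deg G" "form_trace trace_deg G = W"
proof -
  define M :: "nat \<Rightarrow> 'p bipoly" where "M t = varX ^ (layer_deg - (CARD('p) - 1 - t))
      * varY ^ (CARD('p) - 1 - t)" for t
  have M_hom: "homogeneous layer_deg (M t)" for t
    using homogeneous_lin_powers[OF homogeneous_varX homogeneous_varY, of "layer_deg - (CARD('p) - 1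
        - t)" "CARD('p) - 1 - t"] layer_deg_ge
    by (simp add: M_def)
  have M: "form_trace trace_deg (M t) = const (of_nat (trace_deg choose t) * (- 1) ^ t) * (varX ^ t
      * varY ^ (trace_deg - t))" if t: "t \<le> trace_deg" for t
  proof -
    let ?a = "layer_deg - (CARD('p) - 1 - t)" and ?q = "CARD('p) - 1"
    have expand: "(const u * varY - const w * varX) ^ trace_deg =
        (\<Sum>k\<le>trace_deg. const (of_nat (trace_deg choose k) * (- 1) ^ k * (u ^ (trace_deg - k)
            * w ^ k)) * (varX ^ k * varY ^ (trace_deg - k)))" for u w :: "'p mod_ring"
    proof -
      have sign: "const (- w) ^ k = const ((- 1) ^ k * w ^ k)" for k
        by (simp only: const.hom_power[symmetric] power_minus[of w k])
      have "const u * varY - const w * varX = const (- w) * varX + const u * varY"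
        by (simp add: const.hom_uminus)
      then have "(const u * varY - const w * varX) ^ trace_deg =
          (\<Sum>k\<le>trace_deg. of_nat (trace_deg choose k) * (const (- w) * varX) ^ k * (const u * varY) ^
              (trace_deg - k))"
        by (simp only: binomial_ring)
      then show ?thesis
        by (simp only: power_mult_distrib sign const.hom_mult const.hom_power const.hom_of_nat mult_ac)
    qed
    have "form_trace trace_deg (M t) = (\<Sum>u\<in>UNIV. \<Sum>w\<in>UNIV. \<Sum>k\<le>trace_deg.
        const (of_nat (trace_deg choose k) * (- 1) ^ k * (u ^ (?a + (trace_deg - k)) * w ^ (?q - t
            + k))) * (varX ^ k * varY ^ (trace_deg - k)))"
      unfolding form_trace_def expand sum_distrib_left
    proof (intro sum.cong refl)
      fix u w k
      have "bival u w (M t) = u ^ ?a * w ^ (?q - t)"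
        by (simp add: M_def bival.hom_mult bival.hom_power)
      moreover have "(u ^ ?a * w ^ (?q - t)) * (of_nat (trace_deg choose k) * (- 1) ^ k
          * (u ^ (trace_deg - k) * w ^ k))
          = of_nat (trace_deg choose k) * (- 1) ^ k * (u ^ (?a + (trace_deg - k)) * w ^ (?q - t + k))"
        by (simp only: power_add mult_ac)
      ultimately show "const (bival u w (M t)) * (const (of_nat (trace_deg choose k) * (- 1) ^ k
          * (u ^ (trace_deg - k) * w ^ k)) * (varX ^ k * varY ^ (trace_deg - k)))
          = const (of_nat (trace_deg choose k) * (- 1) ^ k * (u ^ (?a + (trace_deg - k)) * w ^ (?q
              - t + k))) * (varX ^ k * varY ^ (trace_deg - k))"
        by (simp only: mult.assoc[symmetric] const.hom_mult[symmetric])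
    qed
    also have "\<dots> = (\<Sum>k\<le>trace_deg. \<Sum>u\<in>UNIV. \<Sum>w\<in>UNIV.
        const (of_nat (trace_deg choose k) * (- 1) ^ k * (u ^ (?a + (trace_deg - k)) * w ^ (?q - t
            + k))) * (varX ^ k * varY ^ (trace_deg - k)))"
      by (rule trans[OF sum.cong[OF refl sum.swap] sum.swap])
    also have "\<dots> = (\<Sum>k\<le>trace_deg. const (of_nat (trace_deg choose k) * (- 1) ^ k *
        ((\<Sum>u\<in>UNIV. u ^ (?a + (trace_deg - k))) * (\<Sum>w\<in>UNIV. w ^ (?q - t + k)))) * (varX ^ k
            * varY ^ (trace_deg - k)))"
      unfolding sum_product by (simp only: sum_distrib_left sum_distrib_right const.hom_sum)
    also have "\<dots> = (\<Sum>k\<le>trace_deg. if k = t then const (of_nat (trace_deg choose t) * (- 1) ^ t)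
        * (varX ^ t * varY ^ (trace_deg - t)) else 0)"
    proof (intro sum.cong refl)
      fix k assume "k \<in> {..trace_deg}"
      then have w: "(\<Sum>w\<in>UNIV. w ^ (?q - t + k) :: 'p mod_ring) = (if k = t then - 1 else 0)"
        using t trace_deg_bounds by (intro power_sum_shift) auto
      have u: "(\<Sum>u\<in>UNIV. u ^ (?a + (trace_deg - t)) :: 'p mod_ring) = - 1"
      proof -
        have "?a + (trace_deg - t) + ?q = layer_deg + trace_deg"
            using t trace_deg_bounds layer_deg_ge by simp
        then have "?q dvd ?a + (trace_deg - t)" using dvd_layer_deg_plus_trace_deg
            by (metis dvd_add_left_iff dvd_refl)
        moreover have "0 < ?a + (trace_deg - t)" using t trace_deg_bounds layer_deg_ge by simp
        ultimately show ?thesis by (simp only: power_sum_mod_ring simp_thms if_True)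
      qed
      show "const (of_nat (trace_deg choose k) * (- 1) ^ k *
          ((\<Sum>u\<in>UNIV. u ^ (?a + (trace_deg - k))) * (\<Sum>w\<in>UNIV. w ^ (?q - t + k)))) * (varX ^ k
              * varY ^ (trace_deg - k))
        = (if k = t then const (of_nat (trace_deg choose t) * (- 1) ^ t) * (varX ^ t
            * varY ^ (trace_deg - t)) else 0 :: 'p bipoly)"
        unfolding w using u by (cases "k = t") simp_all
    qed
    finally show ?thesis using t by simp
  qed
  define e where "e t = of_nat (trace_deg choose t) * (- 1 :: 'p mod_ring) ^ t" for t
  have e: "e t \<noteq> 0" if "t \<le> trace_deg" for t
    using binomial_nonzero_mod_ring[of trace_deg t, where 'p='p] that trace_deg_bounds
        by (simp add: e_def)
  define G where "G = (\<Sum>t\<le>trace_deg. const (coeff (dehom W) t / e t) * M t)"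
  have "form_trace trace_deg G = (\<Sum>t\<le>trace_deg. const (coeff (dehom W) t) * (varX ^ t
      * varY ^ (trace_deg - t)))"
    unfolding G_def form_trace_sum form_trace_const
  proof (intro sum.cong refl)
    fix t assume "t \<in> {..trace_deg}"
    then have "t \<le> trace_deg" by simp
    then show "const (coeff (dehom W) t / e t) * form_trace trace_deg (M t)
        = const (coeff (dehom W) t) * (varX ^ t * varY ^ (trace_deg - t))"
      using e[of t] unfolding M[OF \<open>t \<le> trace_deg\<close>] e_def[symmetric]
      by (simp add: mult.assoc[symmetric] flip: const.hom_mult)
  qed
  then have "form_trace trace_deg G = W" using rehom_dehom[OF W] by (simp add: rehom_def)
  moreover have "homogeneous layer_deg G"
    unfolding G_def by (intro homogeneous_sum homogeneous_const_mult M_hom)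
  ultimately show ?thesis using that by blast
qed

text \<open>Up to an invertible binomial coefficient the left hand side, together with the
  contribution of the line \<open>w = 0\<close>, is a coefficient of \<^const>\<open>form_trace\<close>: each of the \<open>p - 1\<close> values
  \<open>w \<noteq> 0\<close> contributes the same sum over \<open>x = u / w\<close>.\<close>

lemma power_sums_of_form_trace_kernel:
  fixes G :: "'p bipoly"
  assumes G: "homogeneous layer_deg G" and ker: "form_trace trace_deg G = 0" and m: "m \<le> trace_deg"
  shows "(\<Sum>x\<in>UNIV. poly (dehom G) x * x ^ m) = (if m = trace_deg then - coeff (dehom G) layer_deg
      else 0)"
proof -
  define t where "t = trace_deg - m"
  have t: "t \<le> trace_deg" "trace_deg - t = m" using m by (auto simp: t_def)
  have "coeff (dehom (form_trace trace_deg G)) t =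
      (\<Sum>u\<in>UNIV. \<Sum>w\<in>UNIV. bival u w G * (of_nat (trace_deg choose t) * (- w) ^ t * u ^ m))"
  proof -
    have "dehom (const u * varY - const w * varX) = [:u, - w :: 'p mod_ring:]" for u w
      by (simp add: hom_distribs)
    then show ?thesis
      by (simp add: form_trace_def dehom.hom_sum dehom.hom_mult dehom.hom_power coeff_sum
          coeff_linear_power t)
  qed
  also have "\<dots> = of_nat (trace_deg choose t) * (- 1) ^ t * (\<Sum>u\<in>UNIV. \<Sum>w\<in>UNIV. bival u w G
      * (w ^ t * u ^ m))"
    unfolding sum_distrib_left
  proof (intro sum.cong refl)
    fix u w
    show "bival u w G * (of_nat (trace_deg choose t) * (- w) ^ t * u ^ m)
      = of_nat (trace_deg choose t) * (- 1) ^ t * (bival u w G * (w ^ t * u ^ m))"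
      by (simp only: power_minus[of w t] mult_ac)
  qed
  finally have "(\<Sum>u\<in>UNIV. \<Sum>w\<in>UNIV. bival u w G * (w ^ t * u ^ m)) = 0"
    using ker binomial_nonzero_mod_ring[of trace_deg t, where 'p='p] t trace_deg_bounds by simp
  then have "0 = (\<Sum>w\<in>UNIV. \<Sum>u\<in>UNIV. bival u w G * (w ^ t * u ^ m))"
    by (subst sum.swap) simp
  also have "\<dots> = (\<Sum>w\<in>(UNIV :: 'p mod_ring set). if w = 0 then (if m
      = trace_deg then - coeff (dehom G) layer_deg else 0)
      else (\<Sum>x\<in>UNIV. poly (dehom G) x * x ^ m))"
  proof (rule sum.cong[OF refl])
    fix w :: "'p mod_ring"
    show "(\<Sum>u\<in>UNIV. bival u w G * (w ^ t * u ^ m)) =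
      (if w = 0 then (if m = trace_deg then - coeff (dehom G) layer_deg else 0) else (\<Sum>x\<in>UNIV. poly
          (dehom G) x * x ^ m))"
    proof (cases "w = 0")
      case True
      have "(\<Sum>u\<in>UNIV. bival u 0 G * (0 ^ t * u ^ m))
          = (if m = trace_deg then - coeff (dehom G) layer_deg else 0)"
      proof (cases "m = trace_deg")
        case m: True
        have "bival u 0 G * u ^ trace_deg = coeff (dehom G) layer_deg * u ^ (layer_deg + trace_deg)"
            for u
          using bival_scale[OF G, of u 1 0] bival_infinity[OF G] by (simp add: power_add mult_ac)
        then have "(\<Sum>u\<in>UNIV. bival u 0 G * u ^ trace_deg)
            = coeff (dehom G) layer_deg * (\<Sum>u\<in>UNIV. u ^ (layer_deg + trace_deg))"
          by (simp only: sum_distrib_left)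
        also have "(\<Sum>u\<in>UNIV. u ^ (layer_deg + trace_deg) :: 'p mod_ring) = - 1"
          using dvd_layer_deg_plus_trace_deg trace_deg_bounds by (simp add: power_sum_mod_ring)
        finally show ?thesis using m by (simp add: t_def)
      next
        case False
        then have "t \<noteq> 0" using m by (simp add: t_def)
        then show ?thesis using False by (simp add: power_0_left)
      qed
      then show ?thesis using True by simp
    next
      case False
      have "(\<Sum>u\<in>UNIV. bival u w G * (w ^ t * u ^ m))
          = (\<Sum>x\<in>UNIV. bival (w * x) (w * 1) G * (w ^ t * (w * x) ^ m))"
        using False by (intro sum.reindex_bij_witness[of _ "\<lambda>x. w * x" "\<lambda>u. u / w"]) auto
      also have "\<dots> = (\<Sum>x\<in>UNIV. (w ^ layer_deg * w ^ t * w ^ m) * (bival x 1 G * x ^ m))"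
        unfolding bival_scale[OF G] power_mult_distrib by (simp only: mult_ac)
      also have "w ^ layer_deg * w ^ t * w ^ m = w ^ (layer_deg + trace_deg)"
        using m by (simp add: t_def flip: power_add)
      also have "w ^ (layer_deg + trace_deg) = 1" using False
          by (simp add: power_layer_deg_plus_trace_deg)
      finally show ?thesis using False by (simp add: bival_one)
    qed
  qed
  also have "\<dots> = (if m = trace_deg then - coeff (dehom G) layer_deg else 0) + (\<Sum>w\<in>UNIV
      - {0 :: 'p mod_ring}. (\<Sum>x\<in>UNIV. poly (dehom G) x * x ^ m))"
    by (subst sum.remove[of UNIV 0]) simp_all
  also have "(\<Sum>w\<in>UNIV - {0 :: 'p mod_ring}. (\<Sum>x\<in>UNIV. poly (dehom G) x * x ^ m))
      = - (\<Sum>x\<in>UNIV. poly (dehom G) x * x ^ m)"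
    by (simp add: card_Diff_singleton of_nat_diff)
  finally show ?thesis by simp
qed

text \<open>As \<open>r - i (p + 1) \<equiv> c - i\<close> modulo \<open>p - 1\<close>, the powers \<open>(x y + 1)\<^bsup>r-i(p+1)\<^esup>\<close> agree with
  polynomials of degree at most \<open>c - i\<close> in \<open>y\<close>, and by prescribing the moments of \<open>a\<close> one obtains
  all polynomial functions of such a degree. By interpolation, a function on \<open>F\<^sub>p\<close> is of this kind
  if its power sums of order below \<open>p - 1 - (c - i)\<close> vanish, as they do on the kernel. The power
  sum of that order itself matches the values at \<open>(1 : 0)\<close>.\<close>

lemma form_trace_kernel:
  fixes G :: "'p bipoly"
  assumes G: "homogeneous layer_deg G" and ker: "form_trace trace_deg G = 0"
  obtains a where "theta dvd G - (\<Sum>x\<in>UNIV. const (a x) * (const x * varX + varY) ^ layer_deg)"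
proof -
  let ?b = "c - i" and ?q = "CARD('p) - 1"
  define S where "S m = (\<Sum>x\<in>UNIV. poly (dehom G) x * x ^ m)" for m
  have S: "S m = (if m = trace_deg then - coeff (dehom G) layer_deg else 0)" if "m \<le> trace_deg" for m
    using power_sums_of_form_trace_kernel[OF G ker that] by (simp only: S_def)
  have b: "?b < ?q" "0 < ?b" using i_less c_less i_pos by auto
  define a where "a x = (\<Sum>m\<le>?b. S (?q - m) / of_nat (?b choose m) * x ^ (?q - m))" for x
  have moments: "(\<Sum>x\<in>UNIV. a x * x ^ k) = - S (?q - k) / of_nat (?b choose k)" if "k \<le> ?b" for k
  proof -
    have "(\<Sum>x\<in>UNIV. a x * x ^ k) = (\<Sum>m\<le>?b. S (?q - m) / of_nat (?b choose m) * (\<Sum>x\<in>UNIV. x ^ (?q - m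
        + k)))"
      unfolding a_def sum_distrib_left sum_distrib_right
          by (subst sum.swap) (simp only: power_add mult.assoc)
    also have "\<dots> = (\<Sum>m\<le>?b. if m = k then - S (?q - k) / of_nat (?b choose k) else 0)"
    proof (intro sum.cong refl)
      fix m assume "m \<in> {..?b}"
      then have "(\<Sum>x\<in>UNIV. x ^ (?q - m + k) :: 'p mod_ring) = (if k = m then - 1 else 0)"
        using b that by (intro power_sum_shift) auto
      then show "S (?q - m) / of_nat (?b choose m) * (\<Sum>x\<in>UNIV. x ^ (?q - m + k)) =
          (if m = k then - S (?q - k) / of_nat (?b choose k) else 0)"
        by (cases "m = k") simp_all
    qed
    also have "\<dots> = - S (?q - k) / of_nat (?b choose k)" using that by simp
    finally show ?thesis .
  qed
  have reduce: "x ^ layer_deg = x ^ ?b" for x :: "'p mod_ring"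
    using layer_deg_cong layer_deg_ge b by (intro power_cong_card_minus_one) auto
  define H where "H = (\<Sum>x\<in>UNIV. const (a x) * (const x * varX + varY) ^ layer_deg)"
  have hom: "homogeneous layer_deg H"
    using homogeneous_power[OF homogeneous_pencil, of layer_deg]
    unfolding H_def by (intro homogeneous_sum homogeneous_const_mult) simp
  have "theta dvd G - H"
  proof (rule theta_dvd_of_values[OF homogeneous_diff[OF G hom]])
    fix y :: "'p mod_ring"
    have "poly (dehom H) y = (\<Sum>x\<in>UNIV. a x * (x * y + 1) ^ layer_deg)"
      by (simp add: H_def bival_one[symmetric] hom_distribs mult.commute[of y])
    also have "\<dots> = (\<Sum>x\<in>UNIV. \<Sum>k\<le>?b. (of_nat (?b choose k) * y ^ k) * (a x * x ^ k))"
      unfolding reduce binomial_ring sum_distrib_left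
      by (intro sum.cong refl) (simp add: power_mult_distrib mult_ac)
    also have "\<dots> = (\<Sum>k\<le>?b. (of_nat (?b choose k) * y ^ k) * (\<Sum>x\<in>UNIV. a x * x ^ k))"
      unfolding sum_distrib_left by (rule sum.swap)
    also have "\<dots> = (\<Sum>k\<le>?b. - (y ^ k * S (?q - k)))"
    proof (intro sum.cong refl)
      fix k assume "k \<in> {..?b}"
      then have "k \<le> ?b" by simp
      moreover have "of_nat (?b choose k) \<noteq> (0 :: 'p mod_ring)"
        using b \<open>k \<le> ?b\<close> by (intro binomial_nonzero_mod_ring) simp_all
      ultimately show "of_nat (?b choose k) * y ^ k * (\<Sum>x\<in>UNIV. a x * x ^ k) = - (y ^ k * S (?q - k))"
        by (simp only: moments) simp
    qed
    also have "\<dots> = - (\<Sum>k<CARD('p). y ^ k * S (?q - k))"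
      unfolding sum_negf
    proof (intro arg_cong[of _ _ uminus] sum.mono_neutral_left ballI)
      fix k assume "k \<in> {..<CARD('p)} - {..?b}"
      then have "?q - k < trace_deg" using b trace_deg_bounds by auto
      then show "y ^ k * S (?q - k) = 0" using S[of "?q - k"] by simp
    qed (use b in auto)
    also have "\<dots> = poly (dehom G) y"
    proof -
      have "S 0 = 0" using S[of 0] trace_deg_bounds by simp
      then show ?thesis
        using interpolation_mod_ring[of "poly (dehom G)" y] by (simp add: S_def)
    qed
    finally show "poly (dehom (G - H)) y = 0" by (simp add: dehom.hom_minus)
  next
    have "coeff (dehom H) layer_deg = (\<Sum>x\<in>UNIV. a x * x ^ layer_deg)"
      unfolding bival_infinity[OF hom, symmetric] by (simp add: H_def hom_distribs)
    also have "\<dots> = - S (?q - ?b)"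
      unfolding reduce by (subst moments) simp_all
    also have "\<dots> = coeff (dehom G) layer_deg"
      using S[of trace_deg] by (simp add: trace_deg_def)
    finally show "coeff (dehom (G - H)) layer_deg = 0" by (simp add: dehom.hom_minus)
  qed
  then show ?thesis using that[of a] by (simp only: H_def)
qed

end

section \<open>The exact sequence\<close>

lemma bracket_eqI:
  assumes "2 \<le> p" "m \<in> {1..p - 1}" "[int m = k] (mod (int p - 1))"
  shows "bracket p k = m"
  unfolding bracket_def
proof (rule the_equality)
  show "m \<in> {1..p - 1} \<and> [int m = k] (mod (int p - 1))" using assms by simp
  fix m' assume m': "m' \<in> {1..p - 1} \<and> [int m' = k] (mod (int p - 1))"
  then have "[int m' = int m] (mod int (p - 1))"
    using assms by (metis cong_sym cong_trans of_nat_diff of_nat_1 one_le_numeral order.trans)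
  then have "[m' = m] (mod (p - 1))" by (simp only: cong_int_iff)
  moreover have "x = y" if "[x = y] (mod q)" "x \<in> {1..q}" "y \<in> {1..q}" for x y q :: nat
  proof -
    have "[x - 1 = y - 1] (mod q)" using that by (intro cong_diff_nat) auto
    then show ?thesis using that by (auto simp: cong_def)
  qed
  ultimately show "m' = m" using m' assms by blast
qed

lemma bracket_cong:
  assumes "2 \<le> p"
  shows "[int (bracket p k) = k] (mod (int p - 1))"
proof -
  define m where "m = (if k mod (int p - 1) = 0 then p - 1 else nat (k mod (int p - 1)))"
  have pos: "0 < int p - 1" using assms by simp
  have bounds: "0 \<le> k mod (int p - 1)" "k mod (int p - 1) < int p - 1"
    using pos by simp_all
  have m: "m \<in> {1..p - 1}" "[int m = k] (mod (int p - 1))"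
    using assms bounds by (auto simp: m_def cong_def of_nat_diff)
  then show ?thesis using bracket_eqI[OF assms m] by simp
qed

context form_parameters
begin

text \<open>Because of \<open>X_sub_subset_sum\<close> and \<open>X_sub_mono\<close>, the kernel of \<open>Q(i) \<rightarrow> Q(i - 1)\<close> is covered
  by \<open>V\<^sub>r\<^bsup>(i)\<^esup>\<close>. It remains to find the elements of this layer that become zero in \<open>Q(i)\<close>.\<close>

lemma exact_of_layer_surjection:
  fixes L :: "('p mod_ring^2^2, 'p mod_ring, 'l) gmodule" and \<tau> :: "'p bipoly \<Rightarrow> 'l"
  assumes L: "G_module GL2 Fp L"
    and add: "\<And>F G. \<lbrakk>F \<in> V_filt r i; G \<in> V_filt r i\<rbrakk> \<Longrightarrow> \<tau> (F + G) = \<tau> F \<oplus>\<^bsub>L\<^esub> \<tau> G"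
    and smult: "\<And>a F. F \<in> V_filt r i \<Longrightarrow> \<tau> (const a * F) = a \<odot>\<^bsub>L\<^esub> \<tau> F"
    and gact: "\<And>A F. \<lbrakk>invertible A; F \<in> V_filt r i\<rbrakk> \<Longrightarrow> \<tau> (act A F) = gact L A (\<tau> F)"
    and surj: "\<tau> ` V_filt r i = carrier L"
    and ker: "\<And>F. F \<in> V_filt r i \<Longrightarrow> \<tau> F = \<zero>\<^bsub>L\<^esub> \<longleftrightarrow> F \<in> X_sub r i <+>\<^bsub>V r\<^esub> V_filt r (i + 1)"
  shows "\<exists>f h. short_exact GL2 Fp L f (Q r i) h (Q r (i - 1))"
proof -
  define U :: "'p bipoly set" where "U = X_sub r i <+>\<^bsub>V r\<^esub> V_filt r (i + 1)"
  define U' :: "'p bipoly set" where "U' = X_sub r (i - 1) <+>\<^bsub>V r\<^esub> V_filt r i"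
  have X: "G_submodule GL2 Fp (V r) (X_sub r i :: 'p bipoly set)"
    "G_submodule GL2 Fp (V r) (X_sub r (i - 1) :: 'p bipoly set)"
    using i_le_r by (auto intro: G_submodule_X_sub)
  have F: "G_submodule GL2 Fp (V r) (V_filt r i :: 'p bipoly set)"
    "G_submodule GL2 Fp (V r) (V_filt r (i + 1) :: 'p bipoly set)"
    by (rule G_submodule_V_filt)+
  have subU: "G_submodule GL2 Fp (V r) U" and subU': "G_submodule GL2 Fp (V r) U'"
    unfolding U_def U'_def by (intro G_submodule_set_add X F)+
  note filt = G_submodule_V_simps[OF F(1)]
  have PU': "V_filt r i \<subseteq> U'"
    using G_submodule_V_simps(2)[OF X(2)] unfolding U'_def set_add_V by force
  have "V_filt r (i + 1) \<subseteq> (V_filt r i :: 'p bipoly set)"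
    by (auto simp: V_filt_def dest: power_le_dvd[of _ _ _ i])
  then have UU': "U \<subseteq> U'"
    using X_sub_subset_sum[folded U'_def] PU' G_submodule_V_simps(3)[OF subU']
    unfolding U_def set_add_V by blast
  have "X_sub r (i - 1) \<subseteq> (X_sub r i :: 'p bipoly set)"
    using i_le_r i_less c_less by (intro X_sub_mono) auto
  then have mono: "X_sub r (i - 1) \<subseteq> U"
    using G_submodule_V_simps(2)[OF F(2)] unfolding U_def set_add_V by force
  have "\<exists>f h. short_exact GL2 Fp L f (G_quotient (V r) U) h (G_quotient (V r) U')"
  proof (rule short_exact_of_surjection[where P = "V_filt r i" and \<tau> = \<tau>,
        OF G_module_V L subU subU' _ _ _ _ surj _ UU' PU'])
    show "V_filt r i \<subseteq> carrier (V r :: ('p mod_ring^2^2, 'p mod_ring, 'p bipoly) gmodule)"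
      using filt(1) by (simp add: V_simps)
    show "\<exists>x\<in>V_filt r i. \<exists>u\<in>U. y = u \<oplus>\<^bsub>V r\<^esub> x" if "y \<in> U'" for y
      using that mono unfolding U'_def set_add_V by (auto simp: V_simps)
    show "\<tau> x = \<zero>\<^bsub>L\<^esub> \<longleftrightarrow> x \<in> U" if "x \<in> V_filt r i" for x
      unfolding U_def by (rule ker[OF that])
  qed (auto simp: V_simps carrier_GL2 filt add smult gact)
  then show ?thesis using i_pos by (simp add: Q_def U_def U'_def)
qed

text \<open>By \<open>X_sub_inter_V_filt\<close>, here an element of \<open>V\<^sub>r\<^bsup>(i)\<^esup>\<close> becomes zero in \<open>Q(i)\<close> only if it
  lies in \<open>V\<^sub>r\<^bsup>(i+1)\<^esup>\<close>.\<close>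

lemma exact_layer:
  assumes binom: "of_nat ((r - c - 1) choose i) = (0 :: 'p mod_ring)"
  shows "\<exists>f h. short_exact GL2 (Fp :: 'p mod_ring ring) (V_subquot r i (i + 1)) f (Q r i) h (Q r (i
      - 1))"
proof -
  let ?M = "(V r)\<lparr>carrier := V_filt r i\<rparr> :: ('p mod_ring^2^2, 'p mod_ring, 'p bipoly) gmodule"
  let ?K = "V_filt r (i + 1) :: 'p bipoly set"
  have F: "G_submodule GL2 Fp (V r) (V_filt r i :: 'p bipoly set)"
    "G_submodule GL2 Fp (V r) (V_filt r (i + 1) :: 'p bipoly set)"
    by (rule G_submodule_V_filt)+
  have sub: "?K \<subseteq> V_filt r i"
    by (auto simp: V_filt_def dest: power_le_dvd[of _ _ _ i])
  have M: "G_module GL2 Fp ?M" by (rule G_module_submodule[OF G_module_V F(1)])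
  have K: "G_submodule GL2 Fp ?M ?K" by (rule G_submodule_restrict[OF G_module_V F(2,1) sub])
  interpret abelian_subgroup ?K ?M by (rule G_submodule_imp_abelian_subgroup[OF M K])
  have hom: "(\<lambda>F. ?K +>\<^bsub>?M\<^esub> F) \<in> G_hom GL2 Fp ?M (G_quotient ?M ?K)"
    by (rule quotient_map_G_hom[OF M K])
  show ?thesis
  proof (rule exact_of_layer_surjection[where \<tau> = "\<lambda>F. ?K +>\<^bsub>?M\<^esub> F"])
    show "G_module GL2 Fp (V_subquot r i (i + 1) :: ('p mod_ring^2^2, 'p mod_ring, 'p bipoly set)
        gmodule)"
      unfolding V_subquot_def by (rule G_module_quotient[OF M K])
    show "(\<lambda>F. ?K +>\<^bsub>?M\<^esub> F) ` V_filt r i = carrier (V_subquot r i (i + 1))"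
      unfolding V_subquot_def carrier_G_quotient[OF M K] by simp
    fix G :: "'p bipoly" assume G: "G \<in> V_filt r i"
    have "?K +>\<^bsub>?M\<^esub> G = ?K \<longleftrightarrow> G \<in> ?K"
      using a_rcos_self[of G] a_rcos_const[of G] G by auto
    also have "\<dots> \<longleftrightarrow> G \<in> X_sub r i <+>\<^bsub>V r\<^esub> ?K"
    proof
      assume "G \<in> ?K"
      then show "G \<in> X_sub r i <+>\<^bsub>V r\<^esub> ?K"
        using G_submodule_V_simps(2)[OF G_submodule_X_sub[OF i_le_r]] unfolding set_add_V by force
    next
      assume "G \<in> X_sub r i <+>\<^bsub>V r\<^esub> ?K"
      then obtain x y where xy: "G = x + y" "x \<in> X_sub r i" "y \<in> ?K"
        unfolding set_add_V by blast
      then have "x = G - y" by simp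
      then have "x \<in> V_filt r i"
        using G sub xy(3) G_submodule_V_simps(7)[OF F(1)] by blast
      then have "theta ^ (i + 1) dvd x"
        using X_sub_inter_V_filt[OF binom xy(2)] by (simp add: V_filt_def)
      then have "x \<in> ?K"
        using homogeneous_in_X_sub[OF xy(2) i_le_r] by (simp add: V_filt_def V_simps)
      then show "G \<in> ?K" using xy G_submodule_V_simps(3)[OF F(2)] by blast
    qed
    finally show "?K +>\<^bsub>?M\<^esub> G = \<zero>\<^bsub>V_subquot r i (i + 1)\<^esub> \<longleftrightarrow> G \<in> X_sub r i <+>\<^bsub>V r\<^esub> ?K"
      unfolding V_subquot_def zero_G_quotient[OF M K] .
  qed (use hom in \<open>auto simp: G_hom_def hom_def V_subquot_def V_simps carrier_GL2 carrier_Fp\<close>)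
qed

text \<open>From right to left, \<open>form_trace_X_sub\<close> applies, as \<^const>\<open>form_trace\<close> ignores multiples of \<open>\<theta>\<close>.
  From left to right, \<open>form_trace_kernel\<close> leaves the powers \<open>(x X + Y)\<^bsup>r-i(p+1)\<^esup>\<close>. They are
  translates of a power of \<open>Y\<close>, whose product with \<open>\<theta>\<^sup>i\<close> is provided by \<open>critical_congruence\<close>.\<close>

lemma layer_kernel:
  fixes G :: "'p bipoly"
  assumes binom: "of_nat ((r - c - 1) choose i) \<noteq> (0 :: 'p mod_ring)" and G: "homogeneous layer_deg G"
  shows "form_trace trace_deg G = 0 \<longleftrightarrow> theta ^ i * G \<in> X_sub r i <+>\<^bsub>V r\<^esub> V_filt r (i + 1)"
    (is "_ \<longleftrightarrow> _ \<in> ?U")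
proof -
  have subX: "G_submodule GL2 Fp (V r) (X_sub r i :: 'p bipoly set)"
    by (rule G_submodule_X_sub[OF i_le_r])
  have subV: "G_submodule GL2 Fp (V r) (V_filt r (i + 1) :: 'p bipoly set)"
    by (rule G_submodule_V_filt)
  have subU: "G_submodule GL2 Fp (V r) ?U"
    by (rule G_submodule_set_add[OF subX subV])
  note U = G_submodule_V_simps[OF subU]
  have degree: "i * (CARD('p) + 1) + layer_deg = r"
    using r_ge by (simp add: layer_deg_def)
  have hom: "homogeneous r (theta ^ i * F)" if "homogeneous layer_deg F" for F :: "'p bipoly"
    using homogeneous_mult[OF homogeneous_power[OF homogeneous_theta] that, of i] unfolding degree .
  show ?thesis
  proof
    assume "theta ^ i * G \<in> ?U"
    then obtain x y where xy: "theta ^ i * G = x + y" "x \<in> X_sub r i" "y \<in> V_filt r (i + 1)"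
      unfolding set_add_V by blast
    have "theta ^ (i + 1) dvd y" using xy(3) unfolding V_filt_def by blast
    then obtain E where E: "y = theta ^ (i + 1) * E" by (rule dvdE)
    have x: "x = theta ^ i * (G - theta * E)"
      using xy(1) by (simp add: E algebra_simps)
    have "homogeneous r x" by (rule homogeneous_in_X_sub[OF xy(2) i_le_r])
    moreover have "theta ^ i dvd x" unfolding x by (rule dvd_triv_left)
    ultimately obtain F where F: "homogeneous layer_deg F" "x = theta ^ i * F"
      unfolding layer_deg_def by (rule theta_power_dvd_homogeneousE)
    then have "F = G - theta * E" using x by (simp add: theta_nonzero)
    then have "form_trace trace_deg (G - theta * E) = 0"
      using form_trace_X_sub[OF F(1)] F(2) xy(2) by simp
    then have "form_trace trace_deg (G - theta * E) + form_trace trace_deg (theta * E) = 0"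
      by (simp add: form_trace_theta)
    then show "form_trace trace_deg G = 0" by (simp flip: form_trace_add)
  next
    assume ker: "form_trace trace_deg G = 0"
    define k :: "'p mod_ring" where "k = (- 1) ^ i * of_nat ((r - c - 1) choose i)"
    have k: "k \<noteq> 0" using binom by (simp add: k_def)
    have filtU: "F \<in> ?U" if "F \<in> V_filt r (i + 1)" for F
      using that G_submodule_V_simps(2)[OF subX] unfolding set_add_V by force
    have critU: "critical \<in> ?U"
      using critical_in_X_sub G_submodule_V_simps(2)[OF subV] unfolding set_add_V by force
    have "critical - (critical - const k * (theta ^ i * varY ^ layer_deg)) \<in> ?U"
      using critical_congruence unfolding layer_deg_def[symmetric] k_def[symmetric]
      by (intro U(7) critU filtU)
    then have "const k * (theta ^ i * varY ^ layer_deg) \<in> ?U"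
      by (simp only: diff_diff_eq2 add_diff_cancel_left')
    from U(4)[OF this, of "1 / k"] have Y: "theta ^ i * varY ^ layer_deg \<in> ?U"
      using k by (simp add: mult.assoc[symmetric] flip: const.hom_mult)
    have pencil: "theta ^ i * (const x * varX + varY) ^ layer_deg \<in> ?U" for x
      using U(5)[OF _ Y, of "mat2 1 x 0 1"] by (simp add: hom_distribs act_theta)
    obtain a where dvd: "theta dvd G - (\<Sum>x\<in>UNIV. const (a x) * (const x * varX + varY) ^ layer_deg)"
      using form_trace_kernel[OF G ker] by blast
    let ?H = "\<Sum>x\<in>UNIV. const (a x) * (const x * varX + varY) ^ layer_deg :: 'p bipoly"
    have "homogeneous layer_deg ?H"
      using homogeneous_power[OF homogeneous_pencil, of layer_deg]
      by (intro homogeneous_sum homogeneous_const_mult) simp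
    then have "homogeneous r (theta ^ i * (G - ?H))"
      using G by (intro hom homogeneous_diff)
    moreover have "theta ^ (i + 1) dvd theta ^ i * (G - ?H)"
      using dvd by (simp add: mult_dvd_mono)
    ultimately have "theta ^ i * (G - ?H) \<in> ?U"
      by (intro filtU) (simp add: V_filt_def V_simps)
    moreover have "theta ^ i * ?H \<in> ?U"
      unfolding sum_distrib_left mult.left_commute[of "theta ^ i" "const _"] by (intro U(4,8) pencil)
    ultimately have "theta ^ i * (G - ?H) + theta ^ i * ?H \<in> ?U" by (rule U(3))
    then show "theta ^ i * G \<in> ?U" by (simp flip: distrib_left)
  qed
qed

text \<open>\<^const>\<open>form_trace\<close> identifies the image of the layer in \<open>Q(i)\<close> with the forms of degree
  \<open>n = p - 1 - (c - i)\<close>. The character is \<open>D\<^sup>c\<close> since division by \<open>\<theta>\<^sup>i\<close> contributes \<open>D\<^sup>i\<close>,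
  \<^const>\<open>form_trace\<close> contributes \<open>D\<^bsup>-n\<^esup>\<close>, and \<open>i - n \<equiv> c\<close> modulo \<open>p - 1\<close>.\<close>

lemma exact_top:
  assumes binom: "of_nat ((r - c - 1) choose i) \<noteq> (0 :: 'p mod_ring)"
    and psi: "\<And>A :: 'p mod_ring^2^2. invertible A \<Longrightarrow> \<psi> A = det A ^ c"
  shows "\<exists>f h. short_exact GL2 (Fp :: 'p mod_ring ring) (twist (V trace_deg) \<psi>) f (Q r i) h (Q r (i
      - 1))"
proof -
  let ?\<tau> = "\<lambda>F :: 'p bipoly. form_trace trace_deg (F div theta ^ i)"
  have layer: "\<exists>G. homogeneous layer_deg G \<and> F = theta ^ i * G" if "F \<in> V_filt r i" for F :: "'p bipoly"
    using that theta_power_dvd_homogeneousE[of r F i] unfolding layer_deg_def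
    by (auto simp: V_filt_def V_simps)
  have div: "theta ^ i * G div theta ^ i = G" for G :: "'p bipoly"
    by (simp add: theta_nonzero)
  have degree: "i * (CARD('p) + 1) + layer_deg = r"
    using r_ge by (simp add: layer_deg_def)
  have hom: "theta ^ i * G \<in> V_filt r i" if "homogeneous layer_deg G" for G :: "'p bipoly"
    using homogeneous_mult[OF homogeneous_power[OF homogeneous_theta] that, of i] unfolding degree
    by (simp add: V_filt_def V_simps)
  have twist: "carrier (twist (V trace_deg) \<psi>) = {F. homogeneous trace_deg F}"
    "\<zero>\<^bsub>twist (V trace_deg) \<psi>\<^esub> = 0" "(\<oplus>\<^bsub>twist (V trace_deg) \<psi>\<^esub>) = (+)"
    "\<And>a F. a \<odot>\<^bsub>twist (V trace_deg) \<psi>\<^esub> F = const a * F"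
    "\<And>A F. gact (twist (V trace_deg) \<psi>) A F = const (\<psi> A) * act A F"
    by (simp_all add: twist_def V_simps)
  show ?thesis
  proof (rule exact_of_layer_surjection[where \<tau> = ?\<tau>])
    have psi_one: "\<psi> (mat 1) = 1"
      using psi[of "mat 1"] by (simp add: invertible_det_nz)
    show "G_module GL2 Fp (twist (V trace_deg) \<psi>)"
      by (rule G_module_twist[OF G_module_V])
        (simp_all add: carrier_GL2 mult_GL2 one_GL2 psi psi_one invertible_mult det_mul
          power_mult_distrib Fp_def)
    show "?\<tau> (F + G) = ?\<tau> F \<oplus>\<^bsub>twist (V trace_deg) \<psi>\<^esub> ?\<tau> G"
      if F: "F \<in> V_filt r i" and G: "G \<in> V_filt r i" for F G :: "'p bipoly"
    proof -
      obtain F' G' where FG: "F = theta ^ i * F'" "G = theta ^ i * G'" using layer F G by blast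
      have "(F + G) div theta ^ i = F' + G'"
        by (simp only: FG distrib_left[symmetric] div)
      then show ?thesis by (simp only: FG div twist form_trace_add)
    qed
    show "?\<tau> (const a * F) = a \<odot>\<^bsub>twist (V trace_deg) \<psi>\<^esub> ?\<tau> F" if F: "F \<in> V_filt r i"
        for a and F :: "'p bipoly"
    proof -
      obtain G where G: "F = theta ^ i * G" using layer F by blast
      have "(const a * F) div theta ^ i = const a * G"
        unfolding G mult.left_commute[of "const a"] by (rule div)
      then show ?thesis by (simp only: G div twist form_trace_const)
    qed
    show "?\<tau> (act A F) = gact (twist (V trace_deg) \<psi>) A (?\<tau> F)"
      if A: "invertible A" and F: "F \<in> V_filt r i" for A and F :: "'p bipoly"
    proof -
      obtain G where G: "F = theta ^ i * G" using layer F by blast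
      have det: "det A \<noteq> 0" using A by (simp add: invertible_det_nz)
      have "act A F = theta ^ i * (const (det A ^ i) * act A G)"
        by (simp only: G act.hom_mult act.hom_power act_theta power_mult_distrib const.hom_power
            mult.assoc mult.left_commute[of "const _ ^ i"])
      then have "?\<tau> (act A F) = const (det A ^ i) * form_trace trace_deg (act A G)"
        by (simp only: div form_trace_const)
      also have "det A ^ i = det A ^ c * det A ^ trace_deg"
      proof -
        have "c + trace_deg = i + (CARD('p) - 1)" using trace_deg_bounds i_less by simp
        then have "det A ^ c * det A ^ trace_deg = det A ^ i * det A ^ (CARD('p) - 1)"
          by (simp only: power_add[symmetric])
        then show ?thesis by (simp only: power_card_minus_one[OF det] mult_1_right)
      qed
      also have "const (det A ^ c * det A ^ trace_deg) * form_trace trace_deg (act A G)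
          = const (\<psi> A) * act A (form_trace trace_deg G)"
        by (simp only: const.hom_mult mult.assoc form_trace_act[OF A] psi[OF A])
      finally show ?thesis by (simp only: twist G div)
    qed
    show "?\<tau> ` V_filt r i = carrier (twist (V trace_deg) \<psi>)"
    proof
      show "?\<tau> ` V_filt r i \<subseteq> carrier (twist (V trace_deg) \<psi>)"
        by (auto simp: twist homogeneous_form_trace)
      show "carrier (twist (V trace_deg) \<psi>) \<subseteq> ?\<tau> ` V_filt r i"
      proof
        fix W assume "W \<in> carrier (twist (V trace_deg) \<psi>)"
        then have "homogeneous trace_deg W" by (simp add: twist)
        then obtain G where G: "homogeneous layer_deg G" "form_trace trace_deg G = W"
          by (rule form_trace_surj)
        then show "W \<in> ?\<tau> ` V_filt r i"
          using hom[OF G(1)] by (intro image_eqI[of _ _ "theta ^ i * G"]) (simp_all add: div)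
      qed
    qed
    show "?\<tau> F = \<zero>\<^bsub>twist (V trace_deg) \<psi>\<^esub> \<longleftrightarrow> F \<in> X_sub r i <+>\<^bsub>V r\<^esub> V_filt r (i + 1)"
      if F: "F \<in> V_filt r i" for F :: "'p bipoly"
    proof -
      obtain G where "homogeneous layer_deg G" "F = theta ^ i * G" using layer F by blast
      then show ?thesis using layer_kernel[OF binom] by (simp add: twist div)
    qed
  qed
qed

end

lemma det_char_eq_power:
  fixes A :: "'p::prime_card mod_ring^2^2"
  assumes "invertible A" "[int k = m] (mod (int CARD('p) - 1))"
  shows "det_char m A = det A ^ k"
proof -
  have det: "det A \<noteq> 0" using assms by (simp add: invertible_det_nz)
  have p: "CARD('p) > 1" using prime_card[where 'a='p] prime_gt_1_nat by blast
  obtain q where "m = int k + (int CARD('p) - 1) * q"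
    using assms(2) by (metis cong_iff_lin)
  also have "int CARD('p) - 1 = int (CARD('p) - 1)" using p by (simp add: of_nat_diff)
  finally have m: "m = int k + int (CARD('p) - 1) * q" .
  have "det A powi m = det A powi int k * (det A powi int (CARD('p) - 1)) powi q"
    unfolding m using det by (subst power_int_add) (simp_all only: power_int_mult simp_thms)
  also have "det A powi int (CARD('p) - 1) = 1"
    by (simp only: power_int_of_nat power_card_minus_one[OF det])
  finally show ?thesis by (simp add: det_char_def)
qed

theorem theorem1p7:
  fixes p r a r0 i :: nat
  assumes "p = CARD('p::prime_card)" and "p \<ge> 3"
    and "[r = a] (mod (p - 1))" and "1 \<le> a" and "a \<le> p - 1"
    and "[r = r0] (mod p)" and "r0 \<le> p - 1"
    and "1 \<le> i" and "i < bracket p (int a - int i)" and "bracket p (int a - int i) < p - 1"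
    and "r \<ge> i * (p + 1) + p"
  shows
    "(\<not> [(r - bracket p (int a - int i) - 1) choose i = 0] (mod p) \<longrightarrow>
       (\<exists>f g. short_exact GL2 (Fp :: 'p mod_ring ring)
          (twist (V (p - 1 - bracket p (int a - 2 * int i))) (det_char (int a - int i)))
          f (Q r i) g (Q r (i - 1)))) \<and>
     ([(r - bracket p (int a - int i) - 1) choose i = 0] (mod p) \<longrightarrow>
       (\<exists>f g. short_exact GL2 (Fp :: 'p mod_ring ring)
          (V_subquot r i (i + 1))
          f (Q r i) g (Q r (i - 1))))"
proof -
  define c where "c = bracket p (int a - int i)"
  have p: "2 \<le> p" "int (p - 1) = int p - 1" using assms(2) by (auto simp: of_nat_diff)
  have c_cong: "[int c = int a - int i] (mod (int p - 1))"
    unfolding c_def using p by (intro bracket_cong)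
  then have "[int c + int i = int a - int i + int i] (mod (int p - 1))"
    by (intro cong_add) simp_all
  then have "[int (c + i) = int a] (mod int (p - 1))"
    by (simp only: p(2) of_nat_add diff_add_cancel)
  then have "[c + i = a] (mod (p - 1))" by (simp only: cong_int_iff)
  then have r_cong: "[r = c + i] (mod (p - 1))" using cong_trans[OF assms(3)] cong_sym by blast
  interpret form_parameters "TYPE('p)" c i r
    by (rule form_parameters.intro)
      (fact assms(8-11)[folded c_def, unfolded assms(1)] r_cong[unfolded assms(1)])+
  have "[int c - int i = int a - int i - int i] (mod (int p - 1))"
    by (intro cong_diff c_cong) simp
  then have "[int (c - i) = int a - 2 * int i] (mod (int p - 1))"
    using i_less by (simp add: of_nat_diff algebra_simps)
  then have "bracket p (int a - 2 * int i) = c - i"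
    using p i_less c_less assms(1) by (intro bracket_eqI) auto
  then have top: "p - 1 - bracket p (int a - 2 * int i) = trace_deg"
    by (simp add: trace_deg_def assms(1))
  have binom: "[(r - c - 1) choose i = 0] (mod p) \<longleftrightarrow> of_nat ((r - c - 1) choose i) = (0 :: 'p mod_ring)"
    by (simp only: of_nat_eq_0_mod_ring_iff cong_0_iff assms(1))
  show ?thesis
    unfolding c_def[symmetric] top binom
    using exact_top[of "det_char (int a - int i)"] exact_layer
      det_char_eq_power[of _ c "int a - int i", where 'p='p] c_cong assms(1) by blast
qed

end
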